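(* Let $G$ be an $n$-vertex graph of maximum degree $\Delta$. For every positive integer $x$, there is a deterministic distributed algorithm in the LOCAL model, operating directly on $G$ (without simulating the line graph of $G$), that computes a proper edge coloring of $G$ with $2^{x+1}\Delta$ colors within $\tilde O\big(x\cdot\Delta^{1/(2x+2)}\big)+O(\log^* n)$ rounds.
   Context: LOCAL model: the input graph is the communication network; each vertex is a processor with a unique ID of $O(\log n)$ bits and unbounded local computation; computation proceeds in synchronous rounds, in each of which every vertex may send a message of arbitrary size to each neighbor; running time is the number of rounds until all vertices terminate. Global parameters ($n$, $\Delta$, $x$) are assumed known to all vertices. In an edge coloring, edges sharing an endpoint receive distinct colors, and both endpoints of an edge must learn its color. $\tilde O(f)$ hides factors polylogarithmic in $\Delta$. *)

theory Defs
  imports Complex_Main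
begin

text \<open>Graphs: vertices are natural numbers, which double as the unique IDs.
  A simple graph is a finite vertex set with a symmetric irreflexive edge relation.\<close>

definition simple_graph :: "nat set \<Rightarrow> (nat \<Rightarrow> nat \<Rightarrow> bool) \<Rightarrow> bool" where
  "simple_graph V E \<longleftrightarrow> finite V \<and>
     (\<forall>u v. E u v \<longrightarrow> u \<in> V \<and> v \<in> V \<and> u \<noteq> v \<and> E v u)"

definition nbrs :: "(nat \<Rightarrow> nat \<Rightarrow> bool) \<Rightarrow> nat \<Rightarrow> nat set" where
  "nbrs E v = {u. E v u}"

definition degree :: "(nat \<Rightarrow> nat \<Rightarrow> bool) \<Rightarrow> nat \<Rightarrow> nat" where
  "degree E v = card (nbrs E v)"

definition max_degree_is :: "nat set \<Rightarrow> (nat \<Rightarrow> nat \<Rightarrow> bool) \<Rightarrow> nat \<Rightarrow> bool" where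
  "max_degree_is V E D \<longleftrightarrow> (\<forall>v\<in>V. degree E v \<le> D) \<and> (\<exists>v\<in>V. degree E v = D)"

text \<open>Deterministic synchronous LOCAL algorithm. Local states and messages are
  natural numbers (any finite knowledge can be encoded; messages are unbounded).
  init: own ID and set of neighbour IDs give the initial state;
  send: state and recipient neighbour ID give the message;
  step: state and received messages (indexed by sender ID) give the new state;
  out: final state and neighbour ID give the colour of the incident edge.\<close>
record local_alg =
  init :: "nat \<Rightarrow> nat set \<Rightarrow> nat"
  send :: "nat \<Rightarrow> nat \<Rightarrow> nat"
  step :: "nat \<Rightarrow> (nat \<Rightarrow> nat) \<Rightarrow> nat"
  out  :: "nat \<Rightarrow> nat \<Rightarrow> nat"

fun run :: "local_alg \<Rightarrow> (nat \<Rightarrow> nat \<Rightarrow> bool) \<Rightarrow> nat \<Rightarrow> nat \<Rightarrow> nat" where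
  "run A E 0 v = init A v (nbrs E v)"
| "run A E (Suc t) v =
     step A (run A E t v) (\<lambda>u. if E v u then send A (run A E t u) v else 0)"

definition edge_col :: "local_alg \<Rightarrow> (nat \<Rightarrow> nat \<Rightarrow> bool) \<Rightarrow> nat \<Rightarrow> nat \<Rightarrow> nat \<Rightarrow> nat" where
  "edge_col A E T v u = out A (run A E T v) u"

definition proper_edge_coloring :: "(nat \<Rightarrow> nat \<Rightarrow> bool) \<Rightarrow> (nat \<Rightarrow> nat \<Rightarrow> nat) \<Rightarrow> nat \<Rightarrow> bool" where
  "proper_edge_coloring E col K \<longleftrightarrow>
     (\<forall>u v. E u v \<longrightarrow> col u v = col v u \<and> col u v < K) \<and>
     (\<forall>v u w. E v u \<and> E v w \<and> u \<noteq> w \<longrightarrow> col v u \<noteq> col v w)"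

definition log_star :: "nat \<Rightarrow> nat" where
  "log_star n = (LEAST i. ((\<lambda>y. log 2 y) ^^ i) (real n) \<le> 1)"

end

theory Submission
  imports Defs "HOL-Library.FuncSet" "HOL-Library.Nat_Bijection"
begin

text \<open>Let every vertex cut its edges into groups of \<open>t\<close> and let only edges of a common group conflict.
  A proper colouring of this conflict graph with \<open>2 * t - 1\<close> colours leaves at most one edge of
  each group in every colour class, so the maximum degree within the classes drops by a factor \<open>t\<close>.
  Repeating this \<open>x + 1\<close> times with \<open>t\<close> about \<open>D powr (1 / (x + 1))\<close> makes every class a matching;
  the palettes multiply to at most \<open>2 ^ (x + 1) * D\<close>.

  A conflict graph of degree \<open>d\<close> is coloured with \<open>d + 1\<close> colours in about \<open>sqrt d\<close> rounds: split the
  uncoloured edges into about \<open>sqrt d\<close> classes, each carrying an order in which every edge has few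
  smaller neighbours, and treat the classes one after another. An edge that still has many uncoloured
  neighbours has a list of free colours that is quadratically longer than its number of smaller
  neighbours, which suffices for a constant-time list version of Linial's colour reduction. Each pass
  over the classes halves the uncoloured degree.\<close>

text \<open>The exponent \<open>1 / (2 * x + 2)\<close> has two sources: group size \<open>t\<close>
  near \<open>D powr (1 / (x + 1))\<close>, and time about \<open>sqrt t\<close> to colour a
  conflict graph of degree \<open>2 * (t - 1)\<close>. The square root is a balance. With
  \<open>p\<close> classes an edge has about \<open>d / p\<close> lower-ranked neighbours in its
  class, and the list argument needs lists of size about \<open>(d / p)\<^sup>2\<close>; more than
  \<open>d / 2\<close> uncoloured neighbours guarantee only about \<open>d / 2\<close> free colours.
  Hence \<open>p\<close> is about \<open>sqrt d\<close>, up to logarithms, and the classes take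
  \<open>p\<close> turns. Orders are needed because the edges of a class choose simultaneously: rank
  decides who avoids whom. No program is written stage by stage. A stage is a function of edges that
  is determined by the radius-\<open>T\<close> view of either endpoint, and one generic algorithm
  collects views. Nonconstructive choices, such as the probabilistic families, are then harmless:
  local computation is unbounded and a choice is one fixed function shared by all vertices. The
  \<open>log_star n\<close> term is paid once, for a colouring with a palette quadratic in
  \<open>D\<close>; all later stages reuse that colouring.\<close>

subsection \<open>Families for list colouring\<close>

text \<open>For a uniformly random \<open>f\<close> this is the tail bound
  \<open>(card Z / card B) ^ s\<close> on the probability of \<open>s\<close> hits, with
  denominators cleared. It is a union bound over the \<open>s\<close>-subsets of \<open>Z\<close>,
  each of which prescribes \<open>s\<close> coordinates. It is used twice: for random colours and
  for random family members.\<close>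

lemma card_functions_with_hits_le:
  fixes Z :: "('i \<times> 'b) set"
  assumes I: "finite I" and B: "finite B" and Z: "finite Z" "Z \<subseteq> I \<times> B"
  shows "card {f \<in> I \<rightarrow>\<^sub>E B. s \<le> card {i \<in> I. (i, f i) \<in> Z}} * card B ^ s
         \<le> card Z ^ s * card B ^ card I"
proof -
  let ?X = "{X. X \<subseteq> Z \<and> card X = s}"
  define H where "H X = {f \<in> I \<rightarrow>\<^sub>E B. \<forall>(i, y) \<in> X. f i = y}" for X
  have finX: "finite ?X" using Z(1) by simp
  have finF: "finite (I \<rightarrow>\<^sub>E B)" using I B by (simp add: finite_PiE)
  have sub: "{f \<in> I \<rightarrow>\<^sub>E B. s \<le> card {i \<in> I. (i, f i) \<in> Z}} \<subseteq> (\<Union>X\<in>?X. H X)"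
  proof
    fix f assume f: "f \<in> {f \<in> I \<rightarrow>\<^sub>E B. s \<le> card {i \<in> I. (i, f i) \<in> Z}}"
    then obtain J where J: "J \<subseteq> {i \<in> I. (i, f i) \<in> Z}" "card J = s"
      by (metis (no_types, lifting) mem_Collect_eq obtain_subset_with_card_n)
    have "card ((\<lambda>i. (i, f i)) ` J) = s"
      using J by (subst card_image) (auto simp: inj_on_def)
    then have "(\<lambda>i. (i, f i)) ` J \<in> ?X" using J by auto
    moreover have "f \<in> H ((\<lambda>i. (i, f i)) ` J)" using f by (auto simp: H_def)
    ultimately show "f \<in> (\<Union>X\<in>?X. H X)" by blast
  qed
  \<comment> \<open>If \<open>X\<close> prescribes two values for one coordinate, \<open>H X\<close>
    is empty. Otherwise \<open>X\<close> is the graph of a function on exactly \<open>s\<close>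
    coordinates.\<close>
  have each: "card (H X) * card B ^ s \<le> card B ^ card I" if X: "X \<in> ?X" for X
  proof (cases "H X = {}")
    case False
    then obtain f0 where f0: "f0 \<in> H X" by blast
    have Xf: "X = (\<lambda>i. (i, f0 i)) ` (fst ` X)"
      using f0 by (force simp: H_def)
    have inj: "inj_on fst X"
      by (subst Xf) (auto simp: inj_on_def)
    have cI: "card (fst ` X) = s" using X inj by (simp add: card_image)
    have sI: "fst ` X \<subseteq> I" using X Z(2) by auto
    have "H X \<subseteq> Pi\<^sub>E I (\<lambda>i. if i \<in> fst ` X then {f0 i} else B)"
    proof
      fix f assume f: "f \<in> H X"
      have "f i = f0 i" if i: "i \<in> fst ` X" for i
      proof -
        obtain y where "(i, y) \<in> X" using i by (elim imageE) (metis prod.collapse)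
        then show ?thesis using f f0 by (auto simp: H_def)
      qed
      then show "f \<in> Pi\<^sub>E I (\<lambda>i. if i \<in> fst ` X then {f0 i} else B)"
        using f by (auto simp: H_def PiE_iff)
    qed
    then have "card (H X) \<le> card (Pi\<^sub>E I (\<lambda>i. if i \<in> fst ` X then {f0 i} else B))"
      using I B by (intro card_mono finite_PiE) auto
    also have "\<dots> = (\<Prod>i\<in>I. if i \<in> fst ` X then 1 else card B)"
      using I by (auto simp: card_PiE intro!: prod.cong)
    also have "\<dots> = (\<Prod>i\<in>I - fst ` X. card B)"
      using I by (intro prod.mono_neutral_cong_right) auto
    also have "\<dots> = card B ^ (card I - s)"
      using sI cI I by (simp add: card_Diff_subset finite_subset)
    finally have "card (H X) * card B ^ s \<le> card B ^ (card I - s) * card B ^ s" by simp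
    also have "\<dots> = card B ^ card I"
      using sI cI I card_mono by (metis le_add_diff_inverse2 power_add)
    finally show ?thesis .
  qed simp
  have "card {f \<in> I \<rightarrow>\<^sub>E B. s \<le> card {i \<in> I. (i, f i) \<in> Z}} \<le> card (\<Union>X\<in>?X. H X)"
    using finX finF by (intro card_mono[OF _ sub]) (auto simp: H_def)
  also have "\<dots> \<le> (\<Sum>X\<in>?X. card (H X))" using finX by (rule card_UN_le)
  finally have "card {f \<in> I \<rightarrow>\<^sub>E B. s \<le> card {i \<in> I. (i, f i) \<in> Z}} * card B ^ s
      \<le> (\<Sum>X\<in>?X. card (H X)) * card B ^ s" by simp
  also have "\<dots> = (\<Sum>X\<in>?X. card (H X) * card B ^ s)" by (simp add: sum_distrib_right)
  also have "\<dots> \<le> (\<Sum>X\<in>?X. card B ^ card I)" by (intro sum_mono each)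
  also have "\<dots> = (card Z choose s) * card B ^ card I" using Z(1) by (simp add: n_subsets)
  also have "\<dots> \<le> card Z ^ s * card B ^ card I"
    by (cases "s \<le> card Z") (simp_all add: binomial_le_pow binomial_eq_0)
  finally show ?thesis .
qed

text \<open>Probabilistic method in two layers. Cut \<open>L\<close> into \<open>k\<close> blocks of
  size \<open>b\<close> and let a member take one random colour per block. It meets a fixed set of
  size at most \<open>k\<close> in \<open>s\<close> colours with probability at most
  \<open>(k / b) ^ s\<close>, so it is bad for \<open>F'\<close> with probability at most
  \<open>r / 2 ^ s\<close>. Among \<open>r\<close> independent members, \<open>t\<close> bad ones
  occur with probability at most \<open>(r * r / 2 ^ s) ^ t\<close>, hence at most
  \<open>1 / 2 ^ t\<close>, and fewer than \<open>2 ^ t\<close> families have to be avoided.\<close>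

lemma exists_weakly_intersecting_family:
  fixes L :: "'c set" and \<C> :: "(nat \<Rightarrow> 'c set) set"
  assumes L: "finite L" "card L = k * b" and k: "0 < k" "2 * k \<le> b"
    and r: "0 < r" "2 * r * r \<le> 2 ^ s"
    and \<C>: "finite \<C>" "card \<C> < 2 ^ t" "\<And>F j. F \<in> \<C> \<Longrightarrow> j < r \<Longrightarrow> finite (F j) \<and> card (F j) \<le> k"
  shows "\<exists>F. (\<forall>i<r. F i \<subseteq> L \<and> card (F i) = k) \<and>
           (\<forall>F'\<in>\<C>. card {i. i < r \<and> (\<exists>j<r. s \<le> card (F i \<inter> F' j))} < t)"
proof -
  let ?I = "{..<k}" and ?B = "{..<b}" and ?R = "{..<r}"
  obtain g where g: "bij_betw g (?I \<times> ?B) L"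
    using L by (metis card_cartesian_product card_lessThan finite_cartesian_product
        finite_lessThan finite_same_card_bij)
  have ginj: "inj_on g (?I \<times> ?B)" and gim: "g ` (?I \<times> ?B) = L"
    using g by (auto simp: bij_betw_def)
  define Sel where "Sel = ?I \<rightarrow>\<^sub>E ?B"
  define \<sigma> where "\<sigma> = card Sel"
  have finSel: "finite Sel" by (simp add: Sel_def finite_PiE)
  have \<sigma>: "\<sigma> = b ^ k" by (simp add: \<sigma>_def Sel_def card_PiE)
  have b: "0 < b" using k by simp
  then have \<sigma>pos: "0 < \<sigma>" by (simp add: \<sigma>)
  define C where "C f = (\<lambda>i. g (i, f i)) ` ?I" for f
  have Csub: "C f \<subseteq> L" if "f \<in> Sel" for f
    using that gim by (auto simp: C_def Sel_def PiE_iff)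
  have Cinj: "inj_on (\<lambda>i. g (i, f i)) ?I" if "f \<in> Sel" for f
  proof (rule inj_onI)
    fix i j assume ij: "i \<in> ?I" "j \<in> ?I" "g (i, f i) = g (j, f j)"
    have "f i < b" "f j < b" using that ij(1,2) by (auto simp: Sel_def PiE_iff)
    then have "(i, f i) = (j, f j)" using ij by (intro inj_onD[OF ginj]) auto
    then show "i = j" by simp
  qed
  have Ccard: "card (C f) = k" if "f \<in> Sel" for f
    unfolding C_def using card_image[OF Cinj[OF that]] by simp
  define Bad where "Bad F' = {f \<in> Sel. \<exists>j<r. s \<le> card (C f \<inter> F' j)}" for F'
  have Bad: "card (Bad F') * 2 ^ s \<le> r * \<sigma>" if F': "F' \<in> \<C>" for F'
  proof -
    define Z where "Z j = {z \<in> ?I \<times> ?B. g z \<in> F' j}" for j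
    have Z: "card (Z j) \<le> k" if "j < r" for j
    proof -
      have "card (Z j) = card (g ` Z j)"
        by (rule card_image[symmetric]) (rule inj_on_subset[OF ginj], auto simp: Z_def)
      also have "\<dots> \<le> card (F' j)"
        using \<C>(3)[OF F' that] by (intro card_mono) (auto simp: Z_def)
      finally show ?thesis using \<C>(3)[OF F' that] by simp
    qed
    let ?H = "\<lambda>j. {f \<in> ?I \<rightarrow>\<^sub>E ?B. s \<le> card {i \<in> ?I. (i, f i) \<in> Z j}}"
    have "card (C f \<inter> F' j) = card {i \<in> ?I. (i, f i) \<in> Z j}" if f: "f \<in> Sel" for f j
    proof -
      have "C f \<inter> F' j = (\<lambda>i. g (i, f i)) ` {i \<in> ?I. (i, f i) \<in> Z j}"
        using f by (auto simp: C_def Z_def Sel_def PiE_iff)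
      moreover have "inj_on (\<lambda>i. g (i, f i)) {i \<in> ?I. (i, f i) \<in> Z j}"
        by (rule inj_on_subset[OF Cinj[OF f]]) auto
      ultimately show ?thesis by (simp only: card_image)
    qed
    then have "Bad F' = (\<Union>j<r. ?H j)" by (auto simp: Bad_def Sel_def)
    then have "card (Bad F') \<le> (\<Sum>j<r. card (?H j))"
      using card_UN_le[of "{..<r}" ?H] by simp
    then have "card (Bad F') * b ^ s \<le> (\<Sum>j<r. card (?H j)) * b ^ s" by simp
    also have "\<dots> = (\<Sum>j<r. card (?H j) * b ^ s)" by (simp add: sum_distrib_right)
    also have "\<dots> \<le> (\<Sum>j<r. k ^ s * \<sigma>)"
    proof (rule sum_mono)
      fix j assume j: "j \<in> {..<r}"
      have "card (?H j) * card ?B ^ s \<le> card (Z j) ^ s * card ?B ^ card ?I"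
        by (rule card_functions_with_hits_le) (auto simp: Z_def)
      also have "\<dots> \<le> k ^ s * card ?B ^ card ?I"
        using Z j by (intro mult_right_mono power_mono) auto
      finally show "card (?H j) * b ^ s \<le> k ^ s * \<sigma>" by (simp add: \<sigma>)
    qed
    also have "\<dots> = k ^ s * (r * \<sigma>)" by simp
    finally have "card (Bad F') * b ^ s \<le> k ^ s * (r * \<sigma>)" .
    moreover have "2 ^ s * k ^ s \<le> b ^ s"
      using power_mono[OF k(2), of s] by (simp add: power_mult_distrib)
    then have "card (Bad F') * (2 ^ s * k ^ s) \<le> card (Bad F') * b ^ s" by (rule mult_left_mono) simp
    ultimately have "card (Bad F') * (2 ^ s * k ^ s) \<le> k ^ s * (r * \<sigma>)" by linarith
    then have "k ^ s * (card (Bad F') * 2 ^ s) \<le> k ^ s * (r * \<sigma>)"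
      by (simp only: mult_ac)
    then show ?thesis using k(1) by (simp add: mult_le_cancel1)
  qed
  define Fam where "Fam = ?R \<rightarrow>\<^sub>E Sel"
  define BF where "BF F' = {\<Phi> \<in> Fam. t \<le> card {i \<in> ?R. (i, \<Phi> i) \<in> ?R \<times> Bad F'}}" for F'
  have finFam: "finite Fam" using finSel by (simp add: Fam_def finite_PiE)
  have BF: "card (BF F') * 2 ^ t \<le> \<sigma> ^ r" if F': "F' \<in> \<C>" for F'
  proof -
    \<comment> \<open>Second layer: the coordinates are now the \<open>r\<close> members, and a hit
      is a bad member.\<close>
    have "card (BF F') * \<sigma> ^ t \<le> card (?R \<times> Bad F') ^ t * \<sigma> ^ card ?R"
      unfolding BF_def Fam_def \<sigma>_def
      by (rule card_functions_with_hits_le) (use finSel in \<open>auto simp: Bad_def\<close>)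
    then have "card (BF F') * \<sigma> ^ t * (2 ^ s) ^ t \<le> (r * card (Bad F')) ^ t * \<sigma> ^ r * (2 ^ s) ^ t"
      by (simp add: card_cartesian_product)
    also have "\<dots> = (r * (card (Bad F') * 2 ^ s)) ^ t * \<sigma> ^ r"
      by (simp only: power_mult_distrib mult_ac)
    also have "\<dots> \<le> (r * (r * \<sigma>)) ^ t * \<sigma> ^ r"
      using Bad[OF F'] by (intro mult_right_mono power_mono mult_left_mono) auto
    finally have "\<sigma> ^ t * (card (BF F') * (2 ^ s) ^ t) \<le> \<sigma> ^ t * ((r * r) ^ t * \<sigma> ^ r)"
      by (simp only: power_mult_distrib mult_ac)
    then have "card (BF F') * (2 ^ s) ^ t \<le> (r * r) ^ t * \<sigma> ^ r"
      using \<sigma>pos by (simp add: mult_le_cancel1)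
    moreover have "(2 * r * r) ^ t \<le> ((2::nat) ^ s) ^ t" using r(2) by (intro power_mono) auto
    then have "card (BF F') * (2 * r * r) ^ t \<le> card (BF F') * (2 ^ s) ^ t" by (rule mult_left_mono) simp
    ultimately have "card (BF F') * (2 * r * r) ^ t \<le> (r * r) ^ t * \<sigma> ^ r" by linarith
    then have "(r * r) ^ t * (card (BF F') * 2 ^ t) \<le> (r * r) ^ t * \<sigma> ^ r"
      by (simp only: power_mult_distrib mult_ac)
    then show ?thesis using r(1) by (simp add: mult_le_cancel1)
  qed
  have "\<not> Fam \<subseteq> (\<Union>F'\<in>\<C>. BF F')"
  proof
    assume sub: "Fam \<subseteq> (\<Union>F'\<in>\<C>. BF F')"
    have "card Fam \<le> card (\<Union>F'\<in>\<C>. BF F')"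
      using \<C>(1) finFam by (intro card_mono[OF _ sub]) (auto simp: BF_def)
    also have "\<dots> \<le> (\<Sum>F'\<in>\<C>. card (BF F'))" using \<C>(1) by (rule card_UN_le)
    finally have "\<sigma> ^ r * 2 ^ t \<le> (\<Sum>F'\<in>\<C>. card (BF F')) * 2 ^ t"
      by (simp add: Fam_def card_PiE \<sigma>_def)
    also have "\<dots> = (\<Sum>F'\<in>\<C>. card (BF F') * 2 ^ t)" by (simp add: sum_distrib_right)
    also have "\<dots> \<le> (\<Sum>F'\<in>\<C>. \<sigma> ^ r)" by (intro sum_mono BF)
    also have "\<dots> = card \<C> * \<sigma> ^ r" by simp
    also have "\<dots> < 2 ^ t * \<sigma> ^ r" using \<C>(2) \<sigma>pos by simp
    finally show False by (simp add: mult.commute)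
  qed
  then obtain \<Phi> where \<Phi>: "\<Phi> \<in> Fam" "\<And>F'. F' \<in> \<C> \<Longrightarrow> \<Phi> \<notin> BF F'" by auto
  have \<Phi>Sel: "\<Phi> i \<in> Sel" if "i < r" for i using \<Phi>(1) that by (auto simp: Fam_def)
  show ?thesis
  proof (intro exI[of _ "\<lambda>i. C (\<Phi> i)"] conjI allI impI ballI)
    fix i assume "i < r"
    then show "C (\<Phi> i) \<subseteq> L" "card (C (\<Phi> i)) = k" using \<Phi>Sel Csub Ccard by auto
  next
    fix F' assume F': "F' \<in> \<C>"
    have "{i. i < r \<and> (\<exists>j<r. s \<le> card (C (\<Phi> i) \<inter> F' j))} = {i \<in> ?R. (i, \<Phi> i) \<in> ?R \<times> Bad F'}"
      using \<Phi>Sel by (auto simp: Bad_def)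
    then show "card {i. i < r \<and> (\<exists>j<r. s \<le> card (C (\<Phi> i) \<inter> F' j))} < t"
      using \<Phi>(1) \<Phi>(2)[OF F'] by (simp add: BF_def)
  qed
qed

text \<open>Induction on the number of ranks: a family of the new rank is chosen against all
  families of smaller rank at once. There are at most \<open>2 ^ (d + 1)\<close> lists per rank,
  which is where the bound on \<open>M\<close> comes from. Families of equal rank are chosen
  independently of each other, since conflicting edges of one class never share a rank.\<close>

lemma exists_ranked_families:
  fixes d :: nat
  assumes k: "0 < k" "2 * k \<le> b" and r: "0 < r" "2 * r * r \<le> 2 ^ s" and M: "M * 2 ^ (d + 1) < 2 ^ t"
  shows "\<exists>F :: nat \<Rightarrow> nat set \<Rightarrow> nat \<Rightarrow> nat set.
     \<forall>\<rho><M. \<forall>L. L \<subseteq> {..d} \<and> card L = k * b \<longrightarrow>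
       (\<forall>i<r. F \<rho> L i \<subseteq> L \<and> card (F \<rho> L i) = k) \<and>
       (\<forall>\<rho>'<\<rho>. \<forall>L'. L' \<subseteq> {..d} \<and> card L' = k * b \<longrightarrow>
          card {i. i < r \<and> (\<exists>j<r. s \<le> card (F \<rho> L i \<inter> F \<rho>' L' j))} < t)"
  using M
proof (induction M)
  case 0
  then show ?case by simp
next
  case (Suc M)
  have "M * 2 ^ (d + 1) < 2 ^ t" using Suc.prems by simp
  from Suc.IH[OF this] obtain F :: "nat \<Rightarrow> nat set \<Rightarrow> nat \<Rightarrow> nat set" where F: "\<forall>\<rho><M. \<forall>L. L \<subseteq> {..d} \<and> card L = k * b \<longrightarrow>
       (\<forall>i<r. F \<rho> L i \<subseteq> L \<and> card (F \<rho> L i) = k) \<and>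
       (\<forall>\<rho>'<\<rho>. \<forall>L'. L' \<subseteq> {..d} \<and> card L' = k * b \<longrightarrow>
          card {i. i < r \<and> (\<exists>j<r. s \<le> card (F \<rho> L i \<inter> F \<rho>' L' j))} < t)"
    by (rule exE)
  let ?Ls = "{L. L \<subseteq> {..d} \<and> card L = k * b}"
  define \<C> where "\<C> = (\<lambda>(\<rho>, L). F \<rho> L) ` ({..<M} \<times> ?Ls)"
  have fin: "finite \<C>" by (simp add: \<C>_def)
  have "card ?Ls \<le> card (Pow {..d})" by (intro card_mono) auto
  then have "card ?Ls \<le> 2 ^ (d + 1)" by (simp add: card_Pow)
  then have "card ({..<M} \<times> ?Ls) \<le> M * 2 ^ (d + 1)"
    by (simp only: card_cartesian_product card_lessThan mult_le_mono2)
  then have "card \<C> \<le> M * 2 ^ (d + 1)"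
    unfolding \<C>_def by (intro order.trans[OF card_image_le]) auto
  then have card\<C>: "card \<C> < 2 ^ t" using Suc.prems by simp
  have "\<exists>G. (\<forall>i<r. G i \<subseteq> L \<and> card (G i) = k) \<and>
           (\<forall>F'\<in>\<C>. card {i. i < r \<and> (\<exists>j<r. s \<le> card (G i \<inter> F' j))} < t)" if L: "L \<in> ?Ls" for L
  proof (rule exists_weakly_intersecting_family[OF _ _ k r fin card\<C>])
    show "finite L" using L finite_subset by auto
    show "card L = k * b" using L by simp
    show "finite (F' j) \<and> card (F' j) \<le> k" if F': "F' \<in> \<C>" and j: "j < r" for F' j
    proof -
      obtain \<rho> L where "F' = F \<rho> L" "\<rho> < M" "L \<in> ?Ls" using F' unfolding \<C>_def by (elim imageE) (simp add: mem_Times_iff case_prod_beta)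
      then have "F' j \<subseteq> L" "card (F' j) = k" "finite L"
        using F j finite_subset[of L "{..d}"] by auto
      then show ?thesis by (simp add: finite_subset)
    qed
  qed
  then have "\<forall>L\<in>?Ls. \<exists>G. (\<forall>i<r. G i \<subseteq> L \<and> card (G i) = k) \<and>
           (\<forall>F'\<in>\<C>. card {i. i < r \<and> (\<exists>j<r. s \<le> card (G i \<inter> F' j))} < t)" by (rule ballI)
  from bchoice[OF this] obtain G where
    G: "\<forall>L\<in>?Ls. (\<forall>i<r. G L i \<subseteq> L \<and> card (G L i) = k) \<and>
           (\<forall>F'\<in>\<C>. card {i. i < r \<and> (\<exists>j<r. s \<le> card (G L i \<inter> F' j))} < t)" by (rule exE)
  have mem: "F \<rho> L \<in> \<C>" if "\<rho> < M" "L \<in> ?Ls" for \<rho> L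
    using that by (auto simp: \<C>_def)
  show ?case
  proof (intro exI[of _ "F(M := G)"] allI impI)
    fix \<rho> L assume \<rho>: "\<rho> < Suc M" and L: "L \<subseteq> {..d} \<and> card L = k * b"
    show "(\<forall>i<r. (F(M := G)) \<rho> L i \<subseteq> L \<and> card ((F(M := G)) \<rho> L i) = k) \<and>
       (\<forall>\<rho>'<\<rho>. \<forall>L'. L' \<subseteq> {..d} \<and> card L' = k * b \<longrightarrow>
          card {i. i < r \<and> (\<exists>j<r. s \<le> card ((F(M := G)) \<rho> L i \<inter> (F(M := G)) \<rho>' L' j))} < t)"
    proof (cases "\<rho> = M")
      case True
      then show ?thesis using bspec[OF G, of L] L mem by auto
    next
      case False
      then show ?thesis using F \<rho> L by auto
    qed
  qed
qed

text \<open>Each of the at most \<open>\<beta>\<close> lower pairs spoils fewer than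
  \<open>t\<close> of the \<open>\<beta> * t + 1\<close> members, so one member survives. The
  guarantee covers all members of the lower families, so an edge can choose without knowing what its
  neighbours choose. The size \<open>k = \<beta> * s + 1\<close> leaves a colour after
  \<open>\<beta>\<close> intersections of size below \<open>s\<close> are removed.\<close>

lemma exists_list_coloring_families:
  fixes d \<beta> s t M :: nat
  defines "k \<equiv> \<beta> * s + 1"
  defines "\<L> \<equiv> {L. L \<subseteq> {..d} \<and> card L = k * (2 * k)}"
  assumes s: "2 * (\<beta> * t + 1) * (\<beta> * t + 1) \<le> 2 ^ s" and M: "M * 2 ^ (d + 1) < 2 ^ t"
  shows "\<exists>K :: nat \<Rightarrow> nat set \<Rightarrow> nat set set. \<forall>\<rho><M. \<forall>L\<in>\<L>.
     (\<forall>S\<in>K \<rho> L. S \<subseteq> L \<and> card S = k) \<and>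
     (\<forall>P. finite P \<and> card P \<le> \<beta> \<and> P \<subseteq> {..<\<rho>} \<times> \<L> \<longrightarrow>
        (\<exists>S\<in>K \<rho> L. \<forall>(\<rho>', L')\<in>P. \<forall>S'\<in>K \<rho>' L'. card (S \<inter> S') < s))"
proof -
  define r where "r = \<beta> * t + 1"
  have "\<exists>F :: nat \<Rightarrow> nat set \<Rightarrow> nat \<Rightarrow> nat set.
     \<forall>\<rho><M. \<forall>L. L \<subseteq> {..d} \<and> card L = k * (2 * k) \<longrightarrow>
       (\<forall>i<r. F \<rho> L i \<subseteq> L \<and> card (F \<rho> L i) = k) \<and>
       (\<forall>\<rho>'<\<rho>. \<forall>L'. L' \<subseteq> {..d} \<and> card L' = k * (2 * k) \<longrightarrow>
          card {i. i < r \<and> (\<exists>j<r. s \<le> card (F \<rho> L i \<inter> F \<rho>' L' j))} < t)"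
    by (rule exists_ranked_families[OF _ _ _ _ M]) (use s in \<open>auto simp: k_def r_def\<close>)
  then obtain F :: "nat \<Rightarrow> nat set \<Rightarrow> nat \<Rightarrow> nat set" where F:
     "\<forall>\<rho><M. \<forall>L. L \<subseteq> {..d} \<and> card L = k * (2 * k) \<longrightarrow>
       (\<forall>i<r. F \<rho> L i \<subseteq> L \<and> card (F \<rho> L i) = k) \<and>
       (\<forall>\<rho>'<\<rho>. \<forall>L'. L' \<subseteq> {..d} \<and> card L' = k * (2 * k) \<longrightarrow>
          card {i. i < r \<and> (\<exists>j<r. s \<le> card (F \<rho> L i \<inter> F \<rho>' L' j))} < t)"
    by (rule exE)
  have F1: "F \<rho> L i \<subseteq> L \<and> card (F \<rho> L i) = k" if "\<rho> < M" "L \<in> \<L>" "i < r" for \<rho> L i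
    using F that by (auto simp: \<L>_def)
  have F2: "card {i. i < r \<and> (\<exists>j<r. s \<le> card (F \<rho> L i \<inter> F \<rho>' L' j))} < t"
    if "\<rho> < M" "L \<in> \<L>" "\<rho>' < \<rho>" "L' \<in> \<L>" for \<rho> L \<rho>' L'
    using F[rule_format, of \<rho> L] that by (auto simp: \<L>_def)
  show ?thesis
  proof (intro exI[of _ "\<lambda>\<rho> L. F \<rho> L ` {..<r}"] allI impI ballI conjI)
    fix \<rho> L S assume "\<rho> < M" "L \<in> \<L>" and "S \<in> F \<rho> L ` {..<r}"
    then obtain i where "i < r" "S = F \<rho> L i" by auto
    then show "S \<subseteq> L" "card S = k" using F1[OF \<open>\<rho> < M\<close> \<open>L \<in> \<L>\<close>] by simp_all
  next
    fix \<rho> L P assume \<rho>: "\<rho> < M" and L: "L \<in> \<L>"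
      and "finite P \<and> card P \<le> \<beta> \<and> P \<subseteq> {..<\<rho>} \<times> \<L>"
    then have P: "finite P" "card P \<le> \<beta>" "P \<subseteq> {..<\<rho>} \<times> \<L>" by auto
    define N where "N = (\<lambda>(\<rho>', L'). {i. i < r \<and> (\<exists>j<r. s \<le> card (F \<rho> L i \<inter> F \<rho>' L' j))})"
    have "card (\<Union>z\<in>P. N z) \<le> (\<Sum>z\<in>P. card (N z))" using P(1) by (rule card_UN_le)
    also have "\<dots> \<le> (\<Sum>z\<in>P. t)"
    proof (rule sum_mono)
      fix z assume "z \<in> P"
      then show "card (N z) \<le> t"
        using P(3) F2[OF \<rho> L, of "fst z" "snd z"] by (cases z) (auto simp: N_def)
    qed
    also have "\<dots> \<le> \<beta> * t" using P(2) by simp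
    finally have "card (\<Union>z\<in>P. N z) < card {..<r}" by (simp add: r_def)
    moreover have "finite (\<Union>z\<in>P. N z)" using P(1) by (auto simp: N_def)
    ultimately have "\<not> {..<r} \<subseteq> (\<Union>z\<in>P. N z)" by (meson card_mono leD)
    then obtain i where i: "i < r" "\<And>z. z \<in> P \<Longrightarrow> i \<notin> N z" by auto
    show "\<exists>S\<in>F \<rho> L ` {..<r}. \<forall>(\<rho>', L')\<in>P. \<forall>S'\<in>F \<rho>' L' ` {..<r}. card (S \<inter> S') < s"
    proof (rule bexI[of _ "F \<rho> L i"])
      show "\<forall>(\<rho>', L')\<in>P. \<forall>S'\<in>F \<rho>' L' ` {..<r}. card (F \<rho> L i \<inter> S') < s"
        using i by (force simp: N_def not_le)
    qed (use i in auto)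
  qed
qed

subsection \<open>Local functions on edges\<close>

definition edges :: "(nat \<Rightarrow> nat \<Rightarrow> bool) \<Rightarrow> nat set set" where
  "edges E = {{u, v} | u v. E u v}"

definition touching :: "(nat \<Rightarrow> nat \<Rightarrow> bool) \<Rightarrow> nat set \<Rightarrow> nat set set" where
  "touching E e = {e' \<in> edges E. e' \<inter> e \<noteq> {}}"

definition view :: "('b \<Rightarrow> 'a) \<Rightarrow> 'b set \<Rightarrow> 'b \<rightharpoonup> 'a" where
  "view f A = (\<lambda>e. if e \<in> A then Some (f e) else None)"

lemma view_eq_Some_iff [simp]: "view f A e = Some y \<longleftrightarrow> e \<in> A \<and> f e = y"
  by (auto simp: view_def)

section \<open>Views and the full-information algorithm\<close>

fun same_view :: "nat \<Rightarrow> (nat \<Rightarrow> nat \<Rightarrow> bool) \<Rightarrow> (nat \<Rightarrow> nat \<Rightarrow> bool) \<Rightarrow> nat \<Rightarrow> bool" where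
  "same_view 0 E E' u \<longleftrightarrow> nbrs E u = nbrs E' u"
| "same_view (Suc t) E E' u \<longleftrightarrow> same_view t E E' u \<and> (\<forall>w\<in>nbrs E u. same_view t E E' w)"

lemma same_view_mono: "same_view T' E E' u \<Longrightarrow> T \<le> T' \<Longrightarrow> same_view T E E' u"
  by (induction T') (auto simp: le_Suc_eq)

lemma same_view_nbrs: "same_view T E E' u \<Longrightarrow> nbrs E u = nbrs E' u"
  using same_view_mono[of T E E' u 0] by simp

text \<open>Every state starts with the encoded neighbour set: \<open>step\<close> receives the
  messages as a total function and has to know which of its values are real. Messages are stored
  tagged with their sender, so that the resulting finite set determines the state of each
  neighbour.\<close>

definition full_information :: "(nat \<Rightarrow> nat \<Rightarrow> nat) \<Rightarrow> local_alg" where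
  "full_information h = \<lparr>
     init = (\<lambda>v N. prod_encode (set_encode N, v)),
     send = (\<lambda>s u. s),
     step = (\<lambda>s msg. prod_encode (fst (prod_decode s),
        prod_encode (s, set_encode ((\<lambda>u. prod_encode (u, msg u)) ` set_decode (fst (prod_decode s)))))),
     out = h\<rparr>"

lemma run_full_information_Suc:
  fixes h
  defines "A \<equiv> full_information h"
  assumes "finite (nbrs E v)"
  shows "fst (prod_decode (run A E t v)) = set_encode (nbrs E v)" (is ?A)
    and "run A E (Suc t) v = prod_encode (set_encode (nbrs E v), prod_encode (run A E t v,
           set_encode ((\<lambda>u. prod_encode (u, run A E t u)) ` nbrs E v)))" (is ?B)
proof -
  show *: ?A
    by (induction t) (simp_all add: A_def full_information_def)
  show ?B
    using assms(2) * by (simp add: A_def full_information_def set_encode_inverse nbrs_def cong: image_cong_simp)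
qed

text \<open>Injectivity of the encodings recovers the identifier, the neighbour set and, through the
  sender tags, the previous state of each neighbour. A state therefore contains the whole
  view.\<close>

lemma run_full_information_inject:
  assumes fin: "\<And>v. finite (nbrs E v)" "\<And>v. finite (nbrs E' v)"
  shows "run (full_information h) E t u = run (full_information h) E' t u' \<Longrightarrow>
    u = u' \<and> same_view t E E' u"
proof (induction t arbitrary: u u')
  case 0
  then show ?case using fin by (auto simp: full_information_def set_encode_eq)
next
  case (Suc t)
  let ?r = "run (full_information h) E t" and ?r' = "run (full_information h) E' t"
  let ?im = "(\<lambda>w. prod_encode (w, ?r w)) ` nbrs E u" and ?im' = "(\<lambda>w. prod_encode (w, ?r' w)) ` nbrs E' u'"
  have eq: "?r u = ?r' u'" "set_encode ?im = set_encode ?im'"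
    using Suc.prems by (simp_all only: run_full_information_Suc(2)[OF fin(1)]
        run_full_information_Suc(2)[OF fin(2)] prod_encode_eq prod.inject)
  then have im: "?im = ?im'" using fin by (simp add: set_encode_eq)
  have "same_view t E E' w" if "w \<in> nbrs E u" for w
  proof -
    have "prod_encode (w, ?r w) \<in> ?im'" using that im by blast
    then have "?r w = ?r' w" by auto
    then show ?thesis using Suc.IH by blast
  qed
  then show ?case using Suc.IH[OF eq(1)] by auto
qed

section \<open>Edge functions computable in a given number of rounds\<close>

locale graph_family =
  fixes \<G> :: "(nat \<Rightarrow> nat \<Rightarrow> bool) set"
  assumes simple: "E \<in> \<G> \<Longrightarrow> \<exists>V. simple_graph V E"
begin

lemma edge_sym: "E \<in> \<G> \<Longrightarrow> E u v \<Longrightarrow> E v u"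
  using simple by (fastforce simp: simple_graph_def)

lemma edge_irrefl: "E \<in> \<G> \<Longrightarrow> \<not> E u u"
  using simple by (fastforce simp: simple_graph_def)

lemma finite_edges: "E \<in> \<G> \<Longrightarrow> finite (edges E)"
proof -
  assume "E \<in> \<G>"
  then obtain V where "simple_graph V E" using simple by blast
  then have "finite V" "edges E \<subseteq> Pow V" by (auto simp: simple_graph_def edges_def)
  then show ?thesis by (simp add: finite_subset)
qed

lemma finite_nbrs: "E \<in> \<G> \<Longrightarrow> finite (nbrs E v)"
proof -
  assume "E \<in> \<G>"
  then obtain V where "simple_graph V E" using simple by blast
  then have "finite V" "nbrs E v \<subseteq> V" by (auto simp: simple_graph_def nbrs_def)
  then show ?thesis by (simp add: finite_subset)
qed

lemma edge_iff: "E \<in> \<G> \<Longrightarrow> {u, v} \<in> edges E \<longleftrightarrow> E u v"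
  using edge_sym by (fastforce simp: edges_def doubleton_eq_iff)

lemma finite_touching: "E \<in> \<G> \<Longrightarrow> finite (touching E e)"
  using finite_edges by (simp add: touching_def)

lemma touching_self: "e \<in> edges E \<Longrightarrow> e \<in> touching E e"
  by (auto simp: touching_def edges_def)

text \<open>Computability of \<open>f\<close> in \<open>T\<close> rounds. The view of the endpoint
  \<open>u\<close> alone must determine the value; since \<open>E\<close> is symmetric this applies
  to both endpoints, so both learn it. Comparing all pairs of graphs in \<G> makes one algorithm
  serve the whole family.\<close>

definition loc :: "nat \<Rightarrow> ((nat \<Rightarrow> nat \<Rightarrow> bool) \<Rightarrow> nat set \<Rightarrow> 'a) \<Rightarrow> bool" where
  "loc T f \<longleftrightarrow> (\<forall>E\<in>\<G>. \<forall>E'\<in>\<G>. \<forall>u v. E u v \<longrightarrow> same_view T E E' u \<longrightarrow> f E {u, v} = f E' {u, v})"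

lemma loc_mono: "loc T f \<Longrightarrow> T \<le> T' \<Longrightarrow> loc T' f"
  unfolding loc_def using same_view_mono by blast

lemma loc_const: "loc T (\<lambda>E e. c e)"
  by (simp add: loc_def)

lemma loc_comp: "loc T f \<Longrightarrow> loc T (\<lambda>E e. h e (f E e))"
  unfolding loc_def by metis

lemma loc_comp2: "loc T f \<Longrightarrow> loc T g \<Longrightarrow> loc T (\<lambda>E e. h e (f E e) (g E e))"
  unfolding loc_def by metis

lemma loc_Pair: "loc T f \<Longrightarrow> loc T g \<Longrightarrow> loc T (\<lambda>E e. (f E e, g E e))"
  by (rule loc_comp2)

text \<open>Reading all adjacent edges costs a single round: an adjacent edge \<open>{v, w}\<close>
  is already known to \<open>v\<close> after \<open>T\<close> rounds, and \<open>v\<close> is a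
  neighbour of \<open>u\<close>. This is why working on the edges of the graph causes no overhead
  from simulating the line graph.\<close>

lemma loc_view_touching:
  assumes "loc T f"
  shows "loc (Suc T) (\<lambda>E e. view (f E) (touching E e))"
  unfolding loc_def
proof (intro ballI allI impI)
  fix E E' u v assume G: "E \<in> \<G>" "E' \<in> \<G>" and uv: "E u v" and same: "same_view (Suc T) E E' u"
  have s: "same_view T E E' u" "same_view T E E' v" using same uv by (auto simp: nbrs_def)
  have nb: "E u w = E' u w" "E v w = E' v w" for w
    using s[THEN same_view_nbrs] by (auto simp: nbrs_def set_eq_iff)
  have mem: "e \<in> touching H {u, v} \<longleftrightarrow> (\<exists>w. e = {u, w} \<and> H u w) \<or> (\<exists>w. e = {v, w} \<and> H v w)"
    if "H \<in> \<G>" for H e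
    using edge_sym[OF that] by (auto simp: touching_def edges_def insert_commute)
  have tch: "touching E {u, v} = touching E' {u, v}"
    using mem[OF G(1)] mem[OF G(2)] nb by auto
  have "f E e = f E' e" if e: "e \<in> touching E {u, v}" for e
  proof -
    from e consider w where "e = {u, w}" "E u w" | w where "e = {v, w}" "E v w"
      using mem[OF G(1)] by blast
    then show ?thesis
      using assms G s unfolding loc_def by cases blast+
  qed
  then show "view (f E) (touching E {u, v}) = view (f E') (touching E' {u, v})"
    using tch by (auto simp: view_def)
qed

text \<open>The choice operator turns a relational description of a round into a function of the
  edge and its view. Both endpoints thus make the same choice, and only the existence of a legal
  value has to be shown.\<close>

lemma loc_round:
  assumes f: "loc T f"
    and ex: "\<And>E e. E \<in> \<G> \<Longrightarrow> e \<in> edges E \<Longrightarrow> \<exists>x. R e (view (f E) (touching E e)) x"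
  shows "\<exists>g. loc (Suc T) g \<and> (\<forall>E\<in>\<G>. \<forall>e\<in>edges E. R e (view (f E) (touching E e)) (g E e))"
proof (intro exI[of _ "\<lambda>E e. SOME x. R e (view (f E) (touching E e)) x"] conjI ballI)
  show "loc (Suc T) (\<lambda>E e. SOME x. R e (view (f E) (touching E e)) x)"
    by (rule loc_comp[OF loc_view_touching[OF f]])
qed (use ex in \<open>auto intro: someI_ex\<close>)

text \<open>A subgraph of the line graph with bounded degree whose adjacency is itself computed in
  \<open>T\<close> rounds.\<close>

definition conflict_graph :: "nat \<Rightarrow> ((nat \<Rightarrow> nat \<Rightarrow> bool) \<Rightarrow> nat set \<Rightarrow> nat set set) \<Rightarrow> nat \<Rightarrow> bool" where
  "conflict_graph T nb d \<longleftrightarrow> loc T nb \<and> (\<forall>E\<in>\<G>. \<forall>e\<in>edges E.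
     nb E e \<subseteq> touching E e \<and> e \<notin> nb E e \<and> (\<forall>e'\<in>nb E e. e \<in> nb E e') \<and> card (nb E e) \<le> d)"

lemma conflict_graphD:
  assumes "conflict_graph T nb d" "E \<in> \<G>" "e \<in> edges E"
  shows "nb E e \<subseteq> touching E e" "e \<notin> nb E e" "\<And>e'. e' \<in> nb E e \<Longrightarrow> e \<in> nb E e'"
    "card (nb E e) \<le> d" "finite (nb E e)" "\<And>e'. e' \<in> nb E e \<Longrightarrow> e' \<in> edges E"
proof -
  show nb: "nb E e \<subseteq> touching E e" "e \<notin> nb E e" "\<And>e'. e' \<in> nb E e \<Longrightarrow> e \<in> nb E e'"
    "card (nb E e) \<le> d" using assms by (auto simp: conflict_graph_def)
  show "finite (nb E e)" using nb(1) finite_touching[OF assms(2)] finite_subset by blast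
  show "\<And>e'. e' \<in> nb E e \<Longrightarrow> e' \<in> edges E" using nb(1) by (auto simp: touching_def)
qed

lemma conflict_graph_mono: "conflict_graph T nb d \<Longrightarrow> T \<le> T' \<Longrightarrow> conflict_graph T' nb d"
  using loc_mono by (auto simp: conflict_graph_def)

lemma conflict_round:
  assumes nb: "conflict_graph T nb d" and f: "loc T f"
    and ex: "\<And>E e. E \<in> \<G> \<Longrightarrow> e \<in> edges E \<Longrightarrow> \<exists>x. R e (f E e) (view (f E) (nb E e)) x"
  shows "\<exists>g. loc (Suc T) g \<and> (\<forall>E\<in>\<G>. \<forall>e\<in>edges E. R e (f E e) (view (f E) (nb E e)) (g E e))"
proof -
  \<comment> \<open>The neighbourhood travels together with the value: an edge finds its own entry
    in its view and uses the set stored there to filter the other entries.\<close>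
  let ?F = "\<lambda>E e. (nb E e, f E e)"
  define R' where "R' e N x = (case the (N e) of (A, y) \<Rightarrow>
      R e y (\<lambda>e'. if e' \<in> A then map_option snd (N e') else None) x)" for e N x
  have R': "R' e (view (?F E) (touching E e)) = R e (f E e) (view (f E) (nb E e))"
    if "E \<in> \<G>" "e \<in> edges E" for E e
  proof -
    have "(\<lambda>e'. if e' \<in> nb E e then map_option snd (view (?F E) (touching E e) e') else None)
        = view (f E) (nb E e)"
      using conflict_graphD(1)[OF nb that] by (intro ext) (auto simp: view_def)
    moreover have "view (?F E) (touching E e) e = Some (nb E e, f E e)"
      using touching_self[OF that(2)] by simp
    ultimately show ?thesis by (intro ext) (simp only: R'_def option.sel prod.case)
  qed
  have "\<exists>g. loc (Suc T) g \<and> (\<forall>E\<in>\<G>. \<forall>e\<in>edges E. R' e (view (?F E) (touching E e)) (g E e))"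
    using nb f ex by (intro loc_round loc_Pair) (auto simp: R' conflict_graph_def)
  then show ?thesis by (simp add: R')
qed

text \<open>The output map guesses any graph of the family and any vertex with the given final
  state. The guess may be a different graph, but it has the same identifier and the same view there,
  so \<open>f\<close> takes the right value.\<close>

lemma loc_imp_local_alg:
  assumes "loc T f"
  shows "\<exists>A. \<forall>E\<in>\<G>. \<forall>u v. E u v \<longrightarrow> edge_col A E T u v = f E {u, v}"
proof -
  let ?r = "\<lambda>h. run (full_information h)"
  \<comment> \<open>States do not depend on the output map. Hence \<open>h\<close> can be defined
    from runs with \<open>undefined\<close> in its place, without circularity.\<close>
  have rh: "?r h E t v = ?r h' E t v" for h h' E t v
  proof -
    have "init (full_information h) = init (full_information h')"
      "send (full_information h) = send (full_information h')"
      "step (full_information h) = step (full_information h')"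
      by (simp_all add: full_information_def)
    then show ?thesis by (induction t arbitrary: v) (simp_all cong: if_cong)
  qed
  define h where "h s v = (let z = SOME z. fst z \<in> \<G> \<and> ?r undefined (fst z) T (snd z) = s
       in f (fst z) {snd z, v})" for s v
  show ?thesis
  proof (intro exI[of _ "full_information h"] ballI allI impI)
    fix E u v assume E: "E \<in> \<G>" and uv: "E u v"
    let ?P = "\<lambda>z. fst z \<in> \<G> \<and> ?r undefined (fst z) T (snd z) = ?r h E T u"
    define z where "z = (SOME z. ?P z)"
    have "?P (E, u)" using E by (simp add: rh[of undefined _ _ _ h])
    then have z: "?P z" unfolding z_def by (rule someI)
    then have "?r h E T u = ?r h (fst z) T (snd z)" by (simp add: rh[of undefined _ _ _ h])
    then have "u = snd z \<and> same_view T E (fst z) u"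
      using z E by (intro run_full_information_inject[of E "fst z" h] finite_nbrs) auto
    then have "f E {u, v} = f (fst z) {snd z, v}"
      using assms z E uv by (auto simp: loc_def)
    then show "edge_col (full_information h) E T u v = f E {u, v}"
      by (simp add: edge_col_def full_information_def h_def z_def Let_def)
  qed
qed

end

subsection \<open>Ranked classes of small degree\<close>

lemma exists_light_fibre:
  assumes "finite A" "card A \<le> a" "0 < (p::nat)"
  shows "\<exists>x<p. card {e \<in> A. h e = x} \<le> a div p"
proof (rule ccontr)
  assume "\<not> ?thesis"
  then have *: "a div p + 1 \<le> card {e \<in> A. h e = x}" if "x < p" for x
    using that by (force simp: not_le)
  have "a < p * (a div p + 1)"
    using assms(3) by (simp add: dividend_less_times_div)
  also have "\<dots> = (\<Sum>x<p. a div p + 1)" by simp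
  also have "\<dots> \<le> (\<Sum>x<p. card {e \<in> A. h e = x})" using * by (intro sum_mono) auto
  also have "\<dots> = card (\<Union>x<p. {e \<in> A. h e = x})"
    using assms(1) by (subst card_UN_disjoint) auto
  also have "\<dots> \<le> card A" using assms(1) by (intro card_mono) auto
  finally show False using assms(2) by simp
qed

context graph_family
begin

text \<open>An arbdefective colouring with an explicit acyclic orientation: inside a class conflicts
  point to the lower rank, with out-degree at most \<open>w\<close>. The number \<open>M\<close> of
  ranks is recorded because it enters the size of the families for list colouring.\<close>

definition ranked_classes where
  "ranked_classes T nb \<kappa> \<rho> Q M w \<longleftrightarrow> loc T \<kappa> \<and> loc T \<rho> \<and> (\<forall>E\<in>\<G>. \<forall>e\<in>edges E.
     \<kappa> E e < (Q::nat) \<and> \<rho> E e < (M::nat) \<and> (\<forall>e'\<in>nb E e. \<kappa> E e' = \<kappa> E e \<longrightarrow> \<rho> E e' \<noteq> \<rho> E e) \<and>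
     card {e' \<in> nb E e. \<kappa> E e' = \<kappa> E e \<and> \<rho> E e' < \<rho> E e} \<le> w)"

lemma ranked_classesD:
  assumes "ranked_classes T nb \<kappa> \<rho> Q M w"
  shows "loc T \<kappa>" "loc T \<rho>"
    and "\<And>E e. E \<in> \<G> \<Longrightarrow> e \<in> edges E \<Longrightarrow> \<kappa> E e < Q"
    and "\<And>E e. E \<in> \<G> \<Longrightarrow> e \<in> edges E \<Longrightarrow> \<rho> E e < M"
    and "\<And>E e e'. E \<in> \<G> \<Longrightarrow> e \<in> edges E \<Longrightarrow> e' \<in> nb E e \<Longrightarrow> \<kappa> E e' = \<kappa> E e \<Longrightarrow> \<rho> E e' \<noteq> \<rho> E e"
    and "\<And>E e. E \<in> \<G> \<Longrightarrow> e \<in> edges E \<Longrightarrow> card {e' \<in> nb E e. \<kappa> E e' = \<kappa> E e \<and> \<rho> E e' < \<rho> E e} \<le> w"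
  using assms by (auto simp: ranked_classes_def)

text \<open>The Kuhn--Wattenhofer reduction, with conflicts tolerated: the \<open>2 * p\<close> classes of a block act
  one after another, and an edge picks the one of the \<open>p\<close> new classes of its block that is least used
  by its neighbours so far. Ranking edges lexicographically by time of action and old rank keeps
  the number of lower-ranked neighbours in the same class under control.\<close>
lemma ranked_classes_halve:
  assumes nb: "conflict_graph T nb a" and p: "0 < p"
    and rc: "ranked_classes T nb \<kappa> \<rho> (2 * p * q) M w"
  shows "\<exists>\<kappa>' \<rho>'. ranked_classes (T + 2 * p) nb \<kappa>' \<rho>' (p * q) (2 * p * M) (w + a div p)"
proof -
  note \<kappa> = ranked_classesD[OF rc]
  \<comment> \<open>After \<open>i\<close> turns the edges whose old class has residue below
    \<open>i\<close> have chosen. Only neighbours in the same block with a smaller residue are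
    counted, so later choices cannot spoil the bound.\<close>
  have "\<exists>j. loc (T + i) j \<and> (\<forall>E\<in>\<G>. \<forall>e\<in>edges E. \<kappa> E e mod (2 * p) < i \<longrightarrow> j E e < p \<and>
      card {e' \<in> nb E e. \<kappa> E e' div (2 * p) = \<kappa> E e div (2 * p) \<and>
        \<kappa> E e' mod (2 * p) < \<kappa> E e mod (2 * p) \<and> j E e' = j E e} \<le> a div p)" for i
  proof (induction i)
    case 0
    show ?case by (rule exI[of _ "\<lambda>_ _. 0"]) (simp add: loc_const)
  next
    case (Suc i)
    then obtain j where j: "loc (T + i) j" and
      jp: "\<And>E e. E \<in> \<G> \<Longrightarrow> e \<in> edges E \<Longrightarrow> \<kappa> E e mod (2 * p) < i \<Longrightarrow> j E e < p \<and>
      card {e' \<in> nb E e. \<kappa> E e' div (2 * p) = \<kappa> E e div (2 * p) \<and>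
        \<kappa> E e' mod (2 * p) < \<kappa> E e mod (2 * p) \<and> j E e' = j E e} \<le> a div p" by blast
    have nb': "conflict_graph (T + i) nb a" using conflict_graph_mono[OF nb] by simp
    have f: "loc (T + i) (\<lambda>E e. (\<kappa> E e, j E e))"
      using j loc_mono[OF \<kappa>(1)] by (intro loc_Pair) auto
    define R where "R = (\<lambda>(e :: nat set) (y :: nat \<times> nat) (N :: nat set \<Rightarrow> (nat \<times> nat) option) x. if fst y mod (2 * p) = i then x < p \<and>
       card {e'. \<exists>k' j'. N e' = Some (k', j') \<and> k' div (2 * p) = fst y div (2 * p) \<and>
          k' mod (2 * p) < fst y mod (2 * p) \<and> j' = x} \<le> a div p else x = snd y)"
    have "\<exists>g. loc (Suc (T + i)) g \<and> (\<forall>E\<in>\<G>. \<forall>e\<in>edges E.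
        R e (\<kappa> E e, j E e) (view (\<lambda>e. (\<kappa> E e, j E e)) (nb E e)) (g E e))"
    proof (rule conflict_round[OF nb' f])
      fix E e assume E: "E \<in> \<G>" "e \<in> edges E"
      let ?A = "{e' \<in> nb E e. \<kappa> E e' div (2 * p) = \<kappa> E e div (2 * p) \<and> \<kappa> E e' mod (2 * p) < \<kappa> E e mod (2 * p)}"
      have "card ?A \<le> card (nb E e)"
        using conflict_graphD(5)[OF nb E] by (intro card_mono) auto
      then have "\<exists>x<p. card {e' \<in> ?A. j E e' = x} \<le> a div p"
        using conflict_graphD(4,5)[OF nb E] p by (intro exists_light_fibre) auto
      then show "\<exists>x. R e (\<kappa> E e, j E e) (view (\<lambda>e. (\<kappa> E e, j E e)) (nb E e)) x"
        by (auto simp: R_def conj_assoc)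
    qed
    then obtain g where g: "loc (Suc (T + i)) g" and
      gR: "\<And>E e. E \<in> \<G> \<Longrightarrow> e \<in> edges E \<Longrightarrow>
        R e (\<kappa> E e, j E e) (view (\<lambda>e. (\<kappa> E e, j E e)) (nb E e)) (g E e)" by blast
    have g_old: "g E e = j E e" if "E \<in> \<G>" "e \<in> edges E" "\<kappa> E e mod (2 * p) < i" for E e
      using gR[OF that(1,2)] that(3) by (simp add: R_def)
    show ?case
    proof (intro exI[of _ g] conjI ballI impI)
      show "loc (T + Suc i) g" using g by simp
    next
      fix E e assume E: "E \<in> \<G>" "e \<in> edges E" and e: "\<kappa> E e mod (2 * p) < Suc i"
      let ?S = "\<lambda>j x. {e' \<in> nb E e. \<kappa> E e' div (2 * p) = \<kappa> E e div (2 * p) \<and>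
           \<kappa> E e' mod (2 * p) < \<kappa> E e mod (2 * p) \<and> j E e' = (x::nat)}"
      have eq: "?S g x = ?S j x" for x
        using g_old[OF E(1) conflict_graphD(6)[OF nb E]] e by auto
      have "g E e < p \<and> card (?S j (g E e)) \<le> a div p"
      proof (cases "\<kappa> E e mod (2 * p) = i")
        case True
        then show ?thesis using gR[OF E] by (simp add: R_def conj_ac)
      next
        case False
        then have "\<kappa> E e mod (2 * p) < i" using e by simp
        then show ?thesis using jp[OF E] g_old[OF E] by simp
      qed
      then show "g E e < p" "card (?S g (g E e)) \<le> a div p" unfolding eq by auto
    qed
  qed
  from this[of "2 * p"] p obtain j where j: "loc (T + 2 * p) j" and
    jp: "\<And>E e. E \<in> \<G> \<Longrightarrow> e \<in> edges E \<Longrightarrow> j E e < p \<and>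
      card {e' \<in> nb E e. \<kappa> E e' div (2 * p) = \<kappa> E e div (2 * p) \<and>
        \<kappa> E e' mod (2 * p) < \<kappa> E e mod (2 * p) \<and> j E e' = j E e} \<le> a div p" by auto
  define \<kappa>' where "\<kappa>' E e = \<kappa> E e div (2 * p) * p + j E e" for E e
  \<comment> \<open>Turn first, old rank second. A lower-ranked neighbour in the new class either
    acted earlier, and there are at most \<open>a div p\<close> of those, or comes from the same old
    class, where \<open>w\<close> bounds the number.\<close>
  define \<rho>' where "\<rho>' E e = \<kappa> E e mod (2 * p) * M + \<rho> E e" for E e
  have \<kappa>\<rho>: "loc (T + 2 * p) \<kappa>" "loc (T + 2 * p) \<rho>" using loc_mono[OF \<kappa>(1)] loc_mono[OF \<kappa>(2)] by simp_all
  have loc': "loc (T + 2 * p) \<kappa>'" "loc (T + 2 * p) \<rho>'"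
    using loc_comp2[OF \<kappa>\<rho>(1) j, of "\<lambda>e k j. k div (2 * p) * p + j"]
      loc_comp2[OF \<kappa>\<rho>, of "\<lambda>e k r. k mod (2 * p) * M + r"]
    by (simp_all add: \<kappa>'_def[abs_def] \<rho>'_def[abs_def])
  have \<kappa>'_eq: "\<kappa> E e' div (2 * p) = \<kappa> E e div (2 * p) \<and> j E e' = j E e"
    if "\<kappa>' E e' = \<kappa>' E e" "E \<in> \<G>" "e \<in> edges E" "e' \<in> edges E" for E e e'
  proof -
    have "j E e < p" "j E e' < p" using jp that by auto
    then have "\<kappa>' E e div p = \<kappa> E e div (2 * p)" "\<kappa>' E e' div p = \<kappa> E e' div (2 * p)"
      "\<kappa>' E e mod p = j E e" "\<kappa>' E e' mod p = j E e'" using p by (simp_all add: \<kappa>'_def)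
    then show ?thesis using that(1) by metis
  qed
  have \<rho>'_div: "\<rho>' E e div M = \<kappa> E e mod (2 * p) \<and> \<rho>' E e mod M = \<rho> E e"
    if "E \<in> \<G>" "e \<in> edges E" for E e
    using \<kappa>(4)[OF that] by (auto simp: \<rho>'_def)
  have "ranked_classes (T + 2 * p) nb \<kappa>' \<rho>' (p * q) (2 * p * M) (w + a div p)"
    unfolding ranked_classes_def
  proof (intro conjI loc' ballI impI)
    fix E e assume E: "E \<in> \<G>" "e \<in> edges E"
    have "\<kappa> E e div (2 * p) < q" using \<kappa>(3)[OF E] p by (simp add: less_mult_imp_div_less mult.commute)
    then have "\<kappa> E e div (2 * p) + 1 \<le> q" by simp
    then have "(\<kappa> E e div (2 * p) + 1) * p \<le> q * p" by (rule mult_le_mono1)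
    then show "\<kappa>' E e < p * q" using jp[OF E] by (simp add: \<kappa>'_def algebra_simps)
    have "\<kappa> E e mod (2 * p) + 1 \<le> 2 * p" using p by (simp add: Suc_le_eq)
    then have "(\<kappa> E e mod (2 * p) + 1) * M \<le> 2 * p * M" by (rule mult_le_mono1)
    then show "\<rho>' E e < 2 * p * M" using \<kappa>(4)[OF E] by (simp add: \<rho>'_def algebra_simps)
    have same: "\<kappa> E e' = \<kappa> E e"
      if "\<kappa> E e' div (2 * p) = \<kappa> E e div (2 * p)" "\<kappa> E e' mod (2 * p) = \<kappa> E e mod (2 * p)" for e'
      using that by (metis div_mult_mod_eq)
    {
      fix e' assume e': "e' \<in> nb E e" "\<kappa>' E e' = \<kappa>' E e"
      have E': "e' \<in> edges E" using conflict_graphD(6)[OF nb E e'(1)] .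
      show "\<rho>' E e' \<noteq> \<rho>' E e"
      proof
        assume "\<rho>' E e' = \<rho>' E e"
        then have "\<kappa> E e' mod (2 * p) = \<kappa> E e mod (2 * p)" "\<rho> E e' = \<rho> E e"
          using \<rho>'_div[OF E] \<rho>'_div[OF E(1) E'] by metis+
        then show False using \<kappa>'_eq[OF e'(2) E E'] same \<kappa>(5)[OF E e'(1)] by blast
      qed
    }
    let ?A = "{e' \<in> nb E e. \<kappa> E e' = \<kappa> E e \<and> \<rho> E e' < \<rho> E e}"
    let ?B = "{e' \<in> nb E e. \<kappa> E e' div (2 * p) = \<kappa> E e div (2 * p) \<and>
        \<kappa> E e' mod (2 * p) < \<kappa> E e mod (2 * p) \<and> j E e' = j E e}"
    have "{e' \<in> nb E e. \<kappa>' E e' = \<kappa>' E e \<and> \<rho>' E e' < \<rho>' E e} \<subseteq> ?A \<union> ?B"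
    proof
      fix e' assume "e' \<in> {e' \<in> nb E e. \<kappa>' E e' = \<kappa>' E e \<and> \<rho>' E e' < \<rho>' E e}"
      then have e': "e' \<in> nb E e" "\<kappa>' E e' = \<kappa>' E e" "\<rho>' E e' < \<rho>' E e" by auto
      have E': "e' \<in> edges E" using conflict_graphD(6)[OF nb E e'(1)] .
      have "\<rho>' E e' div M \<le> \<rho>' E e div M" using e'(3) by (intro div_le_mono) simp
      then have "\<kappa> E e' mod (2 * p) \<le> \<kappa> E e mod (2 * p)"
        using \<rho>'_div[OF E] \<rho>'_div[OF E(1) E'] by simp
      then consider "\<kappa> E e' mod (2 * p) < \<kappa> E e mod (2 * p)" | "\<kappa> E e' mod (2 * p) = \<kappa> E e mod (2 * p)"
        by linarith
      then show "e' \<in> ?A \<union> ?B"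
      proof cases
        case 1
        then show ?thesis using e'(1) \<kappa>'_eq[OF e'(2) E E'] by simp
      next
        case 2
        then have "\<rho> E e' < \<rho> E e" using e'(3) by (simp add: \<rho>'_def)
        then show ?thesis using e'(1) \<kappa>'_eq[OF e'(2) E E'] same[OF _ 2] by simp
      qed
    qed
    then have "card {e' \<in> nb E e. \<kappa>' E e' = \<kappa>' E e \<and> \<rho>' E e' < \<rho>' E e} \<le> card (?A \<union> ?B)"
      using conflict_graphD(5)[OF nb E] by (intro card_mono) auto
    also have "\<dots> \<le> card ?A + card ?B" by (rule card_Un_le)
    also have "\<dots> \<le> w + a div p" using \<kappa>(6)[OF E] jp[OF E] by simp
    finally show "card {e' \<in> nb E e. \<kappa>' E e' = \<kappa>' E e \<and> \<rho>' E e' < \<rho>' E e} \<le> w + a div p" .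
  qed
  then show ?thesis by blast
qed

text \<open>The number of lower neighbours grows only additively, by \<open>a div p\<close> per
  halving. The start is a proper colouring with constant rank 0 and \<open>w = 0\<close>, as no
  conflict lies inside a class.\<close>

lemma exists_ranked_classes:
  assumes nb: "conflict_graph T nb a" and p: "0 < p" and \<psi>: "loc T \<psi>"
    and \<psi>_lt: "\<And>E e. E \<in> \<G> \<Longrightarrow> e \<in> edges E \<Longrightarrow> \<psi> E e < p * 2 ^ S"
    and \<psi>_ne: "\<And>E e e'. E \<in> \<G> \<Longrightarrow> e \<in> edges E \<Longrightarrow> e' \<in> nb E e \<Longrightarrow> \<psi> E e' \<noteq> \<psi> E e"
  shows "\<exists>\<kappa> \<rho>. ranked_classes (T + 2 * p * S) nb \<kappa> \<rho> p ((2 * p) ^ S) (S * (a div p))"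
proof -
  have "\<exists>\<kappa> \<rho>. ranked_classes (T + 2 * p * i) nb \<kappa> \<rho> (p * 2 ^ (S - i)) ((2 * p) ^ i) (i * (a div p))"
    if "i \<le> S" for i
    using that
  proof (induction i)
    case 0
    have "ranked_classes T nb \<psi> (\<lambda>_ _. 0) (p * 2 ^ S) 1 0"
      using \<psi> \<psi>_lt \<psi>_ne by (auto simp: ranked_classes_def loc_const)
    then show ?case by auto
  next
    case (Suc i)
    then obtain \<kappa> \<rho> where "ranked_classes (T + 2 * p * i) nb \<kappa> \<rho> (p * 2 ^ (S - i)) ((2 * p) ^ i) (i * (a div p))"
      by auto
    moreover have "p * 2 ^ (S - i) = 2 * p * 2 ^ (S - Suc i)"
      using Suc.prems by (simp add: Suc_diff_Suc flip: power_Suc)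
    ultimately have "\<exists>\<kappa>' \<rho>'. ranked_classes (T + 2 * p * i + 2 * p) nb \<kappa>' \<rho>'
        (p * 2 ^ (S - Suc i)) (2 * p * (2 * p) ^ i) (i * (a div p) + a div p)"
      using conflict_graph_mono[OF nb] p by (intro ranked_classes_halve) auto
    moreover have "T + 2 * p * i + 2 * p = T + 2 * p * Suc i" "i * (a div p) + a div p = Suc i * (a div p)"
      by simp_all
    ultimately show ?case by (simp only: power_Suc)
  qed
  from this[of S] show ?thesis by simp
qed

end

subsection \<open>Colouring with degree plus one colours\<close>

context graph_family
begin

definition partial_coloring where
  "partial_coloring T nb d c \<longleftrightarrow> loc T c \<and> (\<forall>E\<in>\<G>. \<forall>e\<in>edges E. \<forall>x::nat. c E e = Some x \<longrightarrow>
     x \<le> d \<and> (\<forall>e'\<in>nb E e. c E e' \<noteq> Some x))"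

lemma partial_coloringD:
  assumes "partial_coloring T nb d c"
  shows "loc T c"
    and "\<And>E e x. E \<in> \<G> \<Longrightarrow> e \<in> edges E \<Longrightarrow> c E e = Some x \<Longrightarrow> x \<le> d"
    and "\<And>E e e' x. E \<in> \<G> \<Longrightarrow> e \<in> edges E \<Longrightarrow> e' \<in> nb E e \<Longrightarrow> c E e = Some x \<Longrightarrow> c E e' \<noteq> Some x"
  using assms by (auto simp: partial_coloring_def)

text \<open>Each coloured neighbour blocks at most one of \<open>d + 1\<close> colours, and there
  are at most \<open>d\<close> neighbours in total.\<close>

lemma card_free_colors:
  assumes nb: "conflict_graph T nb d" and E: "E \<in> \<G>" "e \<in> edges E"
  shows "card {e' \<in> nb E e. c E e' = None} + 1 \<le> card {x. x \<le> d \<and> (\<forall>e'\<in>nb E e. c E e' \<noteq> Some x)}"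
proof -
  let ?U = "{e' \<in> nb E e. c E e' = None}" and ?C = "{e' \<in> nb E e. c E e' \<noteq> None}"
  let ?F = "{x. x \<le> d \<and> (\<forall>e'\<in>nb E e. c E e' \<noteq> Some x)}"
  note fin = conflict_graphD(5)[OF nb E]
  have "{..d} \<subseteq> ?F \<union> (\<lambda>e'. the (c E e')) ` ?C" by force
  then have "card {..d} \<le> card (?F \<union> (\<lambda>e'. the (c E e')) ` ?C)"
    using fin by (intro card_mono) auto
  also have "\<dots> \<le> card ?F + card ((\<lambda>e'. the (c E e')) ` ?C)" by (rule card_Un_le)
  also have "\<dots> \<le> card ?F + card ?C" using fin by (simp add: card_image_le)
  finally have "d + 1 \<le> card ?F + card ?C" by simp
  moreover have "card ?U + card ?C = card (nb E e)"
    using fin by (subst card_Un_disjoint[symmetric]) (auto intro!: arg_cong[of _ _ card])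
  ultimately show ?thesis using conflict_graphD(4)[OF nb E] by linarith
qed

text \<open>Edges of class \<open>i\<close> with more than \<open>h\<close> uncoloured neighbours have a long list of free colours.
  They shrink it in two rounds: first to a member of the family attached to rank and list that
  barely meets any member of the families of the lower-ranked neighbours, then to a single colour.\<close>
lemma color_class:
  fixes \<beta> s h d t M i :: nat
  defines "k \<equiv> \<beta> * s + 1"
  assumes nb: "conflict_graph T nb d" and c: "partial_coloring T nb d c"
    and \<kappa>: "loc T \<kappa>" and \<rho>: "loc T \<rho>"
    and \<rho>_lt: "\<And>E e. E \<in> \<G> \<Longrightarrow> e \<in> edges E \<Longrightarrow> \<rho> E e < M"
    and \<rho>_ne: "\<And>E e e'. E \<in> \<G> \<Longrightarrow> e \<in> edges E \<Longrightarrow> e' \<in> nb E e \<Longrightarrow> c E e = None \<Longrightarrow> c E e' = None \<Longrightarrow>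
        \<kappa> E e' = \<kappa> E e \<Longrightarrow> \<rho> E e' \<noteq> \<rho> E e"
    and \<beta>: "\<And>E e. E \<in> \<G> \<Longrightarrow> e \<in> edges E \<Longrightarrow> c E e = None \<Longrightarrow>
        card {e' \<in> nb E e. c E e' = None \<and> \<kappa> E e' = \<kappa> E e \<and> \<rho> E e' < \<rho> E e} \<le> \<beta>"
    and k: "k * (2 * k) \<le> h + 2"
    and s: "2 * (\<beta> * t + 1) * (\<beta> * t + 1) \<le> 2 ^ s" and M: "M * 2 ^ (d + 1) < 2 ^ t"
  shows "\<exists>c'. partial_coloring (T + 3) nb d c' \<and> (\<forall>E\<in>\<G>. \<forall>e\<in>edges E. (c E e \<noteq> None \<longrightarrow> c' E e = c E e) \<and>
     (\<kappa> E e = i \<and> c' E e = None \<longrightarrow> card {e' \<in> nb E e. c E e' = None} \<le> h))"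
proof -
  define \<L> where "\<L> = {L. L \<subseteq> {..d} \<and> card L = k * (2 * k)}"
  \<comment> \<open>\<open>K\<close> depends on global parameters only, so an edge can evaluate it
    at the rank and list of any neighbour.\<close>
  obtain K :: "nat \<Rightarrow> nat set \<Rightarrow> nat set set" where K: "\<forall>\<rho><M. \<forall>L\<in>\<L>.
     (\<forall>S\<in>K \<rho> L. S \<subseteq> L \<and> card S = k) \<and>
     (\<forall>P. finite P \<and> card P \<le> \<beta> \<and> P \<subseteq> {..<\<rho>} \<times> \<L> \<longrightarrow>
        (\<exists>S\<in>K \<rho> L. \<forall>(\<rho>', L')\<in>P. \<forall>S'\<in>K \<rho>' L'. card (S \<inter> S') < s))"
    using exists_list_coloring_families[OF s M] unfolding k_def \<L>_def by (rule exE)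
  have K1: "S \<subseteq> L \<and> card S = k" if "\<rho> < M" "L \<in> \<L>" "S \<in> K \<rho> L" for \<rho> L S
    using K that by simp
  have K2: "\<exists>S\<in>K \<rho> L. \<forall>(\<rho>', L')\<in>P. \<forall>S'\<in>K \<rho>' L'. card (S \<inter> S') < s"
    if "\<rho> < M" "L \<in> \<L>" "finite P \<and> card P \<le> \<beta>" "P \<subseteq> {..<\<rho>} \<times> \<L>" for \<rho> L P
    using K that by simp
  note c1 = partial_coloringD[OF c]
  note nb0 = conflict_graphD[OF nb]

  \<comment> \<open>At least \<open>h + 1\<close> uncoloured neighbours mean at least
    \<open>h + 2\<close> free colours, hence a list of the exact size \<open>k * (2 * k)\<close>
    that the families require.\<close>
  define act where "act E e \<longleftrightarrow> c E e = None \<and> \<kappa> E e = i \<and> h < card {e' \<in> nb E e. c E e' = None}" for E e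
  have f1: "loc T (\<lambda>E e. (c E e, \<kappa> E e))" using c1(1) \<kappa> by (rule loc_Pair)
  define R1 where "R1 = (\<lambda>(e :: nat set) (y :: nat option \<times> nat) (N :: nat set \<Rightarrow> (nat option \<times> nat) option) x.
      if fst y = None \<and> snd y = i \<and> h < card {e'. \<exists>k'. N e' = Some (None, k')}
      then \<exists>L\<in>\<L>. x = Some L \<and> (\<forall>e' z k'. N e' = Some (Some z, k') \<longrightarrow> z \<notin> L) else x = None)"
  have "\<exists>g. loc (Suc T) g \<and> (\<forall>E\<in>\<G>. \<forall>e\<in>edges E.
      R1 e (c E e, \<kappa> E e) (view (\<lambda>e. (c E e, \<kappa> E e)) (nb E e)) (g E e))"
  proof (rule conflict_round[OF nb f1])
    fix E e assume E: "E \<in> \<G>" "e \<in> edges E"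
    let ?F = "{x. x \<le> d \<and> (\<forall>e'\<in>nb E e. c E e' \<noteq> Some x)}"
    have ex: "\<exists>L\<in>\<L>. L \<subseteq> ?F" if act: "act E e"
    proof -
      have "k * (2 * k) \<le> card ?F"
        using card_free_colors[OF nb E, of c] k act by (simp add: act_def)
      then obtain L where "L \<subseteq> ?F" "card L = k * (2 * k)" by (meson obtain_subset_with_card_n)
      then show ?thesis by (auto simp: \<L>_def)
    qed
    show "\<exists>x. R1 e (c E e, \<kappa> E e) (view (\<lambda>e. (c E e, \<kappa> E e)) (nb E e)) x"
    proof (cases "act E e")
      case True
      then obtain L where "L \<in> \<L>" "L \<subseteq> ?F" using ex by blast
      then have "R1 e (c E e, \<kappa> E e) (view (\<lambda>e. (c E e, \<kappa> E e)) (nb E e)) (Some L)"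
        using True by (auto simp: R1_def act_def)
      then show ?thesis by blast
    next
      case False
      then have "R1 e (c E e, \<kappa> E e) (view (\<lambda>e. (c E e, \<kappa> E e)) (nb E e)) None"
        by (auto simp: R1_def act_def)
      then show ?thesis by blast
    qed
  qed
  then obtain L where locL: "loc (Suc T) L" and
    LR: "\<And>E e. E \<in> \<G> \<Longrightarrow> e \<in> edges E \<Longrightarrow>
      R1 e (c E e, \<kappa> E e) (view (\<lambda>e. (c E e, \<kappa> E e)) (nb E e)) (L E e)" by blast
  have L_act: "L E e \<noteq> None \<longleftrightarrow> act E e" if "E \<in> \<G>" "e \<in> edges E" for E e
    using LR[OF that] by (auto simp: R1_def act_def split: if_splits)
  have L_Some: "Ls \<in> \<L> \<and> (\<forall>e'\<in>nb E e. \<forall>z. c E e' = Some z \<longrightarrow> z \<notin> Ls)"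
    if "E \<in> \<G>" "e \<in> edges E" "L E e = Some Ls" for E e Ls
    using LR[OF that(1,2)] that(3) by (auto simp: R1_def split: if_splits)
  have L_ne: "\<rho> E e' \<noteq> \<rho> E e"
    if E: "E \<in> \<G>" "e \<in> edges E" and e': "e' \<in> nb E e" "L E e \<noteq> None" "L E e' \<noteq> None" for E e e'
    using \<rho>_ne[OF E e'(1)] L_act[OF E] L_act[OF E(1) nb0(6)[OF E e'(1)]] e' by (simp add: act_def)

  define low where "low E e = {e' \<in> nb E e. L E e' \<noteq> None \<and> \<rho> E e' < \<rho> E e}" for E e
  have low: "finite (low E e)" "L E e \<noteq> None \<Longrightarrow> card (low E e) \<le> \<beta>" if E: "E \<in> \<G>" "e \<in> edges E" for E e
  proof -
    show "finite (low E e)" using nb0(5)[OF E] by (simp add: low_def)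
    assume "L E e \<noteq> None"
    then have e: "c E e = None" "\<kappa> E e = i" using L_act[OF E] by (auto simp: act_def)
    have "low E e \<subseteq> {e' \<in> nb E e. c E e' = None \<and> \<kappa> E e' = \<kappa> E e \<and> \<rho> E e' < \<rho> E e}"
      using L_act[OF E(1) nb0(6)[OF E]] e by (auto simp: low_def act_def)
    then have "card (low E e) \<le> card {e' \<in> nb E e. c E e' = None \<and> \<kappa> E e' = \<kappa> E e \<and> \<rho> E e' < \<rho> E e}"
      using nb0(5)[OF E] by (intro card_mono) auto
    then show "card (low E e) \<le> \<beta>" using \<beta>[OF E e(1)] by simp
  qed

  have nb1: "conflict_graph (Suc T) nb d" using conflict_graph_mono[OF nb] by simp
  have f2: "loc (Suc T) (\<lambda>E e. (L E e, \<rho> E e))" using locL loc_mono[OF \<rho>] by (intro loc_Pair) auto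
  \<comment> \<open>The set must be good against every member of the families of lower neighbours,
    because these pick their members in the same round.\<close>
  define R2 where "R2 = (\<lambda>(e :: nat set) (y :: nat set option \<times> nat)
      (N :: nat set \<Rightarrow> (nat set option \<times> nat) option) S.
      \<forall>L. fst y = Some L \<longrightarrow> S \<in> K (snd y) L \<and>
        (\<forall>e' L' r'. N e' = Some (Some L', r') \<and> r' < snd y \<longrightarrow> (\<forall>S'\<in>K r' L'. card (S \<inter> S') < s)))"
  have "\<exists>g. loc (Suc (Suc T)) g \<and> (\<forall>E\<in>\<G>. \<forall>e\<in>edges E.
      R2 e (L E e, \<rho> E e) (view (\<lambda>e. (L E e, \<rho> E e)) (nb E e)) (g E e))"
  proof (rule conflict_round[OF nb1 f2])
    fix E e assume E: "E \<in> \<G>" "e \<in> edges E"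
    show "\<exists>S. R2 e (L E e, \<rho> E e) (view (\<lambda>e. (L E e, \<rho> E e)) (nb E e)) S"
    proof (cases "L E e")
      case None
      then show ?thesis by (simp add: R2_def)
    next
      case (Some Ls)
      define P where "P = (\<lambda>e'. (\<rho> E e', the (L E e'))) ` low E e"
      have "finite P \<and> card P \<le> \<beta>"
        using low[OF E] Some card_image_le[OF low(1)[OF E], of "\<lambda>e'. (\<rho> E e', the (L E e'))"]
        by (simp add: P_def)
      moreover have "P \<subseteq> {..<\<rho> E e} \<times> \<L>"
        using L_Some[OF E(1) nb0(6)[OF E]] by (auto simp: P_def low_def)
      ultimately obtain S where S: "S \<in> K (\<rho> E e) Ls" "\<forall>(\<rho>', L')\<in>P. \<forall>S'\<in>K \<rho>' L'. card (S \<inter> S') < s"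
        using K2[OF \<rho>_lt[OF E], of Ls P] L_Some[OF E Some] by auto
      have "R2 e (L E e, \<rho> E e) (view (\<lambda>e. (L E e, \<rho> E e)) (nb E e)) S"
        unfolding R2_def
      proof (intro allI impI conjI ballI)
        fix L1 assume "fst (L E e, \<rho> E e) = Some L1"
        then show "S \<in> K (snd (L E e, \<rho> E e)) L1" using S(1) Some by simp
      next
        fix L1 e' L' r' S' assume e': "view (\<lambda>e. (L E e, \<rho> E e)) (nb E e) e' = Some (Some L', r') \<and> r' < snd (L E e, \<rho> E e)"
          and S': "S' \<in> K r' L'"
        then have "(r', L') \<in> P" by (force simp: P_def low_def)
        then show "card (S \<inter> S') < s" using S(2) S' by auto
      qed
      then show ?thesis by blast
    qed
  qed
  then obtain S where locS: "loc (Suc (Suc T)) S" and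
    SR: "\<And>E e. E \<in> \<G> \<Longrightarrow> e \<in> edges E \<Longrightarrow>
      R2 e (L E e, \<rho> E e) (view (\<lambda>e. (L E e, \<rho> E e)) (nb E e)) (S E e)" by blast
  have S_mem: "S E e \<in> K (\<rho> E e) Ls" if "E \<in> \<G>" "e \<in> edges E" "L E e = Some Ls" for E e Ls
    using SR[OF that(1,2)] that(3) by (simp add: R2_def)
  have S_sub: "S E e \<subseteq> Ls" "card (S E e) = k" "finite (S E e)"
    if "E \<in> \<G>" "e \<in> edges E" "L E e = Some Ls" for E e Ls
  proof -
    show "S E e \<subseteq> Ls" "card (S E e) = k"
      using K1[OF \<rho>_lt[OF that(1,2)] _ S_mem[OF that]] L_Some[OF that] by simp_all
    then show "finite (S E e)" by (simp add: card_ge_0_finite k_def)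
  qed
  have S_int: "card (S E e \<inter> S E e') < s"
    if E: "E \<in> \<G>" "e \<in> edges E" and e: "L E e \<noteq> None" "e' \<in> low E e" for E e e'
  proof -
    obtain L' where L': "L E e' = Some L'" "e' \<in> nb E e" "\<rho> E e' < \<rho> E e" using e(2) by (auto simp: low_def)
    then have "S E e' \<in> K (\<rho> E e') L'" using S_mem[OF E(1) nb0(6)[OF E]] by blast
    then show ?thesis using SR[OF E] e(1) L' by (auto simp: R2_def)
  qed

  have nb2: "conflict_graph (Suc (Suc T)) nb d" using conflict_graph_mono[OF nb] by simp
  have f3: "loc (Suc (Suc T)) (\<lambda>E e. (c E e, L E e, \<rho> E e, S E e))"
    using locS loc_mono[OF \<rho>] loc_mono[OF locL] loc_mono[OF c1(1)] by (intro loc_Pair) auto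
  \<comment> \<open>A colour outside the whole set of each lower neighbour differs from whatever
    colour that neighbour takes simultaneously.\<close>
  define R3 where "R3 = (\<lambda>(e :: nat set) (y :: nat option \<times> nat set option \<times> nat \<times> nat set)
      (N :: nat set \<Rightarrow> (nat option \<times> nat set option \<times> nat \<times> nat set) option) x.
      case y of (c0, L, r, S) \<Rightarrow> if L = None then x = c0 else
        \<exists>z\<in>S. x = Some z \<and> (\<forall>e' c' L' r' S'. N e' = Some (c', L', r', S') \<and> L' \<noteq> None \<and> r' < r \<longrightarrow> z \<notin> S'))"
  have "\<exists>g. loc (Suc (Suc (Suc T))) g \<and> (\<forall>E\<in>\<G>. \<forall>e\<in>edges E.
      R3 e (c E e, L E e, \<rho> E e, S E e) (view (\<lambda>e. (c E e, L E e, \<rho> E e, S E e)) (nb E e)) (g E e))"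
  proof (rule conflict_round[OF nb2 f3])
    fix E e assume E: "E \<in> \<G>" "e \<in> edges E"
    show "\<exists>x. R3 e (c E e, L E e, \<rho> E e, S E e) (view (\<lambda>e. (c E e, L E e, \<rho> E e, S E e)) (nb E e)) x"
    proof (cases "L E e")
      case None
      then show ?thesis by (simp add: R3_def)
    next
      case (Some Ls)
      let ?X = "\<Union>e'\<in>low E e. S E e \<inter> S E e'"
      have "card ?X \<le> (\<Sum>e'\<in>low E e. card (S E e \<inter> S E e'))" by (rule card_UN_le[OF low(1)[OF E]])
      also have "\<dots> \<le> (\<Sum>e'\<in>low E e. s)"
        using S_int[OF E] Some by (intro sum_mono) (simp add: less_imp_le)
      also have "\<dots> \<le> \<beta> * s" using low(2)[OF E] Some by simp
      finally have "card ?X < card (S E e)" using S_sub(2)[OF E Some] by (simp add: k_def)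
      moreover have "finite ?X" using low(1)[OF E] S_sub(3)[OF E Some] by auto
      ultimately have "\<not> S E e \<subseteq> ?X" by (meson card_mono leD)
      then obtain z where z: "z \<in> S E e" "z \<notin> ?X" by blast
      have "R3 e (c E e, L E e, \<rho> E e, S E e) (view (\<lambda>e. (c E e, L E e, \<rho> E e, S E e)) (nb E e)) (Some z)"
        using z Some by (auto simp: R3_def low_def)
      then show ?thesis by blast
    qed
  qed
  then obtain c' where locc': "loc (Suc (Suc (Suc T))) c'" and
    c'R: "\<And>E e. E \<in> \<G> \<Longrightarrow> e \<in> edges E \<Longrightarrow>
      R3 e (c E e, L E e, \<rho> E e, S E e) (view (\<lambda>e. (c E e, L E e, \<rho> E e, S E e)) (nb E e)) (c' E e)" by blast
  have c'_None: "c' E e = c E e" if "E \<in> \<G>" "e \<in> edges E" "L E e = None" for E e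
    using c'R[OF that(1,2)] that(3) by (simp add: R3_def)
  have c'_Some: "\<exists>z\<in>S E e. c' E e = Some z \<and> (\<forall>e'\<in>low E e. z \<notin> S E e')"
    if "E \<in> \<G>" "e \<in> edges E" "L E e \<noteq> None" for E e
    using c'R[OF that(1,2)] that(3) by (fastforce simp: R3_def low_def)
  \<comment> \<open>In a pair of active edges only the one of higher rank takes precautions. So
    validity is shown towards neighbours that are inactive or not of higher rank; the rest follows
    by symmetry of the conflict graph.\<close>
  have valid: "x \<le> d \<and> c' E e' \<noteq> Some x"
    if E: "E \<in> \<G>" "e \<in> edges E" and e': "e' \<in> nb E e" and x: "c' E e = Some x" and le: "\<rho> E e' \<le> \<rho> E e \<or> L E e' = None"
    for E e e' x
  proof (cases "L E e")
    case None
    then have cx: "c E e = Some x" using c'_None[OF E] x by simp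
    have E': "e' \<in> edges E" using nb0(6)[OF E e'] .
    have "c' E e' \<noteq> Some x"
    proof (cases "L E e'")
      case None
      then show ?thesis using c'_None[OF E(1) E'] c1(3)[OF E e' cx] by simp
    next
      case (Some L')
      then obtain z where "z \<in> S E e'" "c' E e' = Some z" using c'_Some[OF E(1) E'] by auto
      then show ?thesis
        using S_sub(1)[OF E(1) E' Some] L_Some[OF E(1) E' Some] nb0(3)[OF E e'] cx by auto
    qed
    then show ?thesis using c1(2)[OF E cx] by simp
  next
    case (Some Ls)
    then obtain z where z: "z \<in> S E e" "c' E e = Some z" "\<forall>e'\<in>low E e. z \<notin> S E e'"
      using c'_Some[OF E] by auto
    have E': "e' \<in> edges E" using nb0(6)[OF E e'] .
    have "z \<in> Ls" using z S_sub(1)[OF E Some] by blast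
    then have "z \<le> d" and free: "c E e' \<noteq> Some z" using L_Some[OF E Some] e' by (auto simp: \<L>_def)
    moreover have "c' E e' \<noteq> Some z"
    proof (cases "L E e'")
      case None
      then show ?thesis using c'_None[OF E(1) E'] free by simp
    next
      case (Some L')
      then have "\<rho> E e' < \<rho> E e" using le L_ne[OF E e'] \<open>L E e = Some Ls\<close> by fastforce
      then have "e' \<in> low E e" using e' Some by (simp add: low_def)
      moreover obtain z' where "z' \<in> S E e'" "c' E e' = Some z'" using c'_Some[OF E(1) E'] Some by auto
      ultimately show ?thesis using z(3) by auto
    qed
    ultimately show ?thesis using z(2) x by simp
  qed
  have "x \<le> d" if E: "E \<in> \<G>" "e \<in> edges E" and x: "c' E e = Some x" for E e x
  proof (cases "L E e")
    case None
    then show ?thesis using c'_None[OF E] c1(2)[OF E] x by simp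
  next
    case (Some Ls)
    then show ?thesis using c'_Some[OF E] S_sub(1)[OF E Some] L_Some[OF E Some] x by (auto simp: \<L>_def)
  qed
  moreover have "c' E e' \<noteq> Some x" if E: "E \<in> \<G>" "e \<in> edges E" and e': "e' \<in> nb E e" and x: "c' E e = Some x" for E e e' x
  proof (cases "\<rho> E e' \<le> \<rho> E e")
    case True
    then show ?thesis using valid[OF E e' x] by blast
  next
    case False
    have "c' E e \<noteq> Some x" if "c' E e' = Some x"
      using valid[OF E(1) nb0(6)[OF E e'] nb0(3)[OF E e'] that] False by auto
    then show ?thesis using x by blast
  qed
  ultimately have "partial_coloring (T + 3) nb d c'"
    using locc' by (simp add: partial_coloring_def numeral_3_eq_3)
  moreover have "(c E e \<noteq> None \<longrightarrow> c' E e = c E e) \<and>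
     (\<kappa> E e = i \<and> c' E e = None \<longrightarrow> card {e' \<in> nb E e. c E e' = None} \<le> h)" if E: "E \<in> \<G>" "e \<in> edges E" for E e
    using c'_None[OF E] c'_Some[OF E] L_act[OF E] by (cases "L E e") (auto simp: act_def)
  ultimately show ?thesis by blast
qed

end

text \<open>The factor \<open>128 = 4 * 32\<close> gives
  \<open>\<beta> * s \<le> a / (4 * (q + 1))\<close>, and \<open>a \<le> (q + 1)\<^sup>2\<close>
  then gives \<open>16 * (\<beta> * s)\<^sup>2 \<le> a\<close>, which fits the lists into half of
  \<open>a\<close>. In terms of \<open>X = 2 ^ B\<close> everything else is polynomial:
  \<open>s = 32 * B\<close> is chosen for \<open>2 * (512 * X ^ 6)\<^sup>2 \<le> X ^ 32\<close>. The
  value of \<open>t\<close> exceeds the bits for the lists plus those for the ranks, the latter by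
  the crude \<open>2 * p \<le> 2 ^ (2 * p)\<close>.\<close>

lemma list_coloring_parameters:
  fixes a d B q :: nat
  assumes a: "a \<le> d" and B: "d + 2 \<le> 2 ^ B" and q: "d \<le> (q + 1)\<^sup>2" "q \<le> d"
  defines "s \<equiv> 32 * B" and "p \<equiv> 128 * B\<^sup>2 * (q + 1)"
  defines "\<beta> \<equiv> B * (a div p)"
  defines "t \<equiv> d + 2 + B * (2 * p)"
  shows "0 < p"
    and "(\<beta> * s + 1) * (2 * (\<beta> * s + 1)) \<le> a div 2 + 2"
    and "2 * (\<beta> * t + 1) * (\<beta> * t + 1) \<le> 2 ^ s"
    and "(2 * p) ^ B * 2 ^ (d + 1) < 2 ^ t"
proof -
  have B1: "1 \<le> B" using B by (cases B) auto
  show p: "0 < p" using B1 by (simp add: p_def)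
  show "(\<beta> * s + 1) * (2 * (\<beta> * s + 1)) \<le> a div 2 + 2"
  \<comment> \<open>For \<open>\<beta> = 0\<close> the left side is 2, which the summand 2 on the
    right covers.\<close>
  proof (cases "\<beta> = 0")
    case False
    then have "1 \<le> \<beta> * s" using B1 by (simp add: s_def)
    then have "(\<beta> * s + 1) * (2 * (\<beta> * s + 1)) \<le> (2 * (\<beta> * s)) * (2 * (2 * (\<beta> * s)))"
      by (intro mult_mono) auto
    also have "\<dots> = 8 * (\<beta> * s)\<^sup>2" by (simp add: power2_eq_square)
    finally have 1: "(\<beta> * s + 1) * (2 * (\<beta> * s + 1)) \<le> 8 * (\<beta> * s)\<^sup>2" .
    have "\<beta> * p \<le> B * a" by (simp add: \<beta>_def mult.assoc)
    then have "(\<beta> * p)\<^sup>2 \<le> (B * a)\<^sup>2" by (rule power_mono) simp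
    then have "8 * s\<^sup>2 * (\<beta> * p)\<^sup>2 \<le> 8 * s\<^sup>2 * (B * a)\<^sup>2" by simp
    also have "\<dots> = 8192 * B ^ 4 * a * a" by (simp add: s_def power2_eq_square power4_eq_xxxx)
    also have "\<dots> \<le> 8192 * B ^ 4 * (q + 1)\<^sup>2 * a"
      using a q by (intro mult_mono) auto
    finally have "2 * (8 * s\<^sup>2 * (\<beta> * p)\<^sup>2) \<le> 16384 * B ^ 4 * (q + 1)\<^sup>2 * a" by simp
    also have "16384 * B ^ 4 * (q + 1)\<^sup>2 = p\<^sup>2"
      unfolding p_def power_mult_distrib by (simp flip: power_mult)
    finally have "p\<^sup>2 * (2 * (8 * (\<beta> * s)\<^sup>2)) \<le> p\<^sup>2 * a" by (simp add: power_mult_distrib mult_ac)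
    then have "2 * (8 * (\<beta> * s)\<^sup>2) \<le> a" using p by simp
    then show ?thesis using 1 by linarith
  qed simp
  define X :: nat where "X = 2 ^ B"
  have X: "2 \<le> X" using B by (simp add: X_def)
  have le: "B \<le> X" "d + 2 \<le> X" "q + 1 \<le> X"
    using B q less_exp[of B] by (simp_all add: X_def)
  have "p \<le> 128 * X\<^sup>2 * X"
    unfolding p_def using le by (intro mult_mono power_mono) auto
  then have p_le: "p \<le> 128 * X ^ 3" by (simp add: power2_eq_square power3_eq_cube)
  have "t \<le> X + X * (2 * (128 * X ^ 3))"
    unfolding t_def using le p_le by (intro add_mono mult_mono) auto
  also have "\<dots> = X * 1 + 256 * X ^ 4" by (simp add: power3_eq_cube power4_eq_xxxx)
  also have "\<dots> \<le> X * X ^ 3 + 256 * X ^ 4" using X by (intro add_mono mult_mono) auto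
  also have "\<dots> = 257 * X ^ 4" by (simp add: power3_eq_cube power4_eq_xxxx)
  finally have t_le: "t \<le> 257 * X ^ 4" .
  have "a div p \<le> X" using a le div_le_dividend[of a p] by linarith
  then have "\<beta> \<le> X * X" unfolding \<beta>_def using le by (intro mult_mono) auto
  then have "\<beta> * t \<le> X * X * (257 * X ^ 4)" using t_le by (intro mult_mono) auto
  moreover have "1 \<le> X ^ 6" using X by simp
  moreover have "X * X * (257 * X ^ 4) = 257 * X ^ 6" by (simp add: power_numeral_reduce)
  ultimately have "\<beta> * t + 1 \<le> 512 * X ^ 6" by linarith
  then have "2 * ((\<beta> * t + 1) * (\<beta> * t + 1)) \<le> 2 * ((512 * X ^ 6) * (512 * X ^ 6))"
    by (intro mult_left_mono mult_mono) auto
  also have "\<dots> = 2 ^ 19 * X ^ 12" by (simp add: power_numeral_reduce)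
  also have "\<dots> \<le> X ^ 20 * X ^ 12"
  proof (rule mult_right_mono)
    have "(2::nat) ^ 19 \<le> X ^ 19" using X by (rule power_mono) simp
    also have "\<dots> \<le> X ^ 20" using X by (intro power_increasing) auto
    finally show "(2::nat) ^ 19 \<le> X ^ 20" .
  qed simp
  also have "\<dots> = X ^ 32" by (simp flip: power_add)
  also have "\<dots> = 2 ^ s" by (simp add: X_def s_def mult.commute flip: power_mult)
  finally show "2 * (\<beta> * t + 1) * (\<beta> * t + 1) \<le> 2 ^ s" by (simp only: mult.assoc)
  have "(2 * p) ^ B \<le> (2 ^ (2 * p)) ^ B" by (rule power_mono) (simp_all add: less_imp_le)
  also have "\<dots> = 2 ^ (B * (2 * p))" by (simp add: mult.commute flip: power_mult)
  finally have "(2 * p) ^ B * 2 ^ (d + 1) \<le> 2 ^ (B * (2 * p)) * 2 ^ (d + 1)" by simp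
  also have "\<dots> < 2 ^ t" by (simp add: t_def flip: power_add)
  finally show "(2 * p) ^ B * 2 ^ (d + 1) < 2 ^ t" .
qed

context graph_family
begin

definition uncolored_degree_le where
  "uncolored_degree_le nb c a \<longleftrightarrow> (\<forall>E\<in>\<G>. \<forall>e\<in>edges E. c E e = None \<longrightarrow> card {e' \<in> nb E e. c E e' = None} \<le> (a::nat))"

text \<open>An edge that stays uncoloured when its class is processed has few uncoloured neighbours.\<close>
lemma halve_uncolored_degree:
  fixes B q d :: nat
  assumes nb: "conflict_graph T nb d" and \<psi>: "loc T \<psi>"
    and \<psi>_lt: "\<And>E e. E \<in> \<G> \<Longrightarrow> e \<in> edges E \<Longrightarrow> \<psi> E e < (2::nat) ^ B"
    and \<psi>_ne: "\<And>E e e'. E \<in> \<G> \<Longrightarrow> e \<in> edges E \<Longrightarrow> e' \<in> nb E e \<Longrightarrow> \<psi> E e' \<noteq> \<psi> E e"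
    and B: "d + 2 \<le> 2 ^ B" and q: "d \<le> (q + 1)\<^sup>2" "q \<le> d" and a: "a \<le> d"
    and c: "partial_coloring T nb d c" and deg: "uncolored_degree_le nb c a"
  defines "p \<equiv> 128 * B\<^sup>2 * (q + 1)"
  shows "\<exists>c'. partial_coloring (T + (2 * p * B + 3 * p + 1)) nb d c' \<and> uncolored_degree_le nb c' (a div 2)"
proof -
  define \<beta> where "\<beta> = B * (a div p)"
  note par = list_coloring_parameters[OF a B q, folded p_def, folded \<beta>_def]
  note nb0 = conflict_graphD[OF nb]
  note c0 = partial_coloringD[OF c]
  \<comment> \<open>Conflicts between uncoloured edges only: the classes are built for degree
    \<open>a\<close> instead of \<open>d\<close>, so \<open>\<beta>\<close> shrinks along with the
    lists. Learning which neighbours are uncoloured takes one round.\<close>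
  define nb' where "nb' E e = (if c E e = None then {e' \<in> nb E e. c E e' = None} else {})" for E e
  have "\<exists>g. loc (Suc T) g \<and> (\<forall>E\<in>\<G>. \<forall>e\<in>edges E.
      (\<lambda>e y N x. x = (if y = None then {e'. N e' = Some None} else {})) e (c E e) (view (c E) (nb E e)) (g E e))"
    by (rule conflict_round[OF nb c0(1)]) simp
  then obtain g where g: "loc (Suc T) g" "\<And>E e. E \<in> \<G> \<Longrightarrow> e \<in> edges E \<Longrightarrow> g E e = nb' E e"
    by (auto simp: nb'_def)
  \<comment> \<open>\<open>g\<close> agrees with \<open>nb'\<close> only on edges of graphs in \<G>.
    This suffices, since equal views at \<open>u\<close> put the edge \<open>{u, v}\<close> into
    both graphs.\<close>
  have "loc (Suc T) nb'"
    unfolding loc_def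
  proof (intro ballI allI impI)
    fix E E' u v assume uv: "E \<in> \<G>" "E' \<in> \<G>" "E u v" "same_view (Suc T) E E' u"
    then have "E' u v" using same_view_nbrs[of "Suc T" E E' u] by (auto simp: nbrs_def)
    then show "nb' E {u, v} = nb' E' {u, v}"
      using g(2)[of E "{u, v}"] g(2)[of E' "{u, v}"] g(1) uv edge_iff unfolding loc_def by metis
  qed
  then have nb': "conflict_graph (Suc T) nb' a"
    unfolding conflict_graph_def
  proof (intro conjI ballI)
    fix E e assume E: "E \<in> \<G>" "e \<in> edges E"
    show "nb' E e \<subseteq> touching E e" "e \<notin> nb' E e" using nb0(1,2)[OF E] by (auto simp: nb'_def)
    show "card (nb' E e) \<le> a" using deg E by (auto simp: nb'_def uncolored_degree_le_def)
    fix e' assume "e' \<in> nb' E e"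
    then show "e \<in> nb' E e'" using nb0(3)[OF E] by (auto simp: nb'_def split: if_splits)
  qed
  have sub: "nb' E e \<subseteq> nb E e" for E e by (auto simp: nb'_def)
  have pB: "2 ^ B \<le> p * 2 ^ B" using par(1) by simp
  have "\<exists>\<kappa> \<rho>. ranked_classes (Suc T + 2 * p * B) nb' \<kappa> \<rho> p ((2 * p) ^ B) (B * (a div p))"
  proof (rule exists_ranked_classes[OF nb' par(1)])
    show "loc (Suc T) \<psi>" using loc_mono[OF \<psi>] by simp
    show "\<psi> E e < p * 2 ^ B" if "E \<in> \<G>" "e \<in> edges E" for E e
      using \<psi>_lt[OF that] pB by linarith
    show "\<psi> E e' \<noteq> \<psi> E e" if "E \<in> \<G>" "e \<in> edges E" "e' \<in> nb' E e" for E e e'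
      using \<psi>_ne[OF that(1,2)] that(3) sub by blast
  qed
  then obtain \<kappa> \<rho> where rc: "ranked_classes (Suc T + 2 * p * B) nb' \<kappa> \<rho> p ((2 * p) ^ B) \<beta>"
    unfolding \<beta>_def by blast
  note \<kappa> = ranked_classesD[OF rc]
  let ?T = "\<lambda>i. Suc T + 2 * p * B + 3 * i"
  \<comment> \<open>Three rounds per class. The bound \<open>a div 2\<close> is reached when an edge
    is passed over, and uncoloured neighbours can only disappear later.\<close>
  have "\<exists>c'. partial_coloring (?T i) nb d c' \<and> (\<forall>E\<in>\<G>. \<forall>e\<in>edges E. (c' E e = None \<longrightarrow> c E e = None) \<and>
      (c' E e = None \<and> \<kappa> E e < i \<longrightarrow> card {e' \<in> nb E e. c' E e' = None} \<le> a div 2))" for i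
  proof (induction i)
    case 0
    have "partial_coloring (?T 0) nb d c" using c loc_mono[OF c0(1)] by (simp add: partial_coloring_def)
    then show ?case by auto
  next
    case (Suc i)
    then obtain c1 where c1: "partial_coloring (?T i) nb d c1"
      and ext1: "\<And>E e. E \<in> \<G> \<Longrightarrow> e \<in> edges E \<Longrightarrow> c1 E e = None \<Longrightarrow> c E e = None"
      and deg1: "\<And>E e. E \<in> \<G> \<Longrightarrow> e \<in> edges E \<Longrightarrow> c1 E e = None \<Longrightarrow> \<kappa> E e < i \<Longrightarrow>
        card {e' \<in> nb E e. c1 E e' = None} \<le> a div 2" by blast
    have in_nb': "e' \<in> nb' E e"
      if "E \<in> \<G>" "e \<in> edges E" "e' \<in> nb E e" "c1 E e = None" "c1 E e' = None" for E e e'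
      using ext1[OF that(1,2,4)] ext1[OF that(1) nb0(6)[OF that(1,2,3)] that(5)] that(3) by (simp add: nb'_def)
    have "\<exists>c2. partial_coloring (?T i + 3) nb d c2 \<and> (\<forall>E\<in>\<G>. \<forall>e\<in>edges E. (c1 E e \<noteq> None \<longrightarrow> c2 E e = c1 E e) \<and>
     (\<kappa> E e = i \<and> c2 E e = None \<longrightarrow> card {e' \<in> nb E e. c1 E e' = None} \<le> a div 2))"
    proof (rule color_class[where \<rho> = \<rho> and \<beta> = \<beta> and M = "(2 * p) ^ B"])
      show "conflict_graph (?T i) nb d" using conflict_graph_mono[OF nb] by simp
      show "loc (?T i) \<kappa>" "loc (?T i) \<rho>" using loc_mono[OF \<kappa>(1)] loc_mono[OF \<kappa>(2)] by simp_all
      show "\<rho> E e < (2 * p) ^ B" if "E \<in> \<G>" "e \<in> edges E" for E e using \<kappa>(4)[OF that] .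
      show "\<rho> E e' \<noteq> \<rho> E e" if "E \<in> \<G>" "e \<in> edges E" "e' \<in> nb E e" "c1 E e = None" "c1 E e' = None"
        "\<kappa> E e' = \<kappa> E e" for E e e'
        using \<kappa>(5)[OF that(1,2) in_nb'[OF that(1-5)] that(6)] .
      show "card {e' \<in> nb E e. c1 E e' = None \<and> \<kappa> E e' = \<kappa> E e \<and> \<rho> E e' < \<rho> E e} \<le> \<beta>"
        if E: "E \<in> \<G>" "e \<in> edges E" "c1 E e = None" for E e
      proof -
        have "card {e' \<in> nb E e. c1 E e' = None \<and> \<kappa> E e' = \<kappa> E e \<and> \<rho> E e' < \<rho> E e}
            \<le> card {e' \<in> nb' E e. \<kappa> E e' = \<kappa> E e \<and> \<rho> E e' < \<rho> E e}"
          using in_nb'[OF E(1,2) _ E(3)] conflict_graphD(5)[OF nb' E(1,2)] by (intro card_mono) auto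
        then show ?thesis using \<kappa>(6)[OF E(1,2)] by simp
      qed
    qed (rule c1, fact par(2), fact par(3), fact par(4))
    then obtain c2 where c2: "partial_coloring (?T i + 3) nb d c2"
      and c12: "\<forall>E\<in>\<G>. \<forall>e\<in>edges E. (c1 E e \<noteq> None \<longrightarrow> c2 E e = c1 E e) \<and>
     (\<kappa> E e = i \<and> c2 E e = None \<longrightarrow> card {e' \<in> nb E e. c1 E e' = None} \<le> a div 2)" by blast
    have ext2: "c1 E e = None" if "E \<in> \<G>" "e \<in> edges E" "c2 E e = None" for E e
    proof (rule ccontr)
      assume "c1 E e \<noteq> None"
      then have "c2 E e = c1 E e" using c12 that by blast
      then show False using that \<open>c1 E e \<noteq> None\<close> by simp
    qed
    have deg2: "card {e' \<in> nb E e. c1 E e' = None} \<le> a div 2"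
      if "E \<in> \<G>" "e \<in> edges E" "c2 E e = None" "\<kappa> E e = i" for E e
      using c12 that by blast
    show ?case
    proof (intro exI[of _ c2] conjI ballI impI)
      show "partial_coloring (?T (Suc i)) nb d c2" using c2 by (simp add: algebra_simps)
    next
      fix E e assume "E \<in> \<G>" "e \<in> edges E" "c2 E e = None"
      then show "c E e = None" using ext1 ext2 by blast
    next
      fix E e assume E: "E \<in> \<G>" "e \<in> edges E" and e: "c2 E e = None \<and> \<kappa> E e < Suc i"
      have "card {e' \<in> nb E e. c2 E e' = None} \<le> card {e' \<in> nb E e. c1 E e' = None}"
        using ext2[OF E(1) nb0(6)[OF E]] nb0(5)[OF E] by (intro card_mono) auto
      also have "\<dots> \<le> a div 2"
        using deg1[OF E] deg2[OF E] ext2[OF E] e by (auto simp: less_Suc_eq)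
      finally show "card {e' \<in> nb E e. c2 E e' = None} \<le> a div 2" .
    qed
  qed
  from this[of p] obtain c' where c': "partial_coloring (?T p) nb d c'"
    "\<forall>E\<in>\<G>. \<forall>e\<in>edges E. (c' E e = None \<longrightarrow> c E e = None) \<and>
      (c' E e = None \<and> \<kappa> E e < p \<longrightarrow> card {e' \<in> nb E e. c' E e' = None} \<le> a div 2)" by blast
  have "uncolored_degree_le nb c' (a div 2)"
    using c'(2) \<kappa>(3) by (simp add: uncolored_degree_le_def)
  moreover have "?T p = T + (2 * p * B + 3 * p + 1)" by simp
  ultimately show ?thesis using c'(1) by (intro exI[of _ c']) (simp only:)
qed

text \<open>After \<open>B\<close> halvings the uncoloured degree is \<open>d div 2 ^ B = 0\<close>,
  so uncoloured edges do not conflict and all take a free colour in one last round. A halving costs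
  about \<open>2 * p * B\<close> rounds with \<open>p\<close> of order
  \<open>B\<^sup>2 * (q + 1)\<close>, which explains the fourth power of \<open>B\<close>.\<close>

lemma degree_plus_one_coloring:
  fixes B q d :: nat
  assumes nb: "conflict_graph T nb d" and \<psi>: "loc T \<psi>"
    and \<psi>_lt: "\<And>E e. E \<in> \<G> \<Longrightarrow> e \<in> edges E \<Longrightarrow> \<psi> E e < (2::nat) ^ B"
    and \<psi>_ne: "\<And>E e e'. E \<in> \<G> \<Longrightarrow> e \<in> edges E \<Longrightarrow> e' \<in> nb E e \<Longrightarrow> \<psi> E e' \<noteq> \<psi> E e"
    and B: "d + 2 \<le> 2 ^ B" and q: "d \<le> (q + 1)\<^sup>2" "q \<le> d"
  shows "\<exists>col. loc (T + 1000 * B ^ 4 * (q + 1)) col \<and> (\<forall>E\<in>\<G>. \<forall>e\<in>edges E.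
     col E e \<le> d \<and> (\<forall>e'\<in>nb E e. col E e' \<noteq> col E e))"
proof -
  define p where "p = 128 * B\<^sup>2 * (q + 1)"
  define R where "R = 2 * p * B + 3 * p + 1"
  note nb0 = conflict_graphD[OF nb]
  have B1: "1 \<le> B" using B by (cases B) auto
  have "\<exists>c. partial_coloring (T + j * R) nb d c \<and> uncolored_degree_le nb c (d div 2 ^ j)" for j
  proof (induction j)
    case 0
    have "partial_coloring T nb d (\<lambda>_ _. None)" by (simp add: partial_coloring_def loc_const)
    moreover have "uncolored_degree_le nb (\<lambda>_ _. None) d" using nb0(4) by (simp add: uncolored_degree_le_def)
    ultimately show ?case by auto
  next
    case (Suc j)
    then obtain c where c: "partial_coloring (T + j * R) nb d c" "uncolored_degree_le nb c (d div 2 ^ j)" by blast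
    have "\<exists>c'. partial_coloring (T + j * R + (2 * p * B + 3 * p + 1)) nb d c' \<and>
        uncolored_degree_le nb c' (d div 2 ^ j div 2)"
      unfolding p_def
      by (rule halve_uncolored_degree[OF _ _ \<psi>_lt \<psi>_ne B q _ c])
        (use conflict_graph_mono[OF nb] loc_mono[OF \<psi>] in auto)
    moreover have "T + j * R + (2 * p * B + 3 * p + 1) = T + Suc j * R" by (simp add: R_def)
    moreover have "d div 2 ^ j div 2 = d div 2 ^ Suc j" by (simp only: power_Suc mult.commute[of 2] div_mult2_eq)
    ultimately show ?case by (simp only:)
  qed
  from this[of B] obtain c where c: "partial_coloring (T + B * R) nb d c" and
    deg: "uncolored_degree_le nb c (d div 2 ^ B)" by blast
  note c0 = partial_coloringD[OF c]
  have "d div 2 ^ B = 0" using B by simp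
  then have lonely: "c E e' \<noteq> None" if "E \<in> \<G>" "e \<in> edges E" "e' \<in> nb E e" "c E e = None" for E e e'
  proof -
    have "card {e' \<in> nb E e. c E e' = None} = 0"
      using deg that \<open>d div 2 ^ B = 0\<close> by (simp add: uncolored_degree_le_def)
    then have "{e' \<in> nb E e. c E e' = None} = {}" using nb0(5)[OF that(1,2)] by simp
    then have "e' \<notin> {e' \<in> nb E e. c E e' = None}" by simp
    then show ?thesis using that(3) by simp
  qed
  define F where "F = (\<lambda>(e :: nat set) (y :: nat option) (N :: nat set \<Rightarrow> nat option option) x.
     case y of Some z \<Rightarrow> x = z | None \<Rightarrow> x \<le> d \<and> (\<forall>e' z. N e' = Some (Some z) \<longrightarrow> z \<noteq> x))"
  have "\<exists>g. loc (Suc (T + B * R)) g \<and> (\<forall>E\<in>\<G>. \<forall>e\<in>edges E. F e (c E e) (view (c E) (nb E e)) (g E e))"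
  proof (rule conflict_round[OF _ c0(1)])
    show "conflict_graph (T + B * R) nb d" using conflict_graph_mono[OF nb] by simp
    fix E e assume E: "E \<in> \<G>" "e \<in> edges E"
    have "0 < card {x. x \<le> d \<and> (\<forall>e'\<in>nb E e. c E e' \<noteq> Some x)}"
      using card_free_colors[OF nb E, of c] by simp
    then have "{x. x \<le> d \<and> (\<forall>e'\<in>nb E e. c E e' \<noteq> Some x)} \<noteq> {}" by (metis card.empty less_irrefl)
    then obtain x where "x \<le> d" "\<forall>e'\<in>nb E e. c E e' \<noteq> Some x" by blast
    then show "\<exists>x. F e (c E e) (view (c E) (nb E e)) x" by (cases "c E e") (auto simp: F_def)
  qed
  then obtain g where g: "loc (Suc (T + B * R)) g"
    "\<And>E e. E \<in> \<G> \<Longrightarrow> e \<in> edges E \<Longrightarrow> F e (c E e) (view (c E) (nb E e)) (g E e)" by blast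
  have gS: "g E e = x" if "E \<in> \<G>" "e \<in> edges E" "c E e = Some x" for E e x
    using g(2)[OF that(1,2)] that(3) by (simp add: F_def)
  have gN: "g E e \<le> d \<and> c E e' \<noteq> Some (g E e)" if "E \<in> \<G>" "e \<in> edges E" "c E e = None" "e' \<in> nb E e" for E e e'
    using g(2)[OF that(1,2)] that(3,4) by (auto simp: F_def)
  have gd: "g E e \<le> d" if E: "E \<in> \<G>" "e \<in> edges E" for E e
    using g(2)[OF E] c0(2)[OF E] by (auto simp: F_def split: option.splits)
  have "g E e' \<noteq> g E e" if E: "E \<in> \<G>" "e \<in> edges E" and e': "e' \<in> nb E e" for E e e'
  proof -
    note E' = nb0(6)[OF E e'] and sym = nb0(3)[OF E e']
    show ?thesis
    proof (cases "c E e")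
      case None
      then obtain x where "c E e' = Some x" using lonely[OF E e'] by blast
      then show ?thesis using gN[OF E None e'] gS[OF E(1) E'] by auto
    next
      case (Some x)
      show ?thesis
      proof (cases "c E e'")
        case None
        then show ?thesis using gN[OF E(1) E' None sym] gS[OF E Some] Some by auto
      next
        case (Some y)
        then show ?thesis using c0(3)[OF E e' \<open>c E e = Some x\<close>] gS[OF E \<open>c E e = Some x\<close>] gS[OF E(1) E' Some] by auto
      qed
    qed
  qed
  moreover have "Suc (T + B * R) \<le> T + 1000 * B ^ 4 * (q + 1)"
  proof -
    have "0 < p" using B1 by (auto simp: p_def)
    then have p1: "1 \<le> p * B" using B1 by (simp add: Suc_le_eq)
    have "p \<le> p * B" using B1 by simp
    moreover have "R = 2 * (p * B) + 3 * p + 1" by (simp add: R_def)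
    ultimately have "R \<le> 6 * (p * B)" using p1 by linarith
    then have "B * R \<le> B * (6 * (p * B))" by (rule mult_left_mono) simp
    moreover have "1 \<le> B * (p * B)" using p1 B1 by (simp add: Suc_le_eq)
    ultimately have "1 + B * R \<le> 7 * (B * (p * B))" by linarith
    also have "\<dots> = 896 * B ^ 4 * (q + 1)" by (simp add: p_def power2_eq_square power4_eq_xxxx algebra_simps)
    also have "\<dots> \<le> 1000 * B ^ 4 * (q + 1)" by simp
    finally show ?thesis by simp
  qed
  ultimately show ?thesis using gd loc_mono[OF g(1)] by (intro exI[of _ g]) simp
qed

end

subsection \<open>Splitting colour classes\<close>

definition rank_in :: "nat set \<Rightarrow> nat \<Rightarrow> nat" where
  "rank_in A w = card {w' \<in> A. w' < w}"

lemma rank_in_strict_mono: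
  assumes "finite A" "w \<in> A" "w < w'"
  shows "rank_in A w < rank_in A w'"
  unfolding rank_in_def using assms by (intro psubset_card_mono) auto

lemma inj_on_rank_in: "finite A \<Longrightarrow> inj_on (rank_in A) A"
  by (rule inj_onI) (metis rank_in_strict_mono less_irrefl neq_iff)

lemma rank_in_less_card: "finite A \<Longrightarrow> w \<in> A \<Longrightarrow> rank_in A w < card A"
  unfolding rank_in_def by (rule psubset_card_mono) auto

lemma card_rank_in_group_le:
  assumes "finite A" "0 < t"
  shows "card {w \<in> A. rank_in A w div t = g} \<le> t"
proof -
  have "rank_in A ` {w \<in> A. rank_in A w div t = g} \<subseteq> {g * t..<g * t + t}"
    using assms(2) by (auto simp: dividend_less_times_div mult.commute div_times_less_eq_dividend add.commute)
  then have "card (rank_in A ` {w \<in> A. rank_in A w div t = g}) \<le> card {g * t..<g * t + t}"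
    by (intro card_mono) auto
  moreover have "inj_on (rank_in A) {w \<in> A. rank_in A w div t = g}"
    by (rule inj_on_subset[OF inj_on_rank_in[OF assms(1)]]) auto
  ultimately show ?thesis by (simp add: card_image)
qed

context graph_family
begin

definition class_nbrs :: "(nat \<Rightarrow> nat \<Rightarrow> bool) \<Rightarrow> (nat set \<Rightarrow> 'a) \<Rightarrow> nat \<Rightarrow> 'a \<Rightarrow> nat set" where
  "class_nbrs E \<phi> v z = {w. E v w \<and> \<phi> {v, w} = z}"

lemma finite_class_nbrs: "E \<in> \<G> \<Longrightarrow> finite (class_nbrs E \<phi> v z)"
  by (rule finite_subset[OF _ finite_nbrs[of E v]]) (auto simp: class_nbrs_def nbrs_def)

lemma edgesE:
  assumes "e \<in> edges E"
  obtains u v where "e = {u, v}" "E u v"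
  using assms by (auto simp: edges_def)

text \<open>Every vertex cuts each of its colour classes into groups of \<open>t\<close> edges, and only edges that
  share a group conflict. The conflict graph has degree at most \<open>2 * (t - 1)\<close>, and in a proper
  colouring of it a group contributes at most one edge to each new class.\<close>
lemma split_color_classes:
  fixes t a B q Q :: nat
  assumes \<phi>: "loc T \<phi>" and \<phi>_lt: "\<And>E e. E \<in> \<G> \<Longrightarrow> e \<in> edges E \<Longrightarrow> \<phi> E e < Q"
    and deg: "\<And>E v z. E \<in> \<G> \<Longrightarrow> card (class_nbrs E (\<phi> E) v z) \<le> t * a"
    and \<psi>: "loc T \<psi>" and \<psi>_lt: "\<And>E e. E \<in> \<G> \<Longrightarrow> e \<in> edges E \<Longrightarrow> \<psi> E e < (2::nat) ^ B"
    and \<psi>_ne: "\<And>E e e'. E \<in> \<G> \<Longrightarrow> e \<in> edges E \<Longrightarrow> e' \<in> touching E e \<Longrightarrow> e' \<noteq> e \<Longrightarrow> \<psi> E e' \<noteq> \<psi> E e"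
    and t: "0 < t" and B: "2 * t \<le> 2 ^ B" and q: "2 * (t - 1) \<le> (q + 1)\<^sup>2" "q \<le> 2 * (t - 1)"
  shows "\<exists>\<phi>'. loc (T + (1000 * B ^ 4 * (q + 1) + 1)) \<phi>' \<and>
     (\<forall>E\<in>\<G>. (\<forall>e\<in>edges E. \<phi>' E e < Q * (2 * t - 1)) \<and> (\<forall>v z. card (class_nbrs E (\<phi>' E) v z) \<le> a))"
proof -
  define C where "C E v w = class_nbrs E (\<phi> E) v (\<phi> E {v, w})" for E v w
  define grp where "grp E v w = rank_in (C E v w) w div t" for E v w
  define nb where "nb E e = {e'. \<exists>v w w'. e = {v, w} \<and> e' = {v, w'} \<and> w \<noteq> w' \<and> E v w \<and> E v w' \<and>
      \<phi> E e' = \<phi> E e \<and> grp E v w = grp E v w'}" for E e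
  \<comment> \<open>The group number recomputed from the colours of the touching edges alone. On
    actual edges it equals \<open>grp\<close>, and this makes \<open>nb\<close> local.\<close>
  define ix where "ix N v w = card {w'. N {v, w'} = N {v, w} \<and> w' < w} div t"
    for N :: "nat set \<Rightarrow> nat option" and v w :: nat
  define G where "G e N = {e'. \<exists>v w w'. e = {v, w} \<and> e' = {v, w'} \<and> w \<noteq> w' \<and> N e \<noteq> None \<and> N e' = N e \<and>
      ix N v w = ix N v w'}" for e N
  have finC: "finite (C E v w)" if "E \<in> \<G>" for E v w
    unfolding C_def by (rule finite_class_nbrs[OF that])
  have "loc (Suc T) (\<lambda>E e. G e (view (\<phi> E) (touching E e)))"
    by (rule loc_comp[OF loc_view_touching[OF \<phi>]])
  have nb_G: "nb E e = G e (view (\<phi> E) (touching E e))" if E: "E \<in> \<G>" "e \<in> edges E" for E e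
  proof -
    let ?N = "view (\<phi> E) (touching E e)"
    have N: "?N {v, w} = (if E v w then Some (\<phi> E {v, w}) else None)" if "v \<in> e" for v w
      using that edge_iff[OF E(1)] by (auto simp: view_def touching_def)
    have ix: "ix ?N v w = grp E v w" if "v \<in> e" "E v w" for v w
      unfolding ix_def grp_def rank_in_def C_def class_nbrs_def
      using that by (auto simp: N intro!: arg_cong2[of _ _ _ _ "(div)"] arg_cong[of _ _ card] split: if_splits)
    have "e' \<in> nb E e \<longleftrightarrow> e' \<in> G e ?N" for e'
    proof
      assume "e' \<in> nb E e"
      then obtain v w w' where *: "e = {v, w}" "e' = {v, w'}" "w \<noteq> w'" "E v w" "E v w'"
        "\<phi> E e' = \<phi> E e" "grp E v w = grp E v w'" by (auto simp: nb_def)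
      then have "v \<in> e" by simp
      then have "ix ?N v w = ix ?N v w'" "?N e \<noteq> None" "?N e' = ?N e"
        using ix N * by auto
      then show "e' \<in> G e ?N" using * unfolding G_def by blast
    next
      assume "e' \<in> G e ?N"
      then obtain v w w' where *: "e = {v, w}" "e' = {v, w'}" "w \<noteq> w'" "?N e \<noteq> None" "?N e' = ?N e"
        "ix ?N v w = ix ?N v w'" unfolding G_def by blast
      then have "v \<in> e" by simp
      then have "E v w" "E v w'" "\<phi> E e' = \<phi> E e"
        using N[of v w] N[of v w'] * by (auto split: if_splits)
      then show "e' \<in> nb E e" using * ix \<open>v \<in> e\<close> unfolding nb_def by auto
    qed
    then show ?thesis by blast
  qed
  have "loc (Suc T) nb"
    unfolding loc_def
  proof (intro ballI allI impI)
    fix E E' u v assume uv: "E \<in> \<G>" "E' \<in> \<G>" "E u v" "same_view (Suc T) E E' u"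
    then have "E' u v" using same_view_nbrs[of "Suc T" E E' u] by (auto simp: nbrs_def)
    then have "{u, v} \<in> edges E" "{u, v} \<in> edges E'" using uv edge_iff by blast+
    then show "nb E {u, v} = nb E' {u, v}"
      using nb_G uv \<open>loc (Suc T) (\<lambda>E e. G e (view (\<phi> E) (touching E e)))\<close> unfolding loc_def by simp
  qed
  have nb_sub: "nb E e \<subseteq> touching E e - {e}" if "E \<in> \<G>" "e \<in> edges E" for E e
    using edge_iff[OF that(1)] by (auto simp: nb_def touching_def doubleton_eq_iff)
  have nb: "conflict_graph (Suc T) nb (2 * (t - 1))"
    unfolding conflict_graph_def
  proof (intro conjI ballI)
    show "loc (Suc T) nb" by fact
    fix E e assume E: "E \<in> \<G>" "e \<in> edges E"
    show "nb E e \<subseteq> touching E e" "e \<notin> nb E e" using nb_sub[OF E] by auto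
    show "e \<in> nb E e'" if "e' \<in> nb E e" for e'
    proof -
      from that obtain v w w' where "e = {v, w}" "e' = {v, w'}" "w \<noteq> w'" "E v w" "E v w'"
        "\<phi> E e' = \<phi> E e" "grp E v w = grp E v w'" by (auto simp: nb_def)
      then have "e' = {v, w'} \<and> e = {v, w} \<and> w' \<noteq> w \<and> E v w' \<and> E v w \<and> \<phi> E e = \<phi> E e' \<and>
        grp E v w' = grp E v w" by simp
      then show ?thesis unfolding nb_def by blast
    qed
    obtain u0 v0 where e: "e = {u0, v0}" "E u0 v0" using edgesE[OF E(2)] .
    have "E v0 u0" using edge_sym[OF E(1) e(2)] .
    define D where "D v w = {w' \<in> C E v w. rank_in (C E v w) w' div t = grp E v w} - {w}" for v w
    have D: "card (D v w) \<le> t - 1" "finite (D v w)" if "E v w" for v w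
    proof -
      let ?D = "{w' \<in> C E v w. rank_in (C E v w) w' div t = grp E v w}"
      have "w \<in> ?D" using that by (simp add: C_def class_nbrs_def grp_def)
      then show "card (D v w) \<le> t - 1"
        unfolding D_def using card_rank_in_group_le[OF finC[OF E(1)] t] by (simp add: diff_le_mono)
      show "finite (D v w)" using finC[OF E(1)] by (simp add: D_def)
    qed
    have "nb E e \<subseteq> (\<lambda>w. {u0, w}) ` D u0 v0 \<union> (\<lambda>w. {v0, w}) ` D v0 u0"
    proof
      fix e' assume "e' \<in> nb E e"
      then obtain v w w' where *: "e = {v, w}" "e' = {v, w'}" "w \<noteq> w'" "E v w" "E v w'"
        "\<phi> E e' = \<phi> E e" "grp E v w = grp E v w'" by (auto simp: nb_def)
      then have "C E v w' = C E v w" by (simp add: C_def)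
      then have "w' \<in> D v w" using * by (auto simp: D_def C_def class_nbrs_def grp_def)
      then show "e' \<in> (\<lambda>w. {u0, w}) ` D u0 v0 \<union> (\<lambda>w. {v0, w}) ` D v0 u0"
        using *(1,2) e(1) by (auto simp: doubleton_eq_iff)
    qed
    then have "card (nb E e) \<le> card ((\<lambda>w. {u0, w}) ` D u0 v0 \<union> (\<lambda>w. {v0, w}) ` D v0 u0)"
      using D(2)[OF e(2)] D(2)[OF \<open>E v0 u0\<close>] by (intro card_mono) auto
    also have "\<dots> \<le> card ((\<lambda>w. {u0, w}) ` D u0 v0) + card ((\<lambda>w. {v0, w}) ` D v0 u0)"
      by (rule card_Un_le)
    also have "\<dots> \<le> card (D u0 v0) + card (D v0 u0)"
      using D(2)[OF e(2)] D(2)[OF \<open>E v0 u0\<close>] by (intro add_mono card_image_le)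
    also have "\<dots> \<le> 2 * (t - 1)" using D(1)[OF e(2)] D(1)[OF \<open>E v0 u0\<close>] by simp
    finally show "card (nb E e) \<le> 2 * (t - 1)" .
  qed
  have "\<exists>col. loc (Suc T + 1000 * B ^ 4 * (q + 1)) col \<and> (\<forall>E\<in>\<G>. \<forall>e\<in>edges E.
     col E e \<le> 2 * (t - 1) \<and> (\<forall>e'\<in>nb E e. col E e' \<noteq> col E e))"
  proof (rule degree_plus_one_coloring[OF nb _ \<psi>_lt])
    show "loc (Suc T) \<psi>" using loc_mono[OF \<psi>] by simp
    show "\<psi> E e' \<noteq> \<psi> E e" if "E \<in> \<G>" "e \<in> edges E" "e' \<in> nb E e" for E e e'
      using \<psi>_ne[OF that(1,2)] nb_sub[OF that(1,2)] that(3) by blast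
  qed (use t B q in auto)
  then obtain col where col: "loc (Suc T + 1000 * B ^ 4 * (q + 1)) col"
    and col_le: "\<And>E e. E \<in> \<G> \<Longrightarrow> e \<in> edges E \<Longrightarrow> col E e \<le> 2 * (t - 1)"
    and col_ne: "\<And>E e e'. E \<in> \<G> \<Longrightarrow> e \<in> edges E \<Longrightarrow> e' \<in> nb E e \<Longrightarrow> col E e' \<noteq> col E e" by blast
  have col_lt: "col E e < 2 * t - 1" if "E \<in> \<G>" "e \<in> edges E" for E e
    using col_le[OF that] t by simp
  define \<phi>' where "\<phi>' E e = \<phi> E e * (2 * t - 1) + col E e" for E e
  have "loc (Suc T + 1000 * B ^ 4 * (q + 1)) \<phi>'"
    using loc_comp2[OF loc_mono[OF \<phi>] col, of "\<lambda>e x y. x * (2 * t - 1) + y"] by (simp add: \<phi>'_def[abs_def])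
  moreover have "\<phi>' E e < Q * (2 * t - 1)" if E: "E \<in> \<G>" "e \<in> edges E" for E e
  proof -
    have "(\<phi> E e + 1) * (2 * t - 1) \<le> Q * (2 * t - 1)"
      using \<phi>_lt[OF E] by (intro mult_le_mono1) simp
    then show ?thesis using col_lt[OF E] by (simp add: \<phi>'_def)
  qed
  moreover have "card (class_nbrs E (\<phi>' E) v z) \<le> a" if E: "E \<in> \<G>" for E v z
  proof -
    define m where "m = 2 * t - 1"
    let ?W = "class_nbrs E (\<phi>' E) v z" and ?A = "class_nbrs E (\<phi> E) v (z div m)"
    have finA: "finite ?A" by (rule finite_class_nbrs[OF E])
    have W: "w \<in> ?A \<and> col E {v, w} = z mod m" if "w \<in> ?W" for w
    proof -
      have w: "E v w" "\<phi>' E {v, w} = z" using that by (auto simp: class_nbrs_def)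
      then have "col E {v, w} < m" using col_lt[OF E] edge_iff[OF E] by (simp add: m_def)
      moreover have "z = \<phi> E {v, w} * m + col E {v, w}" using w(2) unfolding \<phi>'_def m_def by (rule sym)
      ultimately have "z div m = \<phi> E {v, w}" "z mod m = col E {v, w}" by simp_all
      then show ?thesis using w(1) by (simp add: class_nbrs_def)
    qed
    have C_A: "C E v w = ?A" if "w \<in> ?A" for w using that by (simp add: C_def class_nbrs_def)
    \<comment> \<open>Edges at \<open>v\<close> in one new class come from one old class and from
      different groups; an old class of size at most \<open>t * a\<close> has at most
      \<open>a\<close> groups.\<close>
    have "inj_on (\<lambda>w. rank_in ?A w div t) ?W"
    proof (rule inj_onI, rule ccontr)
      fix w w' assume w: "w \<in> ?W" "w' \<in> ?W" "rank_in ?A w div t = rank_in ?A w' div t" "w \<noteq> w'"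
      have A: "w \<in> ?A" "w' \<in> ?A" using W w by auto
      then have "grp E v w = grp E v w'" using w(3) C_A by (simp add: grp_def)
      then have "{v, w} = {v, w} \<and> {v, w'} = {v, w'} \<and> w \<noteq> w' \<and> E v w \<and> E v w' \<and>
          \<phi> E {v, w'} = \<phi> E {v, w} \<and> grp E v w = grp E v w'"
        using A w(4) by (simp add: class_nbrs_def)
      then have "{v, w'} \<in> nb E {v, w}" unfolding nb_def mem_Collect_eq by blast
      moreover have "{v, w} \<in> edges E" using A(1) edge_iff[OF E] by (simp add: class_nbrs_def)
      ultimately have "col E {v, w'} \<noteq> col E {v, w}" using col_ne[OF E] by blast
      then show False using W[OF w(1)] W[OF w(2)] by simp
    qed
    moreover have "(\<lambda>w. rank_in ?A w div t) ` ?W \<subseteq> {..<a}"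
    proof
      fix y assume "y \<in> (\<lambda>w. rank_in ?A w div t) ` ?W"
      then obtain w where w: "w \<in> ?W" "y = rank_in ?A w div t" by blast
      then have "rank_in ?A w < t * a"
        using rank_in_less_card[OF finA, of w] W[OF w(1)] deg[OF E, of v "z div m"] by linarith
      then show "y \<in> {..<a}" using w(2) by (simp add: less_mult_imp_div_less mult.commute)
    qed
    ultimately have "card ?W \<le> card {..<a}" by (meson card_inj_on_le finite_lessThan)
    then show ?thesis by simp
  qed
  ultimately show ?thesis by (intro exI[of _ \<phi>']) simp
qed

text \<open>The colouring \<psi> is computed once and reused in every iteration, so its cost is not
  multiplied by \<open>j\<close>.\<close>

lemma split_color_classes_iterate:
  fixes t a B q Q :: nat
  assumes \<phi>: "loc T \<phi>" and \<phi>_lt: "\<And>E e. E \<in> \<G> \<Longrightarrow> e \<in> edges E \<Longrightarrow> \<phi> E e < Q"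
    and deg: "\<And>E v z. E \<in> \<G> \<Longrightarrow> card (class_nbrs E (\<phi> E) v z) \<le> t ^ j * a"
    and \<psi>: "loc T \<psi>" and \<psi>_lt: "\<And>E e. E \<in> \<G> \<Longrightarrow> e \<in> edges E \<Longrightarrow> \<psi> E e < (2::nat) ^ B"
    and \<psi>_ne: "\<And>E e e'. E \<in> \<G> \<Longrightarrow> e \<in> edges E \<Longrightarrow> e' \<in> touching E e \<Longrightarrow> e' \<noteq> e \<Longrightarrow> \<psi> E e' \<noteq> \<psi> E e"
    and t: "0 < t" and B: "2 * t \<le> 2 ^ B" and q: "2 * (t - 1) \<le> (q + 1)\<^sup>2" "q \<le> 2 * (t - 1)"
  shows "\<exists>\<phi>'. loc (T + j * (1000 * B ^ 4 * (q + 1) + 1)) \<phi>' \<and>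
     (\<forall>E\<in>\<G>. (\<forall>e\<in>edges E. \<phi>' E e < Q * (2 * t - 1) ^ j) \<and> (\<forall>v z. card (class_nbrs E (\<phi>' E) v z) \<le> a))"
  using deg
proof (induction j arbitrary: a)
  case 0
  then show ?case using \<phi> \<phi>_lt by (intro exI[of _ \<phi>]) simp
next
  case (Suc j)
  let ?R = "1000 * B ^ 4 * (q + 1) + 1"
  have "\<exists>\<phi>'. loc (T + j * ?R) \<phi>' \<and>
     (\<forall>E\<in>\<G>. (\<forall>e\<in>edges E. \<phi>' E e < Q * (2 * t - 1) ^ j) \<and> (\<forall>v z. card (class_nbrs E (\<phi>' E) v z) \<le> t * a))"
    using Suc.prems by (intro Suc.IH) (simp add: mult_ac)
  then obtain \<phi>1 where \<phi>1: "loc (T + j * ?R) \<phi>1"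
    "\<And>E e. E \<in> \<G> \<Longrightarrow> e \<in> edges E \<Longrightarrow> \<phi>1 E e < Q * (2 * t - 1) ^ j"
    "\<And>E v z. E \<in> \<G> \<Longrightarrow> card (class_nbrs E (\<phi>1 E) v z) \<le> t * a" by blast
  have "\<exists>\<phi>'. loc (T + j * ?R + ?R) \<phi>' \<and>
     (\<forall>E\<in>\<G>. (\<forall>e\<in>edges E. \<phi>' E e < Q * (2 * t - 1) ^ j * (2 * t - 1)) \<and> (\<forall>v z. card (class_nbrs E (\<phi>' E) v z) \<le> a))"
    by (rule split_color_classes[OF \<phi>1 _ \<psi>_lt \<psi>_ne t B q]) (use loc_mono[OF \<psi>] in auto)
  moreover have "T + j * ?R + ?R = T + Suc j * ?R" by simp
  moreover have "Q * (2 * t - 1) ^ j * (2 * t - 1) = Q * (2 * t - 1) ^ Suc j" by simp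
  ultimately show ?case by (simp only:)
qed

end

subsection \<open>An initial colouring in log-star time\<close>

lemma exists_distinct_bit:
  fixes x y :: nat
  assumes "x \<noteq> y" "x < 2 ^ k" "y < 2 ^ k"
  shows "\<exists>b<k. bit x b \<noteq> bit y b"
proof (rule ccontr)
  assume "\<not> ?thesis"
  then have "take_bit k x = take_bit k y" by (auto simp: bit_eq_iff bit_take_bit_iff)
  then show False using assms by (simp add: take_bit_nat_eq_self)
qed

lemma half_le_ln_2: "1 / 2 \<le> ln (2::real)"
proof -
  have "exp (1 / 2 :: real) \<le> 1 + 1 / 2 + (1 / 2)\<^sup>2" by (rule exp_bound) auto
  also have "\<dots> \<le> 2" by (simp add: power2_eq_square)
  finally show ?thesis by (simp only: ln_ge_iff zero_less_numeral)
qed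

text \<open>From 2 on a logarithm step loses at least 1, so the iteration gets down to 1 and the
  \<open>LEAST\<close> in \<open>log_star\<close> is attained. Equality holds at 2, hence the
  splitting of \<open>ln y\<close> there.\<close>

lemma log_2_le_minus_one:
  assumes "2 \<le> (y::real)"
  shows "log 2 y \<le> y - 1"
proof -
  have "ln y = ln 2 + ln (y / 2)" using assms by (simp add: ln_div)
  also have "\<dots> \<le> ln 2 + (y / 2 - 1)" using assms by (intro add_left_mono ln_le_minus_one) auto
  also have "y / 2 - 1 = 1 / 2 * (y - 2)" by simp
  also have "\<dots> \<le> ln 2 * (y - 2)" using assms half_le_ln_2 by (intro mult_right_mono) auto
  finally have "ln y \<le> ln 2 * (y - 1)" by (simp add: algebra_simps)
  then show ?thesis by (simp add: log_def divide_le_eq mult.commute)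
qed

lemma iterated_log_le_one: "\<exists>i. ((\<lambda>y. log 2 y) ^^ i) y \<le> 1" if "y \<le> real m + 1"
  using that
proof (induction m arbitrary: y)
  case 0
  then show ?case by (intro exI[of _ 0]) simp
next
  case (Suc m)
  show ?case
  proof (cases "y \<le> 2")
    case True
    show ?thesis
    proof (cases "y \<le> 1")
      case False
      then have "log 2 y \<le> log 2 2" using True by (subst log_le_cancel_iff) auto
      then show ?thesis by (intro exI[of _ 1]) simp
    qed (intro exI[of _ 0], simp)
  next
    case False
    then have "log 2 y \<le> real m + 1" using Suc.prems log_2_le_minus_one[of y] by simp
    then obtain i where "((\<lambda>y. log 2 y) ^^ i) (log 2 y) \<le> 1" using Suc.IH by blast
    then show ?thesis by (intro exI[of _ "Suc i"]) (simp only: funpow_Suc_right o_apply)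
  qed
qed

lemma log_star_le_one: "((\<lambda>y. log 2 y) ^^ log_star n) (real n) \<le> 1"
  unfolding log_star_def by (rule LeastI_ex) (rule iterated_log_le_one[of _ n], simp)

lemma log_star_gt_one: "i < log_star n \<Longrightarrow> 1 < ((\<lambda>y. log 2 y) ^^ i) (real n)"
  unfolding log_star_def using not_less_Least by fastforce

section \<open>Cole-Vishkin colour reduction on paths\<close>

context graph_family
begin

lemma edge_Min_Max:
  assumes E: "E \<in> \<G>" and e: "e \<in> edges E"
  shows "e = {Min e, Max e}" "Min e < Max e" "E (Min e) (Max e)"
proof -
  obtain u v where uv: "e = {u, v}" "E u v" using edgesE[OF e] .
  have "u \<noteq> v" "E v u" using uv edge_irrefl[OF E] edge_sym[OF E] by auto
  then show "e = {Min e, Max e}" "Min e < Max e" "E (Min e) (Max e)"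
    using uv by (auto simp: min_def max_def)
qed

text \<open>Edges with equal labels form vertex-disjoint paths that are monotone in the identifiers.\<close>
definition path_labelling where
  "path_labelling T lab \<longleftrightarrow> loc T lab \<and> (\<forall>E\<in>\<G>. \<forall>e\<in>edges E. \<forall>e'\<in>edges E. lab E e = (lab E e' :: nat) \<longrightarrow>
     (Min e = Min e' \<longrightarrow> e = e') \<and> (Max e = Max e' \<longrightarrow> e = e'))"

lemma path_labelling_touching:
  assumes "path_labelling T lab" "E \<in> \<G>" "e \<in> edges E" "e' \<in> touching E e" "e' \<noteq> e" "lab E e' = lab E e"
  shows "Min e' = Max e \<or> Min e = Max e'"
proof -
  have e': "e' \<in> edges E" "e' \<inter> e \<noteq> {}" using assms(4) by (auto simp: touching_def)
  have "Min e \<noteq> Min e'" "Max e \<noteq> Max e'"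
    using assms e' unfolding path_labelling_def by metis+
  moreover have "{Min e', Max e'} \<inter> {Min e, Max e} \<noteq> {}"
    using e'(2) edge_Min_Max(1)[OF assms(2,3)] edge_Min_Max(1)[OF assms(2) e'(1)] by simp
  ultimately show ?thesis by auto
qed

text \<open>The label of an edge consists of its port numbers at the smaller and at the larger endpoint.\<close>
lemma exists_path_labelling:
  assumes deg: "\<And>E v. E \<in> \<G> \<Longrightarrow> card (nbrs E v) \<le> D"
  shows "\<exists>lab. path_labelling 1 lab \<and> (\<forall>E\<in>\<G>. \<forall>e\<in>edges E. lab E e < D * D)"
proof -
  define lab where "lab E e = rank_in (nbrs E (Min e)) (Max e) * D + rank_in (nbrs E (Max e)) (Min e)" for E e
  define ix where "ix N v w = card {w'. N {v, w'} \<noteq> None \<and> w' < w}"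
    for N :: "nat set \<Rightarrow> unit option" and v w :: nat
  define G where "G e N = ix N (Min e) (Max e) * D + ix N (Max e) (Min e)" for e N
  \<comment> \<open>The view of a constant function shows just which touching edges exist; one round
    thus suffices to read off port numbers.\<close>
  have "loc 1 (\<lambda>E e. G e (view (\<lambda>_. ()) (touching E e)))"
    using loc_comp[OF loc_view_touching[OF loc_const]] by simp
  have lab_G: "lab E e = G e (view (\<lambda>_. ()) (touching E e))" if E: "E \<in> \<G>" "e \<in> edges E" for E e
  proof -
    have ix: "ix (view (\<lambda>_. ()) (touching E e)) v w = rank_in (nbrs E v) w" if "v \<in> e" for v w
      unfolding ix_def rank_in_def using that edge_iff[OF E(1)]
      by (intro arg_cong[of _ _ card]) (auto simp: view_def touching_def nbrs_def)
    have "Min e \<in> e" "Max e \<in> e" using edge_Min_Max(1)[OF E] by blast+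
    then show ?thesis by (simp add: lab_def G_def ix)
  qed
  have "loc 1 lab"
    unfolding loc_def
  proof (intro ballI allI impI)
    fix E E' u v assume uv: "E \<in> \<G>" "E' \<in> \<G>" "E u v" "same_view 1 E E' u"
    then have "E' u v" using same_view_nbrs[of 1 E E' u] by (auto simp: nbrs_def)
    then have "{u, v} \<in> edges E" "{u, v} \<in> edges E'" using uv edge_iff by blast+
    moreover have "G {u, v} (view (\<lambda>_. ()) (touching E {u, v})) = G {u, v} (view (\<lambda>_. ()) (touching E' {u, v}))"
      using \<open>loc 1 (\<lambda>E e. G e (view (\<lambda>_. ()) (touching E e)))\<close> uv unfolding loc_def by blast
    ultimately show "lab E {u, v} = lab E' {u, v}" using lab_G uv(1,2) by simp
  qed
  have rank: "rank_in (nbrs E v) w < D" if "E \<in> \<G>" "E v w" for E v w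
    using rank_in_less_card[OF finite_nbrs[OF that(1)], of w v] deg[OF that(1), of v] that(2)
    by (simp add: nbrs_def)
  have ports: "rank_in (nbrs E (Min e)) (Max e) < D" "rank_in (nbrs E (Max e)) (Min e) < D"
    if E: "E \<in> \<G>" "e \<in> edges E" for E e
    using rank[OF E(1)] edge_Min_Max(3)[OF E] edge_sym[OF E(1)] by blast+
  have lab_lt: "lab E e < D * D" if E: "E \<in> \<G>" "e \<in> edges E" for E e
  proof -
    have "(rank_in (nbrs E (Min e)) (Max e) + 1) * D \<le> D * D"
      using ports(1)[OF E] by (intro mult_le_mono1) simp
    then show ?thesis using ports(2)[OF E] by (simp add: lab_def)
  qed
  have "path_labelling 1 lab"
    unfolding path_labelling_def
  proof (intro conjI ballI impI)
    show "loc 1 lab" by fact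
    fix E e e' assume E: "E \<in> \<G>" "e \<in> edges E" "e' \<in> edges E" and eq: "lab E e = lab E e'"
    have "lab E x div D = rank_in (nbrs E (Min x)) (Max x) \<and> lab E x mod D = rank_in (nbrs E (Max x)) (Min x)"
      if "x \<in> edges E" for x
      using ports[OF E(1) that] by (simp add: lab_def)
    then have ranks: "rank_in (nbrs E (Min e)) (Max e) = rank_in (nbrs E (Min e')) (Max e')"
      "rank_in (nbrs E (Max e)) (Min e) = rank_in (nbrs E (Max e')) (Min e')"
      using E(2,3) eq by metis+
    have inj: "w = w'" if "E v w" "E v w'" "rank_in (nbrs E v) w = rank_in (nbrs E v) w'" for v w w'
      using inj_onD[OF inj_on_rank_in[OF finite_nbrs[OF E(1), of v]] that(3)] that(1,2) by (simp add: nbrs_def)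
    note mm = edge_Min_Max[OF E(1,2)] and mm' = edge_Min_Max[OF E(1,3)]
    {
      assume "Min e = Min e'"
      then have "Max e = Max e'" using inj[of "Min e" "Max e" "Max e'"] ranks(1) mm(3) mm'(3) by simp
      then show "e = e'" using mm(1) mm'(1) \<open>Min e = Min e'\<close> by simp
    }
    {
      assume "Max e = Max e'"
      then have "Min e = Min e'"
        using inj[of "Max e" "Min e" "Min e'"] ranks(2) edge_sym[OF E(1) mm(3)] edge_sym[OF E(1) mm'(3)] by simp
      then show "e = e'" using mm(1) mm'(1) \<open>Max e = Max e'\<close> by simp
    }
  qed
  then show ?thesis using lab_lt by blast
qed

text \<open>The bound \<open>X\<close> is real so that iterated logarithms can be followed without
  rounding.\<close>

definition proper_on_paths where
  "proper_on_paths T lab c X \<longleftrightarrow> loc T c \<and> (\<forall>E\<in>\<G>. \<forall>e\<in>edges E. real (c E e) < X \<and>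
     (\<forall>e'\<in>touching E e. e' \<noteq> e \<and> lab E e' = (lab E e :: nat) \<longrightarrow> c E e' \<noteq> (c E e :: nat)))"

text \<open>One step of Cole and Vishkin.\<close>
lemma proper_on_paths_reduce:
  assumes lab: "path_labelling T lab" and c: "proper_on_paths T lab c X" and X: "1 < X"
  shows "\<exists>c'. proper_on_paths (Suc T) lab c' (2 * (log 2 X + 1))"
proof -
  define k where "k = nat \<lceil>log 2 X\<rceil>"
  have "0 < log 2 X" using X by simp
  then have k: "log 2 X \<le> real k" "real k < log 2 X + 1" unfolding k_def by linarith+
  then have "0 < k" using \<open>0 < log 2 X\<close> by linarith
  have "X = 2 powr (log 2 X)" using X by simp
  also have "\<dots> \<le> 2 powr real k" using k by (intro powr_mono) auto
  finally have Xk: "X \<le> 2 ^ k" by (simp add: powr_realpow)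
  have locs: "loc T lab" "loc T c" using lab c by (auto simp: path_labelling_def proper_on_paths_def)
  have c_lt: "c E e < 2 ^ k" if "E \<in> \<G>" "e \<in> edges E" for E e
  proof -
    have "real (c E e) < X" using c that by (simp add: proper_on_paths_def)
    then have "real (c E e) < 2 ^ k" using Xk by linarith
    then show ?thesis by simp
  qed
  have c_ne: "c E e' \<noteq> c E e" if "E \<in> \<G>" "e \<in> edges E" "e' \<in> touching E e" "e' \<noteq> e" "lab E e' = lab E e" for E e e'
    using c that by (simp add: proper_on_paths_def)
  \<comment> \<open>An edge compares itself with its successor, the edge of the same label that
    starts at its larger endpoint; the labelling makes it unique. Without a successor the index 0 is
    legal because \<open>0 < k\<close>.\<close>
  define R where "R = (\<lambda>e (N :: nat set \<Rightarrow> (nat \<times> nat) option) b. b < k \<and> (\<forall>l x e' x'. N e = Some (l, x) \<longrightarrow>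
     N e' = Some (l, x') \<longrightarrow> e' \<noteq> e \<longrightarrow> Min e' = Max e \<longrightarrow> bit x b \<noteq> bit x' b))"
  have "\<exists>g. loc (Suc T) g \<and> (\<forall>E\<in>\<G>. \<forall>e\<in>edges E. R e (view (\<lambda>e. (lab E e, c E e)) (touching E e)) (g E e))"
  proof (rule loc_round)
    show "loc T (\<lambda>E e. (lab E e, c E e))" using locs by (rule loc_Pair)
    fix E e assume E: "E \<in> \<G>" "e \<in> edges E"
    show "\<exists>b. R e (view (\<lambda>e. (lab E e, c E e)) (touching E e)) b"
    proof (cases "\<exists>e'\<in>touching E e. e' \<noteq> e \<and> lab E e' = lab E e \<and> Min e' = Max e")
      case True
      then obtain e1 where e1: "e1 \<in> touching E e" "e1 \<noteq> e" "lab E e1 = lab E e" "Min e1 = Max e" by blast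
      have E1: "e1 \<in> edges E" using e1(1) by (simp add: touching_def)
      obtain b where b: "b < k" "bit (c E e) b \<noteq> bit (c E e1) b"
        using exists_distinct_bit[OF c_ne[OF E e1(1-3), symmetric] c_lt[OF E] c_lt[OF E(1) E1]] by blast
      have "e' = e1" if "e' \<in> touching E e" "lab E e' = lab E e" "Min e' = Max e" for e'
      proof -
        have "e' \<in> edges E" using that(1) by (simp add: touching_def)
        moreover have "lab E e' = lab E e1" "Min e' = Min e1" using that e1 by simp_all
        ultimately show ?thesis using lab E(1) E1 unfolding path_labelling_def by blast
      qed
      then have "R e (view (\<lambda>e. (lab E e, c E e)) (touching E e)) b"
        using b by (auto simp: R_def)
      then show ?thesis by blast
    next
      case False
      then have "R e (view (\<lambda>e. (lab E e, c E e)) (touching E e)) 0"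
        using \<open>0 < k\<close> by (auto simp: R_def)
      then show ?thesis by blast
    qed
  qed
  then obtain g where g: "loc (Suc T) g"
    and gR: "\<And>E e. E \<in> \<G> \<Longrightarrow> e \<in> edges E \<Longrightarrow> R e (view (\<lambda>e. (lab E e, c E e)) (touching E e)) (g E e)" by blast
  define c' where "c' E e = 2 * g E e + (if bit (c E e) (g E e) then 1 else 0)" for E e
  have inj: "g E e = g E e' \<and> (bit (c E e) (g E e) \<longleftrightarrow> bit (c E e') (g E e'))" if "c' E e = c' E e'" for E e e'
  proof -
    have "c' E x div 2 = g E x" "c' E x mod 2 = (if bit (c E x) (g E x) then 1 else 0)" for x
      by (simp_all add: c'_def)
    then show ?thesis using that by (metis zero_neq_one)
  qed
  \<comment> \<open>Equal new colours would give the same index and the same bit there, but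
    \<open>e\<close> chose an index at which the two old colours differ.\<close>
  have succ: "c' E e \<noteq> c' E e'"
    if E: "E \<in> \<G>" "e \<in> edges E" and e': "e' \<in> touching E e" "e' \<noteq> e" "lab E e' = lab E e" "Min e' = Max e" for E e e'
  proof
    assume "c' E e = c' E e'"
    then have "g E e = g E e'" "bit (c E e) (g E e) \<longleftrightarrow> bit (c E e') (g E e)" using inj[of E e e'] by auto
    moreover have "bit (c E e) (g E e) \<noteq> bit (c E e') (g E e)"
      using gR[OF E] e' touching_self[OF E(2)] by (simp add: R_def)
    ultimately show False by blast
  qed
  have "proper_on_paths (Suc T) lab c' (2 * (log 2 X + 1))"
    unfolding proper_on_paths_def
  proof (intro conjI ballI impI)
    show "loc (Suc T) c'"
      using loc_comp2[OF g loc_mono[OF locs(2)], of "\<lambda>e b x. 2 * b + (if bit x b then 1 else 0)"]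
      by (simp add: c'_def[abs_def])
  next
    fix E e assume E: "E \<in> \<G>" "e \<in> edges E"
    have "g E e < k" using gR[OF E] by (simp add: R_def)
    then have "c' E e < 2 * k" by (simp add: c'_def)
    then have "real (c' E e) < 2 * real k" by linarith
    also have "2 * real k < 2 * (log 2 X + 1)" using k(2) by simp
    finally show "real (c' E e) < 2 * (log 2 X + 1)" .
    fix e' assume e': "e' \<in> touching E e" "e' \<noteq> e \<and> lab E e' = lab E e"
    have E': "e' \<in> edges E" "e \<in> touching E e'" using e'(1) E(2) by (auto simp: touching_def)
    have "Min e' = Max e \<or> Min e = Max e'"
      using path_labelling_touching[OF lab E e'(1)] e'(2) by blast
    then show "c' E e' \<noteq> c' E e"
      using succ[OF E e'(1)] succ[OF E(1) E'(1,2)] e'(2) by metis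
  qed
  then show ?thesis by blast
qed

text \<open>The smaller endpoint is a valid first colour, as edges of equal label have different
  minima. Afterwards the bound stays within the factor \<open>K = 16 + 2 * c\<close> of the iterated
  logarithm: by \<open>log 2 K \<le> 6 + c\<close> a step takes \<open>K * y\<close> to at most
  \<open>14 + 2 * c + 2 * log 2 y\<close>, and so to at most \<open>K * max 1 (log 2 y)\<close>. The
  maximum covers the last iterate, which may drop below 1.\<close>

lemma proper_on_paths_log_star:
  assumes lab: "path_labelling 1 lab" and ids: "\<And>E u v. E \<in> \<G> \<Longrightarrow> E u v \<Longrightarrow> u < n ^ c"
  shows "\<exists>col. proper_on_paths (1 + log_star n) lab col (16 + 2 * real c)"
proof -
  let ?L = "\<lambda>i. ((\<lambda>y. log 2 y) ^^ i) (real n)"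
  define K where "K = 16 + 2 * real c"
  have K: "log 2 K \<le> 6 + real c"
  proof -
    have "real c + 1 \<le> 2 ^ c" using less_exp[of c] by (metis Suc_eq_plus1 Suc_leI of_nat_Suc of_nat_le_iff of_nat_numeral of_nat_power add.commute)
    then have "K \<le> 64 * 2 ^ c" by (simp add: K_def)
    also have "\<dots> = 2 powr (6 + real c)" by (simp add: powr_add powr_realpow)
    finally have "log 2 K \<le> log 2 (2 powr (6 + real c))" by (subst log_le_cancel_iff) (auto simp: K_def)
    then show ?thesis by simp
  qed
  have lab': "path_labelling (1 + i) lab" for i
    using lab loc_mono[of 1 lab "1 + i"] by (simp add: path_labelling_def)
  have Min_col: "proper_on_paths 1 lab (\<lambda>E e. Min e) (real (n ^ c))"
    unfolding proper_on_paths_def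
  proof (intro conjI ballI impI)
    show "loc 1 (\<lambda>E e. Min e)" by (rule loc_const)
    fix E e assume E: "E \<in> \<G>" "e \<in> edges E"
    show "real (Min e) < real (n ^ c)" using ids[OF E(1) edge_Min_Max(3)[OF E]] by (simp only: of_nat_less_iff)
    fix e' assume e': "e' \<in> touching E e" "e' \<noteq> e \<and> lab E e' = lab E e"
    then have "e' \<in> edges E" by (simp add: touching_def)
    then show "Min e' \<noteq> Min e" using lab E e'(2) unfolding path_labelling_def by blast
  qed
  have step: "\<exists>col. proper_on_paths (1 + Suc i) lab col (K * max 1 (?L (Suc i)))" if "Suc i \<le> log_star n" for i
    using that
  proof (induction i)
    case 0
    then have n: "1 < real n" using log_star_gt_one[of 0 n] by simp
    show ?case
    \<comment> \<open>For \<open>c = 0\<close> the only possible identifier is 0, so there are no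
      edges; the reduction step would fail its condition \<open>1 < X\<close>.\<close>
    proof (cases "c = 0")
      case True
      then have "u = 0" if "E \<in> \<G>" "E u v" for E u v using ids[OF that] by simp
      then have none: "\<not> E u v" if "E \<in> \<G>" for E u v using edge_sym[OF that] edge_irrefl[OF that] that by metis
      have "edges E = {}" if "E \<in> \<G>" for E using none[OF that] by (auto simp: edges_def)
      then have "proper_on_paths (1 + Suc 0) lab (\<lambda>E e. 0) (K * max 1 (?L (Suc 0)))"
        by (simp add: proper_on_paths_def loc_const)
      then show ?thesis by blast
    next
      case False
      then have "1 < real (n ^ c)" using n by (simp add: one_less_power)
      from proper_on_paths_reduce[OF lab Min_col this]
      obtain col where col: "proper_on_paths (Suc 1) lab col (2 * (log 2 (real (n ^ c)) + 1))" by blast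
      have "log 2 (real (n ^ c)) = real c * log 2 (real n)" using n by (simp add: log_nat_power)
      moreover have "real c * log 2 (real n) \<le> real c * max 1 (log 2 (real n))" by (intro mult_left_mono) auto
      moreover have "K * max 1 (log 2 (real n)) = 16 * max 1 (log 2 (real n)) + 2 * (real c * max 1 (log 2 (real n)))"
        by (simp add: K_def algebra_simps)
      ultimately have le: "2 * (log 2 (real (n ^ c)) + 1) \<le> K * max 1 (?L (Suc 0))" by simp
      have "proper_on_paths (1 + Suc 0) lab col (K * max 1 (?L (Suc 0)))"
        using col order.strict_trans2[OF _ le] by (auto simp: proper_on_paths_def)
      then show ?thesis by blast
    qed
  next
    case (Suc i)
    have L: "1 < ?L (Suc i)" using log_star_gt_one[of "Suc i" n] Suc.prems by linarith
    then obtain col where "proper_on_paths (1 + Suc i) lab col (K * ?L (Suc i))"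
      using Suc by (auto simp: max_def)
    moreover have "1 < K * ?L (Suc i)"
    proof -
      have "1 * 1 < K * ?L (Suc i)" using L by (intro mult_strict_mono) (auto simp: K_def)
      then show ?thesis by simp
    qed
    ultimately obtain col' where
      col': "proper_on_paths (Suc (1 + Suc i)) lab col' (2 * (log 2 (K * ?L (Suc i)) + 1))"
      using proper_on_paths_reduce[OF lab'] by blast
    have "log 2 (K * ?L (Suc i)) = log 2 K + log 2 (?L (Suc i))"
      using L by (subst log_mult) (auto simp: K_def)
    moreover have "log 2 (?L (Suc i)) = ?L (Suc (Suc i))" by simp
    ultimately have "2 * (log 2 (K * ?L (Suc i)) + 1) = 2 * (log 2 K + ?L (Suc (Suc i)) + 1)" by (simp only:)
    also have "\<dots> \<le> 2 * (6 + real c + max 1 (?L (Suc (Suc i))) + 1)"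
      by (intro mult_left_mono add_mono K max.cobounded2) auto
    also have "\<dots> = (14 + 2 * real c) * 1 + 2 * max 1 (?L (Suc (Suc i)))" by (simp only: distrib_left) simp
    also have "\<dots> \<le> (14 + 2 * real c) * max 1 (?L (Suc (Suc i))) + 2 * max 1 (?L (Suc (Suc i)))"
      by (intro add_right_mono mult_left_mono max.cobounded1) auto
    also have "\<dots> = K * max 1 (?L (Suc (Suc i)))" unfolding K_def distrib_right[symmetric] by simp
    finally have le: "2 * (log 2 (K * ?L (Suc i)) + 1) \<le> K * max 1 (?L (Suc (Suc i)))" .
    have "proper_on_paths (1 + Suc (Suc i)) lab col' (K * max 1 (?L (Suc (Suc i))))"
      using col' order.strict_trans2[OF _ le] by (auto simp: proper_on_paths_def)
    then show ?case by blast
  qed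
  show ?thesis
  proof (cases "log_star n")
    case 0
    then have "n \<le> 1" using log_star_le_one[of n] by simp
    then have "n ^ c \<le> 1" using power_mono[of n 1 c] by simp
    then have le: "real (n ^ c) \<le> 16 + 2 * real c" by linarith
    have "proper_on_paths (1 + log_star n) lab (\<lambda>E e. Min e) (16 + 2 * real c)"
      using Min_col order.strict_trans2[OF _ le] 0 by (auto simp: proper_on_paths_def)
    then show ?thesis by blast
  next
    case (Suc i)
    moreover have "K * max 1 (?L (log_star n)) = K" using log_star_le_one[of n] by simp
    ultimately show ?thesis using step[of i] unfolding K_def by (simp only:)
  qed
qed

text \<open>Path label and colour on the path together separate touching edges. The palette is free
  of \<open>n\<close>, which keeps \<open>n\<close> out of the cost of all later stages.\<close>

lemma exists_initial_coloring:
  assumes deg: "\<And>E v. E \<in> \<G> \<Longrightarrow> card (nbrs E v) \<le> D"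
    and ids: "\<And>E u v. E \<in> \<G> \<Longrightarrow> E u v \<Longrightarrow> u < n ^ c"
  shows "\<exists>\<psi>. loc (1 + log_star n) \<psi> \<and> (\<forall>E\<in>\<G>. \<forall>e\<in>edges E. \<psi> E e < D * D * (16 + 2 * c) \<and>
     (\<forall>e'\<in>touching E e. e' \<noteq> e \<longrightarrow> \<psi> E e' \<noteq> \<psi> E e))"
proof -
  obtain lab where lab: "path_labelling 1 lab" and lab_lt: "\<forall>E\<in>\<G>. \<forall>e\<in>edges E. lab E e < D * D"
    using exists_path_labelling[OF deg] by blast
  obtain col where col: "proper_on_paths (1 + log_star n) lab col (16 + 2 * real c)"
    using proper_on_paths_log_star[OF lab, of n c] ids by blast
  define K where "K = 16 + 2 * c"
  have col_lt: "col E e < K" if "E \<in> \<G>" "e \<in> edges E" for E e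
  proof -
    have "real (col E e) < real K" using col that by (simp add: proper_on_paths_def K_def)
    then show ?thesis by simp
  qed
  define \<psi> where "\<psi> E e = lab E e * K + col E e" for E e
  have "loc (1 + log_star n) lab" "loc (1 + log_star n) col"
    using lab col loc_mono[of 1 lab "1 + log_star n"] by (auto simp: path_labelling_def proper_on_paths_def)
  then have "loc (1 + log_star n) \<psi>"
    using loc_comp2[of _ lab col "\<lambda>e l x. l * K + x"] by (simp add: \<psi>_def[abs_def])
  moreover have "\<psi> E e < D * D * K" if E: "E \<in> \<G>" "e \<in> edges E" for E e
  proof -
    have "(lab E e + 1) * K \<le> D * D * K" using lab_lt E by (intro mult_le_mono1) (simp add: Suc_le_eq)
    then show ?thesis using col_lt[OF E] by (simp add: \<psi>_def)
  qed
  moreover have "\<psi> E e' \<noteq> \<psi> E e" if E: "E \<in> \<G>" "e \<in> edges E" and e': "e' \<in> touching E e" "e' \<noteq> e" for E e e'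
  proof
    assume eq: "\<psi> E e' = \<psi> E e"
    have "e' \<in> edges E" using e'(1) by (simp add: touching_def)
    then have "\<psi> E x div K = lab E x \<and> \<psi> E x mod K = col E x" if "x \<in> {e, e'}" for x
      using that col_lt[OF E(1), of x] E(2) by (auto simp: \<psi>_def)
    then have "lab E e' = lab E e" "col E e' = col E e" using eq by (metis insertCI)+
    then show False using col E e' by (simp add: proper_on_paths_def)
  qed
  ultimately show ?thesis unfolding K_def by blast
qed

end

subsection \<open>Choice of parameters\<close>

lemma exists_floor_root:
  fixes D x :: nat
  shows "\<exists>t. t ^ Suc x \<le> D \<and> D < (t + 1) ^ Suc x"
proof -
  let ?P = "\<lambda>t. D < (t + 1) ^ Suc x"
  have "D + 1 \<le> (D + 1) ^ Suc x" by (rule self_le_power) auto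
  then have ex: "?P D" by (simp only: less_eq_Suc_le Suc_eq_plus1)
  define t where "t = (LEAST t. ?P t)"
  have "?P t" unfolding t_def using ex by (rule LeastI)
  moreover have "t ^ Suc x \<le> D"
  proof (cases t)
    case (Suc t')
    then have "\<not> ?P t'" using not_less_Least[of t' ?P] by (simp add: t_def)
    then show ?thesis using Suc by simp
  qed simp
  ultimately show ?thesis by blast
qed

text \<open>For the case that all factors are \<open>t + 1\<close>, where no palette of size
  \<open>2 * t - 1\<close> can compensate. The induction starts at the cube, since for the square
  the main term falls short by 1; each further factor \<open>2 * t + 1\<close> is at most
  \<open>2 * (t + 1)\<close>. The last summand covers \<open>t = 0\<close>.\<close>

lemma odd_power_le:
  fixes t :: nat
  assumes "2 \<le> x"
  shows "(2 * t + 1) ^ Suc x \<le> 2 ^ Suc x * ((t + 1) ^ x * t) + 2 ^ Suc x"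
proof (cases "t = 0")
  case False
  have "(2 * t + 1) ^ Suc x \<le> 2 ^ Suc x * ((t + 1) ^ x * t)"
    using assms
  proof (induction x rule: dec_induct)
    case base
    have "(2 * t + 1) ^ 3 \<le> 8 * ((t + 1)\<^sup>2 * t)"
      using False by (simp add: power2_eq_square power3_eq_cube algebra_simps)
    then show ?case by (simp add: numeral_3_eq_3)
  next
    case (step x)
    have "(2 * t + 1) ^ Suc (Suc x) \<le> (2 * (t + 1)) * (2 * t + 1) ^ Suc x"
      by (simp only: power_Suc[of _ "Suc x"]) (intro mult_right_mono, auto)
    also have "\<dots> \<le> (2 * (t + 1)) * (2 ^ Suc x * ((t + 1) ^ x * t))"
      using step.IH by (rule mult_left_mono) simp
    also have "\<dots> = 2 ^ Suc (Suc x) * ((t + 1) ^ Suc x * t)" by (simp only: power_Suc mult_ac)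
    finally show ?case .
  qed
  then show ?thesis by simp
qed simp

text \<open>Rounding \<open>D\<close> up to a product of \<open>x + 1\<close> factors \<open>t\<close> and \<open>t + 1\<close> costs no more than what is
  gained by the palettes having odd size \<open>2 * t - 1\<close> and \<open>2 * t + 1\<close>.\<close>
lemma exists_balanced_factors:
  fixes D x :: nat
  assumes x: "1 \<le> x" and D: "1 \<le> D"
  shows "\<exists>t j. 1 \<le> t \<and> t ^ Suc x \<le> D \<and> j \<le> Suc x \<and> D \<le> (t + 1) ^ j * t ^ (Suc x - j) \<and>
    (2 * t + 1) ^ j * (2 * t - 1) ^ (Suc x - j) \<le> 2 ^ Suc x * D"
proof -
  obtain t where t: "t ^ Suc x \<le> D" "D < (t + 1) ^ Suc x" using exists_floor_root by blast
  have t1: "1 \<le> t" using t(2) D by (cases t) auto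
  let ?P = "\<lambda>j. D \<le> (t + 1) ^ j * t ^ (Suc x - j)"
  have PS: "?P (Suc x)" using t(2) by simp
  \<comment> \<open>By minimality the product with one factor \<open>t + 1\<close> fewer is below
    \<open>D\<close>, and integrality turns this into a gain of 1.\<close>
  define j where "j = (LEAST j. ?P j)"
  have Pj: "?P j" unfolding j_def using PS by (rule LeastI)
  have jx: "j \<le> Suc x" unfolding j_def using PS by (rule Least_le)
  have "(2 * t + 1) ^ j * (2 * t - 1) ^ (Suc x - j) \<le> 2 ^ Suc x * D"
  proof (cases j)
    case 0
    have "(2 * t - 1) ^ Suc x \<le> (2 * t) ^ Suc x" by (intro power_mono) auto
    also have "\<dots> = 2 ^ Suc x * t ^ Suc x" by (rule power_mult_distrib)
    also have "\<dots> \<le> 2 ^ Suc x * D" using t(1) by (rule mult_left_mono) simp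
    finally show ?thesis using 0 by simp
  next
    case (Suc i)
    have less: "(t + 1) ^ i * t ^ (Suc x - i) + 1 \<le> D"
      using not_less_Least[of i ?P] Suc by (simp add: j_def)
    show ?thesis
    proof (cases "j = Suc x")
      case True
      then have ix: "i = x" using Suc by simp
      show ?thesis
      proof (cases "x = 1")
        case True
        then have "(t + 1) * t + 1 \<le> D" using less ix by simp
        then have "4 * ((t + 1) * t + 1) \<le> 4 * D" by (rule mult_left_mono) simp
        then show ?thesis using True \<open>j = Suc x\<close> by (simp add: power2_eq_square algebra_simps)
      next
        case False
        then have "(2 * t + 1) ^ Suc x \<le> 2 ^ Suc x * ((t + 1) ^ x * t) + 2 ^ Suc x"
          using x by (intro odd_power_le) simp
        also have "\<dots> = 2 ^ Suc x * ((t + 1) ^ x * t + 1)" by (simp only: distrib_left mult_1_right)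
        also have "\<dots> \<le> 2 ^ Suc x * D" using less ix by (intro mult_left_mono) auto
        finally show ?thesis using \<open>j = Suc x\<close> by simp
      qed
    next
      case False
      then obtain m where m: "Suc x - j = Suc m" using jx by (metis Suc_diff_Suc le_neq_implies_less)
      then have sum: "Suc x = i + (m + 2)" "Suc x - i = m + 2" using Suc jx by auto
      \<comment> \<open>One factor \<open>2 * t + 1\<close> is paired with one
        \<open>2 * t - 1\<close>. Bounding the others by \<open>2 * (t + 1)\<close> and
        \<open>2 * t\<close> leaves the product for \<open>j - 1\<close>, which is below
        \<open>D\<close>.\<close>
      have "(2 * t + 1) * (2 * t - 1) \<le> (2 * t) * (2 * t)" using t1 by (cases t) (auto simp: algebra_simps)
      then have "(2 * t + 1) ^ i * (2 * t - 1) ^ m * ((2 * t + 1) * (2 * t - 1))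
          \<le> (2 * t + 1) ^ i * (2 * t - 1) ^ m * ((2 * t) * (2 * t))" by (rule mult_left_mono) simp
      moreover have "(2 * t + 1) ^ j * (2 * t - 1) ^ (Suc x - j)
          = (2 * t + 1) ^ i * (2 * t - 1) ^ m * ((2 * t + 1) * (2 * t - 1))"
        unfolding m unfolding Suc power_Suc by (simp only: mult_ac)
      ultimately have "(2 * t + 1) ^ j * (2 * t - 1) ^ (Suc x - j)
          \<le> (2 * t + 1) ^ i * (2 * t - 1) ^ m * ((2 * t) * (2 * t))" by (simp only:)
      also have "\<dots> \<le> (2 * (t + 1)) ^ i * (2 * t) ^ m * ((2 * t) * (2 * t))"
        by (intro mult_mono power_mono) auto
      also have "\<dots> = 2 ^ Suc x * ((t + 1) ^ i * t ^ (Suc x - i))"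
        unfolding sum power_add power_mult_distrib by (simp add: power2_eq_square mult_ac)
      also have "\<dots> \<le> 2 ^ Suc x * D" using less by (intro mult_left_mono) auto
      finally show ?thesis .
    qed
  qed
  then show ?thesis using t1 t(1) jx Pj by blast
qed

lemma (in graph_family) loc_proper_edge_coloring:
  fixes x n D c B t q0 q1 :: nat
  assumes deg: "\<And>E v. E \<in> \<G> \<Longrightarrow> card (nbrs E v) \<le> D"
    and ids: "\<And>E u v. E \<in> \<G> \<Longrightarrow> E u v \<Longrightarrow> u < n ^ c"
    and t: "1 \<le> t" "j \<le> Suc x" "D \<le> (t + 1) ^ j * t ^ (Suc x - j)"
    and B: "D * D * (16 + 2 * c) \<le> 2 ^ B" "2 * (t + 1) \<le> 2 ^ B"
    and q0: "2 * (t - 1) \<le> (q0 + 1)\<^sup>2" "q0 \<le> 2 * (t - 1)" and q1: "2 * t \<le> (q1 + 1)\<^sup>2" "q1 \<le> 2 * t"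
  shows "\<exists>\<phi>. loc (1 + log_star n + j * (1000 * B ^ 4 * (q1 + 1) + 1) + (Suc x - j) * (1000 * B ^ 4 * (q0 + 1) + 1)) \<phi> \<and>
    (\<forall>E\<in>\<G>. (\<forall>e\<in>edges E. \<phi> E e < (2 * t + 1) ^ j * (2 * t - 1) ^ (Suc x - j)) \<and>
      (\<forall>e\<in>edges E. \<forall>e'\<in>touching E e. e' \<noteq> e \<longrightarrow> \<phi> E e' \<noteq> \<phi> E e))"
proof -
  have "\<exists>\<psi>. loc (1 + log_star n) \<psi> \<and> (\<forall>E\<in>\<G>. \<forall>e\<in>edges E. \<psi> E e < D * D * (16 + 2 * c) \<and>
     (\<forall>e'\<in>touching E e. e' \<noteq> e \<longrightarrow> \<psi> E e' \<noteq> \<psi> E e))"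
  proof (rule exists_initial_coloring)
    show "card (nbrs E v) \<le> D" if "E \<in> \<G>" for E v using that by (rule deg)
    show "u < n ^ c" if "E \<in> \<G>" "E u v" for E u v using that by (rule ids)
  qed
  then obtain \<psi> where \<psi>: "loc (1 + log_star n) \<psi>" and
    \<psi>_all: "\<forall>E\<in>\<G>. \<forall>e\<in>edges E. \<psi> E e < D * D * (16 + 2 * c) \<and>
      (\<forall>e'\<in>touching E e. e' \<noteq> e \<longrightarrow> \<psi> E e' \<noteq> \<psi> E e)" by (elim exE conjE)
  have \<psi>_small: "\<psi> E e < D * D * (16 + 2 * c)" if "E \<in> \<G>" "e \<in> edges E" for E e
    using \<psi>_all that by simp
  have \<psi>_ne: "\<psi> E e' \<noteq> \<psi> E e" if "E \<in> \<G>" "e \<in> edges E" "e' \<in> touching E e" "e' \<noteq> e" for E e e'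
    using \<psi>_all that by simp
  have \<psi>_lt: "\<psi> E e < 2 ^ B" if "E \<in> \<G>" "e \<in> edges E" for E e using \<psi>_small[OF that] B(1) by linarith
  let ?T1 = "1 + log_star n + j * (1000 * B ^ 4 * (q1 + 1) + 1)"
  \<comment> \<open>A single class of degree at most \<open>D\<close>. The \<open>j\<close> splits
    by \<open>t + 1\<close> and \<open>Suc x - j\<close> splits by \<open>t\<close> bring the class
    degree down to 1, so the classes become matchings.\<close>
  define \<phi>0 where "\<phi>0 = (\<lambda>(E :: nat \<Rightarrow> nat \<Rightarrow> bool) (e :: nat set). 0 :: nat)"
  have \<phi>0: "loc (1 + log_star n) \<phi>0" "\<And>E e. E \<in> \<G> \<Longrightarrow> e \<in> edges E \<Longrightarrow> \<phi>0 E e < 1"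
    "\<And>E v z. E \<in> \<G> \<Longrightarrow> card (class_nbrs E (\<phi>0 E) v z) \<le> (t + 1) ^ j * t ^ (Suc x - j)"
  proof -
    show "loc (1 + log_star n) \<phi>0" unfolding \<phi>0_def by (rule loc_const)
    show "\<phi>0 E e < 1" for E e by (simp add: \<phi>0_def)
    fix E v z assume E: "E \<in> \<G>"
    have "card (class_nbrs E (\<phi>0 E) v z) \<le> card (nbrs E v)"
      using finite_nbrs[OF E] by (intro card_mono) (auto simp: class_nbrs_def nbrs_def)
    then show "card (class_nbrs E (\<phi>0 E) v z) \<le> (t + 1) ^ j * t ^ (Suc x - j)"
      using deg[OF E, of v] t(3) by linarith
  qed
  have "\<exists>\<phi>. loc ?T1 \<phi> \<and> (\<forall>E\<in>\<G>. (\<forall>e\<in>edges E. \<phi> E e < 1 * (2 * (t + 1) - 1) ^ j) \<and>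
      (\<forall>v z. card (class_nbrs E (\<phi> E) v z) \<le> t ^ (Suc x - j)))"
    by (rule split_color_classes_iterate[OF \<phi>0 \<psi> \<psi>_lt \<psi>_ne]) (use B(2) q1 in simp_all)
  then obtain \<phi>1 where \<phi>1: "loc ?T1 \<phi>1"
    "\<And>E e. E \<in> \<G> \<Longrightarrow> e \<in> edges E \<Longrightarrow> \<phi>1 E e < 1 * (2 * (t + 1) - 1) ^ j"
    "\<And>E v z. E \<in> \<G> \<Longrightarrow> card (class_nbrs E (\<phi>1 E) v z) \<le> t ^ (Suc x - j) * 1" unfolding mult_1_right by blast
  have "\<exists>\<phi>. loc (?T1 + (Suc x - j) * (1000 * B ^ 4 * (q0 + 1) + 1)) \<phi> \<and>
      (\<forall>E\<in>\<G>. (\<forall>e\<in>edges E. \<phi> E e < 1 * (2 * (t + 1) - 1) ^ j * (2 * t - 1) ^ (Suc x - j)) \<and>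
      (\<forall>v z. card (class_nbrs E (\<phi> E) v z) \<le> 1))"
    by (rule split_color_classes_iterate[OF \<phi>1 _ \<psi>_lt \<psi>_ne])
      (use t B(2) q0 loc_mono[OF \<psi>] in auto)
  then obtain \<phi> where \<phi>: "loc (?T1 + (Suc x - j) * (1000 * B ^ 4 * (q0 + 1) + 1)) \<phi>"
    "\<And>E e. E \<in> \<G> \<Longrightarrow> e \<in> edges E \<Longrightarrow> \<phi> E e < 1 * (2 * (t + 1) - 1) ^ j * (2 * t - 1) ^ (Suc x - j)"
    "\<And>E v z. E \<in> \<G> \<Longrightarrow> card (class_nbrs E (\<phi> E) v z) \<le> 1" by blast
  have "\<phi> E e' \<noteq> \<phi> E e" if E: "E \<in> \<G>" "e \<in> edges E" and e': "e' \<in> touching E e" "e' \<noteq> e" for E e e'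
  proof
    assume eq: "\<phi> E e' = \<phi> E e"
    obtain v where v: "v \<in> e" "v \<in> e'" using e'(1) by (auto simp: touching_def)
    have other: "\<exists>w. y = {v, w} \<and> E v w" if y: "y \<in> edges E" "v \<in> y" for y
    proof -
      obtain a b where "y = {a, b}" "E a b" using edgesE[OF y(1)] .
      then show ?thesis using y(2) edge_sym[OF E(1)] by (auto simp: insert_commute)
    qed
    obtain w where w: "e = {v, w}" "E v w" using other[OF E(2) v(1)] by blast
    obtain w' where w': "e' = {v, w'}" "E v w'" using other[OF _ v(2)] e'(1) by (auto simp: touching_def)
    have "{w, w'} \<subseteq> class_nbrs E (\<phi> E) v (\<phi> E e)" using w w' eq by (simp add: class_nbrs_def)
    then have "card {w, w'} \<le> card (class_nbrs E (\<phi> E) v (\<phi> E e))"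
      by (intro card_mono finite_class_nbrs[OF E(1)])
    then have "card {w, w'} \<le> 1" using \<phi>(3)[OF E(1), of v "\<phi> E e"] by linarith
    then have "w = w'" by (cases "w = w'") auto
    then show False using e'(2) w w' by simp
  qed
  then show ?thesis using \<phi>(1,2) by (intro exI[of _ \<phi>]) simp
qed

text \<open>For \<open>r = D powr (1 / (2 * x + 2))\<close> one has
  \<open>t \<le> r\<^sup>2\<close>, and \<open>q1\<^sup>2 \<le> 2 * t\<close> gives
  \<open>q1 + 1 \<le> 3 * r\<close>. The constant is \<open>6006 = 2 * 1001 * 3\<close>: the 2 from
  \<open>Suc x \<le> 2 * x\<close>, the 1001 from absorbing the extra round of a split, the 3 from
  \<open>q1\<close>.\<close>

lemma round_bound:
  fixes x D t j q0 q1 c B l :: nat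
  assumes x: "1 \<le> x" and D: "1 \<le> D" and t: "1 \<le> t" "t ^ Suc x \<le> D" "j \<le> Suc x"
    and q: "q1\<^sup>2 \<le> 2 * t" "q0 \<le> q1" and B1: "1 \<le> B"
    and B: "real B \<le> real (21 + 2 * c) * ln (real D + 2)"
  shows "real (1 + l + j * (1000 * B ^ 4 * (q1 + 1) + 1) + (Suc x - j) * (1000 * B ^ 4 * (q0 + 1) + 1))
    \<le> 6006 * real (21 + 2 * c) ^ 4 * real x * (real D powr (1 / (2 * real x + 2))) * (ln (real D + 2)) ^ 4
      + real l + 1"
proof -
  define r where "r = real D powr (1 / (2 * real x + 2))"
  have r1: "1 \<le> r" using D by (simp add: r_def ge_one_powr_ge_zero)
  have "(r\<^sup>2) ^ Suc x = r ^ (2 * Suc x)" by (simp only: power_mult)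
  also have "\<dots> = r powr real (2 * Suc x)" using r1 by (intro powr_realpow[symmetric]) simp
  also have "\<dots> = real D powr (1 / (2 * real x + 2) * real (2 * Suc x))" by (simp only: r_def powr_powr)
  also have "1 / (2 * real x + 2) * real (2 * Suc x) = 1" by (simp add: divide_simps)
  finally have rD: "(r\<^sup>2) ^ Suc x = real D" using D by simp
  have "real t ^ Suc x \<le> (r\<^sup>2) ^ Suc x" unfolding rD using t(2) by (metis of_nat_le_iff of_nat_power)
  then have "real t \<le> r\<^sup>2" by (rule power_le_imp_le_base) simp
  moreover have "real (q1\<^sup>2) \<le> real (2 * t)" using q(1) by (simp only: of_nat_le_iff)
  ultimately have "(real q1)\<^sup>2 \<le> (2 * r)\<^sup>2" by (simp add: power_mult_distrib)
  then have "real q1 \<le> 2 * r" by (rule power2_le_imp_le) (use r1 in simp)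
  then have qr: "real (q1 + 1) \<le> 3 * r" using r1 by simp
  define W where "W = 1001 * B ^ 4 * (q1 + 1)"
  have "1 \<le> B ^ 4" using B1 by simp
  then have "1 * 1 \<le> B ^ 4 * (q1 + 1)" by (intro mult_mono) auto
  then have W1: "1000 * B ^ 4 * (q1 + 1) + 1 \<le> W" by (simp add: W_def algebra_simps)
  have W0: "1000 * B ^ 4 * (q0 + 1) + 1 \<le> W"
    using W1 mult_le_mono2[of "q0 + 1" "q1 + 1" "1000 * B ^ 4"] q(2) by linarith
  have "j * (1000 * B ^ 4 * (q1 + 1) + 1) + (Suc x - j) * (1000 * B ^ 4 * (q0 + 1) + 1)
      \<le> j * W + (Suc x - j) * W"
    using W0 W1 by (intro add_mono mult_le_mono2)
  also have "\<dots> = Suc x * W" using t(3) by (simp add: add_mult_distrib[symmetric])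
  also have "\<dots> \<le> 2 * x * W" using x by (intro mult_le_mono1) simp
  finally have "real (1 + l + j * (1000 * B ^ 4 * (q1 + 1) + 1) + (Suc x - j) * (1000 * B ^ 4 * (q0 + 1) + 1))
      \<le> real (1 + l + 2 * x * W)" by (simp only: of_nat_le_iff add.assoc add_le_cancel_left)
  also have "\<dots> = 2002 * real x * (real B ^ 4 * real (q1 + 1)) + real l + 1" by (simp add: W_def algebra_simps)
  finally have 1: "real (1 + l + j * (1000 * B ^ 4 * (q1 + 1) + 1) + (Suc x - j) * (1000 * B ^ 4 * (q0 + 1) + 1))
      \<le> 2002 * real x * (real B ^ 4 * real (q1 + 1)) + real l + 1" .
  have "real B ^ 4 * real (q1 + 1) \<le> (real (21 + 2 * c) * ln (real D + 2)) ^ 4 * (3 * r)"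
    using B qr by (intro mult_mono power_mono) auto
  then have "2002 * real x * (real B ^ 4 * real (q1 + 1))
      \<le> 2002 * real x * ((real (21 + 2 * c) * ln (real D + 2)) ^ 4 * (3 * r))"
    by (rule mult_left_mono) simp
  also have "\<dots> = 6006 * real (21 + 2 * c) ^ 4 * real x * r * (ln (real D + 2)) ^ 4"
    by (simp only: power_mult_distrib) simp
  finally show ?thesis using 1 unfolding r_def by linarith
qed

text \<open>\<open>B\<close> bits suffice both for the initial palette and for
  \<open>2 * (t + 1)\<close>. As \<open>B\<close> is of order \<open>ln (D + 2)\<close>, it is the
  source of the polylogarithmic factor. The shift by 2 makes this logarithm at least 1, so that it
  absorbs the constants in \<open>c\<close>.\<close>

lemma exists_palette_bits:
  fixes c D :: nat
  assumes "1 \<le> D"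
  shows "\<exists>B. 1 \<le> B \<and> (16 + 2 * c) * (D + 2)\<^sup>2 \<le> 2 ^ B \<and> real B \<le> real (21 + 2 * c) * ln (real D + 2)"
proof -
  define K where "K = 16 + 2 * c"
  define y where "y = log 2 (real K * (real D + 2)\<^sup>2)"
  define B where "B = nat \<lceil>y\<rceil>"
  have pos: "0 < real K" "0 < real D + 2" by (simp_all add: K_def)
  have ln1: "1 \<le> ln (real D + 2)"
  proof -
    have "exp (1::real) \<le> real D + 2" using assms exp_le by simp
    then show ?thesis using pos by (simp add: ln_ge_iff)
  qed
  have "y = log 2 (real K) + 2 * log 2 (real D + 2)"
    using pos by (simp add: y_def log_mult_pos log_nat_power)
  moreover have "log 2 (real K) \<le> real K - 1" by (rule log_2_le_minus_one) (simp add: K_def)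
  moreover have "log 2 (real D + 2) \<le> 2 * ln (real D + 2)"
  proof -
    have "ln (real D + 2) * (1 / 2) \<le> ln (real D + 2) * ln 2"
      using half_le_ln_2 ln1 by (intro mult_left_mono) auto
    then show ?thesis by (simp add: log_def divide_le_eq mult.commute)
  qed
  ultimately have "y + 1 \<le> real K + 4 * ln (real D + 2)" by linarith
  moreover have "real K * 1 \<le> real K * ln (real D + 2)" using ln1 by (intro mult_left_mono) auto
  ultimately have y_le: "y + 1 \<le> (real K + 4) * ln (real D + 2)" by (simp add: algebra_simps)
  have "1 < real K * (real D + 2)\<^sup>2"
  proof -
    have "1 * 1 < real K * (real D + 2)\<^sup>2" by (intro mult_less_le_imp_less) (auto simp: K_def)
    then show ?thesis by simp
  qed
  then have y0: "0 < y" by (simp add: y_def)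
  then have B: "y \<le> real B" "real B < y + 1" unfolding B_def by linarith+
  have "real K * (real D + 2)\<^sup>2 = 2 powr y" using pos by (simp add: y_def)
  also have "\<dots> \<le> 2 powr real B" using B by (intro powr_mono) auto
  finally have "real K * (real D + 2)\<^sup>2 \<le> 2 ^ B" by (simp add: powr_realpow)
  moreover have "real (K * (D + 2)\<^sup>2) = real K * (real D + 2)\<^sup>2" by simp
  ultimately have "real (K * (D + 2)\<^sup>2) \<le> real (2 ^ B)" by (simp only: of_nat_power of_nat_numeral)
  then have "K * (D + 2)\<^sup>2 \<le> 2 ^ B" by (simp only: of_nat_le_iff)
  moreover have "1 \<le> B" using B(1) y0 by linarith
  moreover have "real B \<le> real (21 + 2 * c) * ln (real D + 2)"
  proof -
    have "real B \<le> (real K + 4) * ln (real D + 2)" using B(2) y_le by linarith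
    also have "\<dots> \<le> real (21 + 2 * c) * ln (real D + 2)" using ln1 by (intro mult_right_mono) (auto simp: K_def)
    finally show ?thesis .
  qed
  ultimately show ?thesis unfolding K_def by blast
qed

section \<open>Assembling the algorithm\<close>

lemma exists_edge_coloring_alg:
  fixes x n D c :: nat
  assumes x: "1 \<le> x" and D: "1 \<le> D"
  shows "\<exists>(A::local_alg) (T::nat).
           real T \<le> 6006 * real (21 + 2 * c) ^ 4 * real x * (real D powr (1 / (2 * real x + 2))) * (ln (real D + 2)) ^ 4
                     + real (log_star n) + 1
         \<and> (\<forall>V E. simple_graph V E \<and> card V = n \<and> V \<subseteq> {..< n ^ c} \<and> max_degree_is V E D
              \<longrightarrow> proper_edge_coloring E (edge_col A E T) (2 ^ (x + 1) * D))"
proof -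
  \<comment> \<open>All graphs with the globally known parameters \<open>n\<close>, \<open>c\<close>
    and \<open>D\<close>; locality over this family yields one algorithm for all of them.\<close>
  define \<G> where "\<G> = {E. \<exists>V. simple_graph V E \<and> card V = n \<and> V \<subseteq> {..< n ^ c} \<and> max_degree_is V E D}"
  interpret graph_family \<G> by unfold_locales (auto simp: \<G>_def)
  obtain t j where t: "1 \<le> t" "t ^ Suc x \<le> D" "j \<le> Suc x" "D \<le> (t + 1) ^ j * t ^ (Suc x - j)"
    and colors: "(2 * t + 1) ^ j * (2 * t - 1) ^ (Suc x - j) \<le> 2 ^ Suc x * D"
    using exists_balanced_factors[OF x D] by blast
  obtain B where B: "1 \<le> B" "(16 + 2 * c) * (D + 2)\<^sup>2 \<le> 2 ^ B" "real B \<le> real (21 + 2 * c) * ln (real D + 2)"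
    using exists_palette_bits[OF D] by blast
  obtain q1 where q1: "q1\<^sup>2 \<le> 2 * t" "2 * t < (q1 + 1)\<^sup>2"
    using exists_floor_root[of 1 "2 * t"] by (auto simp: numeral_2_eq_2)
  obtain q0 where q0: "q0\<^sup>2 \<le> 2 * (t - 1)" "2 * (t - 1) < (q0 + 1)\<^sup>2"
    using exists_floor_root[of 1 "2 * (t - 1)"] by (auto simp: numeral_2_eq_2)
  have sq: "q \<le> q\<^sup>2" for q :: nat by (cases q) (auto simp: power2_eq_square)
  have "q0\<^sup>2 < (q1 + 1)\<^sup>2" using q0(1) q1(2) by linarith
  then have "q0 \<le> q1" by (simp add: power2_less_imp_less less_Suc_eq_le[symmetric])
  have deg: "card (nbrs E v) \<le> D" if E: "E \<in> \<G>" for E v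
  proof -
    obtain V where V: "simple_graph V E" "max_degree_is V E D" using E by (auto simp: \<G>_def)
    show ?thesis
    proof (cases "v \<in> V")
      case False
      then have "nbrs E v = {}" using V(1) by (auto simp: nbrs_def simple_graph_def)
      then show ?thesis by simp
    qed (use V(2) in \<open>auto simp: max_degree_is_def degree_def\<close>)
  qed
  have ids: "u < n ^ c" if "E \<in> \<G>" "E u v" for E u v
    using that by (auto simp: \<G>_def simple_graph_def)
  have tD: "t \<le> D"
    by (rule order_trans[OF self_le_power[OF t(1)] t(2)]) simp
  have "2 * (t + 1) \<le> 16 * (D + 2)\<^sup>2" using tD by (simp add: power2_eq_square algebra_simps)
  also have "\<dots> \<le> (16 + 2 * c) * (D + 2)\<^sup>2" by (rule mult_le_mono1) simp
  finally have Bt: "2 * (t + 1) \<le> 2 ^ B" using B(2) by simp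
  have "D * D \<le> (D + 2)\<^sup>2" unfolding power2_eq_square by (intro mult_le_mono) auto
  then have "(16 + 2 * c) * (D * D) \<le> (16 + 2 * c) * (D + 2)\<^sup>2" by (rule mult_le_mono2)
  then have BD: "D * D * (16 + 2 * c) \<le> 2 ^ B"
    unfolding mult.commute[of "D * D"] using B(2) by (rule order_trans)
  define T where "T = 1 + log_star n + j * (1000 * B ^ 4 * (q1 + 1) + 1) + (Suc x - j) * (1000 * B ^ 4 * (q0 + 1) + 1)"
  have "\<exists>\<phi>. loc T \<phi> \<and>
    (\<forall>E\<in>\<G>. (\<forall>e\<in>edges E. \<phi> E e < (2 * t + 1) ^ j * (2 * t - 1) ^ (Suc x - j)) \<and>
      (\<forall>e\<in>edges E. \<forall>e'\<in>touching E e. e' \<noteq> e \<longrightarrow> \<phi> E e' \<noteq> \<phi> E e))"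
    unfolding T_def
  proof (rule loc_proper_edge_coloring[OF _ _ t(1,3,4) BD Bt])
    show "card (nbrs E v) \<le> D" if "E \<in> \<G>" for E v using that by (rule deg)
    show "u < n ^ c" if "E \<in> \<G>" "E u v" for E u v using that by (rule ids)
    show "2 * (t - 1) \<le> (q0 + 1)\<^sup>2" "2 * t \<le> (q1 + 1)\<^sup>2" using q0(2) q1(2) by linarith+
    show "q0 \<le> 2 * (t - 1)" using sq[of q0] q0(1) by linarith
    show "q1 \<le> 2 * t" using sq[of q1] q1(1) by linarith
  qed
  then obtain \<phi> where \<phi>: "loc T \<phi>" and
    \<phi>_all: "\<forall>E\<in>\<G>. (\<forall>e\<in>edges E. \<phi> E e < (2 * t + 1) ^ j * (2 * t - 1) ^ (Suc x - j)) \<and>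
      (\<forall>e\<in>edges E. \<forall>e'\<in>touching E e. e' \<noteq> e \<longrightarrow> \<phi> E e' \<noteq> \<phi> E e)" by (elim exE conjE)
  have \<phi>_lt: "\<phi> E e < (2 * t + 1) ^ j * (2 * t - 1) ^ (Suc x - j)" if "E \<in> \<G>" "e \<in> edges E" for E e
    using \<phi>_all that by simp
  have \<phi>_ne: "\<phi> E e' \<noteq> \<phi> E e" if "E \<in> \<G>" "e \<in> edges E" "e' \<in> touching E e" "e' \<noteq> e" for E e e'
    using \<phi>_all that by simp
  obtain A where A: "\<And>E u v. E \<in> \<G> \<Longrightarrow> E u v \<Longrightarrow> edge_col A E T u v = \<phi> E {u, v}"
    using loc_imp_local_alg[OF \<phi>] by blast
  have proper: "proper_edge_coloring E (edge_col A E T) (2 ^ (x + 1) * D)" if E: "E \<in> \<G>" for E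
    unfolding proper_edge_coloring_def
  proof (intro conjI allI impI)
    fix u v assume uv: "E u v"
    then have vu: "E v u" using edge_sym[OF E] by blast
    show "edge_col A E T u v = edge_col A E T v u"
      using A[OF E uv] A[OF E vu] by (simp add: insert_commute)
    have "\<phi> E {u, v} < (2 * t + 1) ^ j * (2 * t - 1) ^ (Suc x - j)"
      using \<phi>_lt[OF E] edge_iff[OF E] uv by blast
    then show "edge_col A E T u v < 2 ^ (x + 1) * D" using A[OF E uv] colors by simp
  next
    fix v u w assume "E v u \<and> E v w \<and> u \<noteq> w"
    then have h: "E v u" "E v w" "u \<noteq> w" by auto
    have "{v, u} \<in> edges E" "{v, w} \<in> edges E" using h edge_iff[OF E] by auto
    then have "{v, u} \<in> touching E {v, w}" by (simp add: touching_def)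
    moreover have "{v, u} \<noteq> {v, w}" using h(3) by (auto simp: doubleton_eq_iff)
    ultimately show "edge_col A E T v u \<noteq> edge_col A E T v w"
      using A[OF E h(1)] A[OF E h(2)] \<phi>_ne[OF E \<open>{v, w} \<in> edges E\<close>] by simp
  qed
  show ?thesis
  proof (rule exI[of _ A], rule exI[of _ T], intro conjI allI impI)
    show "real T \<le> 6006 * real (21 + 2 * c) ^ 4 * real x * (real D powr (1 / (2 * real x + 2))) * (ln (real D + 2)) ^ 4
        + real (log_star n) + 1"
      unfolding T_def by (rule round_bound[OF x D t(1-3) q1(1) \<open>q0 \<le> q1\<close> B(1,3)])
    fix V E assume "simple_graph V E \<and> card V = n \<and> V \<subseteq> {..< n ^ c} \<and> max_degree_is V E D"
    then have "E \<in> \<G>" by (auto simp: \<G>_def)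
    then show "proper_edge_coloring E (edge_col A E T) (2 ^ (x + 1) * D)" by (rule proper)
  qed
qed

theorem mainTheorem10:
  "\<forall>c::nat. c \<ge> 1 \<longrightarrow>
    (\<exists>(C::real) (k::nat). C > 0 \<and>
      (\<forall>(x::nat) (n::nat) (D::nat). x \<ge> 1 \<longrightarrow>
        (\<exists>(A::local_alg) (T::nat).
           real T \<le> C * real x * (real D powr (1 / (2 * real x + 2))) * (ln (real D + 2)) ^ k
                     + C * real (log_star n) + C
         \<and> (\<forall>V E. simple_graph V E \<and> card V = n \<and> V \<subseteq> {..< n ^ c} \<and> max_degree_is V E D
              \<longrightarrow> proper_edge_coloring E (edge_col A E T) (2 ^ (x + 1) * D)))))"
proof (intro allI impI)
  fix c :: nat
  define C where "C = 6006 * real (21 + 2 * c) ^ 4"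
  have "(1::real) \<le> real (21 + 2 * c) ^ 4" by (intro one_le_power) simp
  then have C: "1 \<le> C" unfolding C_def by linarith
  show "\<exists>(C::real) (k::nat). C > 0 \<and>
      (\<forall>(x::nat) (n::nat) (D::nat). x \<ge> 1 \<longrightarrow>
        (\<exists>(A::local_alg) (T::nat).
           real T \<le> C * real x * (real D powr (1 / (2 * real x + 2))) * (ln (real D + 2)) ^ k
                     + C * real (log_star n) + C
         \<and> (\<forall>V E. simple_graph V E \<and> card V = n \<and> V \<subseteq> {..< n ^ c} \<and> max_degree_is V E D
              \<longrightarrow> proper_edge_coloring E (edge_col A E T) (2 ^ (x + 1) * D))))"
  proof (intro exI[of _ C] exI[of _ "4::nat"] conjI allI impI)
    show "0 < C" using C by simp
    fix x n D :: nat assume x: "1 \<le> x"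
    show "\<exists>(A::local_alg) (T::nat).
           real T \<le> C * real x * (real D powr (1 / (2 * real x + 2))) * (ln (real D + 2)) ^ 4
                     + C * real (log_star n) + C
         \<and> (\<forall>V E. simple_graph V E \<and> card V = n \<and> V \<subseteq> {..< n ^ c} \<and> max_degree_is V E D
              \<longrightarrow> proper_edge_coloring E (edge_col A E T) (2 ^ (x + 1) * D))"
    \<comment> \<open>For \<open>D = 0\<close> the term with \<open>powr\<close> vanishes and there
      is no edge to colour, so any algorithm stopped after 0 rounds will do.\<close>
    proof (cases "D = 0")
      case True
      have no_edge: "\<not> E u v" if "simple_graph V E" "max_degree_is V E D" for V E u v
      proof
        assume uv: "E u v"
        then have "finite (nbrs E u)" "u \<in> V"
          using that(1) finite_subset[of "nbrs E u" V] by (auto simp: simple_graph_def nbrs_def)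
        moreover have "v \<in> nbrs E u" using uv by (simp add: nbrs_def)
        ultimately have "0 < card (nbrs E u)" by (auto simp: card_gt_0_iff)
        then show False using that(2) \<open>u \<in> V\<close> True by (auto simp: max_degree_is_def degree_def)
      qed
      show ?thesis
      proof (rule exI[of _ undefined], rule exI[of _ 0], intro conjI allI impI)
        show "real 0 \<le> C * real x * (real D powr (1 / (2 * real x + 2))) * (ln (real D + 2)) ^ 4
            + C * real (log_star n) + C" using True C by simp
        fix V E assume "simple_graph V E \<and> card V = n \<and> V \<subseteq> {..< n ^ c} \<and> max_degree_is V E D"
        then have "\<not> E u v" for u v using no_edge by blast
        then show "proper_edge_coloring E (edge_col undefined E 0) (2 ^ (x + 1) * D)"
          by (simp add: proper_edge_coloring_def)
      qed
    next
      case False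
      then have "1 \<le> D" by simp
      from exists_edge_coloring_alg[OF x this, of c n] obtain A T where
        T: "real T \<le> C * real x * (real D powr (1 / (2 * real x + 2))) * (ln (real D + 2)) ^ 4 + real (log_star n) + 1"
        and A: "\<forall>V E. simple_graph V E \<and> card V = n \<and> V \<subseteq> {..< n ^ c} \<and> max_degree_is V E D
              \<longrightarrow> proper_edge_coloring E (edge_col A E T) (2 ^ (x + 1) * D)"
        unfolding C_def by blast
      have "1 * real (log_star n) \<le> C * real (log_star n)" using C by (rule mult_right_mono) simp
      then have "real T \<le> C * real x * (real D powr (1 / (2 * real x + 2))) * (ln (real D + 2)) ^ 4
          + C * real (log_star n) + C"
        using T C by linarith
      then show ?thesis by (intro exI[of _ A], intro exI[of _ T]) (rule conjI[OF _ A])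
    qed
  qed
qed

end
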